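(* Let $T>0$, let $a$ and $f$ (together with the boundary conditions) satisfy the assumptions $(Deg)$ and $(SL)$ listed in the context, and let $\alpha\in L^\infty(Q_T)$ be piecewise static. Let $u_0\in L^2(-1,1)$ be such that $u_0(x)\ge 0$ for a.e. $x\in(-1,1)$, and let $u$ be the corresponding unique strong solution of problem (P). Then $$u(x,t)\ge 0\qquad\text{for a.e. }(x,t)\in Q_T .$$
   Context: Let $T>0$ and $Q_T=(-1,1)\times(0,T)$. **Problem (P).** $u_t-(a(x)u_x)_x=\alpha(x,t)u+f(x,t,u)$ in $Q_T$, $u(x,0)=u_0(x)$, with boundary conditions - in the case $(WDeg)$: $\beta_0u(-1,t)+\beta_1a(-1)u_x(-1,t)=0$ and $\gamma_0u(1,t)+\gamma_1a(1)u_x(1,t)=0$ for $t\in(0,T)$; - in the case $(SDeg)$: $a(x)u_x(x,t)|_{x=\pm1}=0$ for $t\in(0,T)$. Here $a(\pm1)u_x(\pm1,t)$ denotes the boundary value (limit) of the function $a u_x$ at $\pm1$. **Assumption $(Deg)$.** $a\in C([-1,1])\cap C^1(-1,1)$, $a>0$ on $(-1,1)$, $a(-1)=a(1)=0$, and one of the following two alternatives holds: - $(WDeg)$: $1/a\in L^1(-1,1)$; then $\vartheta_{sup}=4$, and $\beta_0,\beta_1,\gamma_0,\gamma_1\in\mathbb R$ satisfy $\beta_0^2+\beta_1^2>0$, $\gamma_0^2+\gamma_1^2>0$, $\beta_0\beta_1\le0$, $\gamma_0\gamma_1\ge0$; - $(SDeg)$: $1/a\notin L^1(-1,1)$ and $\xi_a(x):=\int_0^x\frac{ds}{a(s)}$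 belongs to $L^{q_\vartheta}(-1,1)$ with $q_\vartheta=\max\{\frac{1+\vartheta}{3-\vartheta},2\vartheta-1\}$; then $\vartheta_{sup}=3$. **Assumption $(SL)$.** $f:Q_T\times\mathbb R\to\mathbb R$ is such that: $(x,t)\mapsto f(x,t,u)$ is measurable for every $u$, and $u\mapsto f(x,t,u)$ is continuous for a.e. $(x,t)$; and there are constants $\delta_*\ge0$, $\vartheta\in[1,\vartheta_{sup})$, $\nu\ge0$ such that - $t\mapsto f(x,t,u)$ is locally absolutely continuous for a.e. $x$ and every $u\in\mathbb R$, and $f_t(x,t,u)u\ge-\nu u^2$ for a.e. $t\in(0,T)$; - for a.e. $(x,t)\in Q_T$ and all $u,v\in\mathbb R$: $|f(x,t,u)|\le\delta_*|u|^\vartheta$ and $-\nu(1+|u|^{\vartheta-1}+|v|^{\vartheta-1})(u-v)^2\le(f(x,t,u)-f(x,t,v))(u-v)\le\nu(u-v)^2$. **Piecewise static.** $\alpha\in L^\infty(Q_T)$ is piecewise static ($m$-steps) if there are $m\in\mathbb N$, $0=t_0<t_1<\dots<t_m=T$ and $\alpha_1,\dots,\alpha_m\in L^\infty(-1,1)$ with $\alpha(x,t)=\alpha_1(x)\mathbf 1_{[t_0,t_1]}(t)+\sum_{k=2}^m\alpha_k(x)\mathbf 1_{(t_{k-1},t_k]}(t)$. **Spaces.** $H^1_a(-1,1)$ is the set of $u\in L^2(-1,1)$ with $\sqrt a\,u_x\in L^2(-1,1)$ that are absolutely continuous on $[-1,1]$ in the case $(WDeg)$, respectively locally absolutely continuous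 on $(-1,1)$ in the case $(SDeg)$; $\|u\|_{1,a}^2=\|u\|_{L^2}^2+\|\sqrt a u_x\|_{L^2}^2$. $H^2_a(-1,1)=\{u\in H^1_a(-1,1): au_x\in H^1(-1,1)\}$, with $\|u\|_{2,a}^2=\|u\|_{1,a}^2+\|(au_x)_x\|_{L^2}^2$. $D(A_0)$ is $H^2_a(-1,1)$ in the case $(SDeg)$, and in the case $(WDeg)$ it is the set of $u\in H^2_a(-1,1)$ with $\beta_0u(-1)+\beta_1a(-1)u_x(-1)=0$ and $\gamma_0u(1)+\gamma_1a(1)u_x(1)=0$. $\mathcal B(Q_T)=C([0,T];L^2(-1,1))\cap L^2(0,T;H^1_a(-1,1))$ with norm $\|u\|_{\mathcal B(Q_T)}^2=\sup_{t\in[0,T]}\|u(\cdot,t)\|_{L^2}^2+2\int_0^T\int_{-1}^1a u_x^2\,dx\,dt$. $\mathcal H(Q_T)=L^2(0,T;D(A_0))\cap H^1(0,T;L^2(-1,1))\cap C([0,T];H^1_a(-1,1))$. **Solutions.** For $u_0\in H^1_a(-1,1)$, a strict solution of (P) is $u\in\mathcal H(Q_T)$ satisfying the equation a.e. in $Q_T$, the boundary conditions for a.e. $t\in(0,T)$, and $u(\cdot,0)=u_0$. For $u_0\in L^2(-1,1)$, a strong solution of (P) is $u\in\mathcal B(Q_T)$ with $u(\cdot,0)=u_0$ for which there is a sequence $(u_k)$ in $\mathcal H(Q_T)$ with $u_k\to u$ in $\mathcal B(Q_T)$, each $u_k$ being the strict solution of (P) with initial datum $u_k(\cdot,0)$.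 *)

theory Defs
  imports "HOL-Analysis.Analysis"
begin

section \<open>Functions on an interval\<close>

abbreviation Om :: "real set"
  where "Om \<equiv> {-1<..<1}"

abbreviation QT :: "real \<Rightarrow> (real \<times> real) set"
  where "QT T \<equiv> Om \<times> {0<..<T}"

definition square_integrable :: "'a measure \<Rightarrow> ('a \<Rightarrow> real) \<Rightarrow> bool"
  where "square_integrable M g \<longleftrightarrow> g \<in> borel_measurable M \<and> integrable M (\<lambda>x. (g x)\<^sup>2)"

definition ess_bounded :: "'a measure \<Rightarrow> ('a \<Rightarrow> real) \<Rightarrow> bool"
  where "ess_bounded M g \<longleftrightarrow> g \<in> borel_measurable M \<and> (\<exists>C. AE x in M. \<bar>g x\<bar> \<le> C)"

definition L2 :: "(real \<Rightarrow> real) set"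
  where "L2 = {g. square_integrable (lebesgue_on Om) g}"

definition norm_L2 :: "(real \<Rightarrow> real) \<Rightarrow> real"
  where "norm_L2 g = sqrt (LINT x|lebesgue_on Om. (g x)\<^sup>2)"

definition abs_cont_on :: "real set \<Rightarrow> (real \<Rightarrow> real) \<Rightarrow> bool"
  where "abs_cont_on S g \<longleftrightarrow>
    (\<forall>\<epsilon>>0. \<exists>\<delta>>0. \<forall>(n::nat) l r.
       (\<forall>i<n. l i \<le> r i \<and> {l i..r i} \<subseteq> S) \<longrightarrow>
       (\<forall>i<n. \<forall>j<n. i \<noteq> j \<longrightarrow> {l i<..<r i} \<inter> {l j<..<r j} = {}) \<longrightarrow>
       (\<Sum>i<n. r i - l i) < \<delta> \<longrightarrow>
       (\<Sum>i<n. \<bar>g (r i) - g (l i)\<bar>) < \<epsilon>)"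

definition loc_abs_cont_on :: "real set \<Rightarrow> (real \<Rightarrow> real) \<Rightarrow> bool"
  where "loc_abs_cont_on S g \<longleftrightarrow> (\<forall>c d. {c..d} \<subseteq> S \<longrightarrow> abs_cont_on {c..d} g)"

text \<open>Below, the derivative \<open>u\<^sub>x\<close> of a (locally) absolutely continuous function is the pointwise
  derivative, which exists almost everywhere. The existence almost everywhere, automatic by
  Lebesgue's theorem, is recorded explicitly next to each absolute continuity requirement, because
  \<^const>\<open>deriv\<close> has an arbitrary value at points of non-differentiability.\<close>

definition ae_differentiable_on :: "real set \<Rightarrow> (real \<Rightarrow> real) \<Rightarrow> bool"
  where "ae_differentiable_on S g \<longleftrightarrow> (AE x in lebesgue_on S. g differentiable (at x))"

text \<open>\<open>H\<^sup>1(-1,1)\<close> as a set of functions modulo equality a.e. The absolutely continuous representative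
  \<open>w\<close> is existential: \<open>a u\<^sub>x\<close> is only determined on the open interval, and since
  \<open>a(-1) = a(1) = 0\<close>, the literal product \<open>a x * deriv u x\<close> is \<open>0\<close> at the end points, which need not be
  the limit there.\<close>

definition H1 :: "(real \<Rightarrow> real) set"
  where "H1 = {g. g \<in> L2 \<and>
    (\<exists>w. (AE x in lebesgue_on Om. g x = w x) \<and> abs_cont_on {-1..1} w \<and>
         ae_differentiable_on Om w \<and> deriv w \<in> L2)}"

section \<open>The degenerate coefficient and the weighted spaces\<close>

definition weakly_degenerate :: "(real \<Rightarrow> real) \<Rightarrow> bool"
  where "weakly_degenerate a \<longleftrightarrow> integrable (lebesgue_on Om) (\<lambda>x. 1 / a x)"

definition theta_sup :: "(real \<Rightarrow> real) \<Rightarrow> real"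
  where "theta_sup a = (if weakly_degenerate a then 4 else 3)"

definition xi :: "(real \<Rightarrow> real) \<Rightarrow> real \<Rightarrow> real"
  where "xi a x = (LBINT s=0..x. 1 / a s)"

definition q_theta :: "real \<Rightarrow> real"
  where "q_theta \<theta> = max ((1 + \<theta>) / (3 - \<theta>)) (2 * \<theta> - 1)"

definition assumption_Deg ::
    "(real \<Rightarrow> real) \<Rightarrow> real \<Rightarrow> real \<Rightarrow> real \<Rightarrow> real \<Rightarrow> real \<Rightarrow> bool"
  where "assumption_Deg a \<beta>\<^sub>0 \<beta>\<^sub>1 \<gamma>\<^sub>0 \<gamma>\<^sub>1 \<theta> \<longleftrightarrow>
    continuous_on {-1..1} a \<and> a C1_differentiable_on Om \<and>
    (\<forall>x\<in>Om. a x > 0) \<and> a (-1) = 0 \<and> a 1 = 0 \<and>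
    (if weakly_degenerate a
     then \<beta>\<^sub>0\<^sup>2 + \<beta>\<^sub>1\<^sup>2 > 0 \<and> \<gamma>\<^sub>0\<^sup>2 + \<gamma>\<^sub>1\<^sup>2 > 0 \<and> \<beta>\<^sub>0 * \<beta>\<^sub>1 \<le> 0 \<and> \<gamma>\<^sub>0 * \<gamma>\<^sub>1 \<ge> 0
     else xi a \<in> borel_measurable (lebesgue_on Om) \<and>
          integrable (lebesgue_on Om) (\<lambda>x. \<bar>xi a x\<bar> powr q_theta \<theta>))"

definition H1a :: "(real \<Rightarrow> real) \<Rightarrow> (real \<Rightarrow> real) set"
  where "H1a a = {u. u \<in> L2 \<and>
    (if weakly_degenerate a then abs_cont_on {-1..1} u else loc_abs_cont_on Om u) \<and>
    ae_differentiable_on Om u \<and> (\<lambda>x. sqrt (a x) * deriv u x) \<in> L2}"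

definition norm_1a :: "(real \<Rightarrow> real) \<Rightarrow> (real \<Rightarrow> real) \<Rightarrow> real"
  where "norm_1a a u = sqrt ((norm_L2 u)\<^sup>2 + (norm_L2 (\<lambda>x. sqrt (a x) * deriv u x))\<^sup>2)"

definition flux :: "(real \<Rightarrow> real) \<Rightarrow> (real \<Rightarrow> real) \<Rightarrow> real \<Rightarrow> real"
  where "flux a u x = a x * deriv u x"

definition H2a :: "(real \<Rightarrow> real) \<Rightarrow> (real \<Rightarrow> real) set"
  where "H2a a = {u \<in> H1a a. flux a u \<in> H1}"

definition norm_2a :: "(real \<Rightarrow> real) \<Rightarrow> (real \<Rightarrow> real) \<Rightarrow> real"
  where "norm_2a a u = sqrt ((norm_1a a u)\<^sup>2 + (norm_L2 (deriv (flux a u)))\<^sup>2)"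

definition robin_bc ::
    "(real \<Rightarrow> real) \<Rightarrow> real \<Rightarrow> real \<Rightarrow> real \<Rightarrow> real \<Rightarrow> (real \<Rightarrow> real) \<Rightarrow> bool"
  where "robin_bc a \<beta>\<^sub>0 \<beta>\<^sub>1 \<gamma>\<^sub>0 \<gamma>\<^sub>1 u \<longleftrightarrow>
    (\<exists>l. (flux a u \<longlongrightarrow> l) (at_right (-1)) \<and> \<beta>\<^sub>0 * u (-1) + \<beta>\<^sub>1 * l = 0) \<and>
    (\<exists>l. (flux a u \<longlongrightarrow> l) (at_left 1) \<and> \<gamma>\<^sub>0 * u 1 + \<gamma>\<^sub>1 * l = 0)"

definition boundary_conditions ::
    "(real \<Rightarrow> real) \<Rightarrow> real \<Rightarrow> real \<Rightarrow> real \<Rightarrow> real \<Rightarrow> (real \<Rightarrow> real) \<Rightarrow> bool"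
  where "boundary_conditions a \<beta>\<^sub>0 \<beta>\<^sub>1 \<gamma>\<^sub>0 \<gamma>\<^sub>1 u \<longleftrightarrow>
    (if weakly_degenerate a then robin_bc a \<beta>\<^sub>0 \<beta>\<^sub>1 \<gamma>\<^sub>0 \<gamma>\<^sub>1 u
     else (flux a u \<longlongrightarrow> 0) (at_right (-1)) \<and> (flux a u \<longlongrightarrow> 0) (at_left 1))"

definition DA0 ::
    "(real \<Rightarrow> real) \<Rightarrow> real \<Rightarrow> real \<Rightarrow> real \<Rightarrow> real \<Rightarrow> (real \<Rightarrow> real) set"
  where "DA0 a \<beta>\<^sub>0 \<beta>\<^sub>1 \<gamma>\<^sub>0 \<gamma>\<^sub>1 =
    {u \<in> H2a a. weakly_degenerate a \<longrightarrow> robin_bc a \<beta>\<^sub>0 \<beta>\<^sub>1 \<gamma>\<^sub>0 \<gamma>\<^sub>1 u}"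

section \<open>The nonlinearity and the multiplicative coefficient\<close>

text \<open>\<open>s\<^sup>p\<close> for \<open>s, p \<ge> 0\<close> with \<open>0\<^sup>0 = 1\<close>; \<^const>\<open>powr\<close> has \<open>0 powr 0 = 0\<close>, which would matter
  for \<open>\<bar>u\<bar>\<close> to the power \<open>\<theta> - 1\<close> when \<open>\<theta> = 1\<close>.\<close>

definition rpow :: "real \<Rightarrow> real \<Rightarrow> real"
  where "rpow s p = (if p = 0 then 1 else s powr p)"

definition assumption_SL ::
    "real \<Rightarrow> (real \<Rightarrow> real) \<Rightarrow> (real \<Rightarrow> real \<Rightarrow> real \<Rightarrow> real) \<Rightarrow> real \<Rightarrow> real \<Rightarrow> real \<Rightarrow> bool"
  where "assumption_SL T a f \<delta> \<theta> \<nu> \<longleftrightarrow>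
    \<delta> \<ge> 0 \<and> 1 \<le> \<theta> \<and> \<theta> < theta_sup a \<and> \<nu> \<ge> 0 \<and>
    (\<forall>v. (\<lambda>(x,t). f x t v) \<in> borel_measurable (lebesgue_on (QT T))) \<and>
    (AE (x,t) in lebesgue_on (QT T). continuous_on UNIV (f x t)) \<and>
    (AE x in lebesgue_on Om. \<forall>v.
       loc_abs_cont_on {0<..<T} (\<lambda>t. f x t v) \<and>
       ae_differentiable_on {0<..<T} (\<lambda>t. f x t v) \<and>
       (AE t in lebesgue_on {0<..<T}. deriv (\<lambda>s. f x s v) t * v \<ge> - \<nu> * v\<^sup>2)) \<and>
    (AE (x,t) in lebesgue_on (QT T). \<forall>v w.
       \<bar>f x t v\<bar> \<le> \<delta> * rpow \<bar>v\<bar> \<theta> \<and>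
       - \<nu> * (1 + rpow \<bar>v\<bar> (\<theta> - 1) + rpow \<bar>w\<bar> (\<theta> - 1)) * (v - w)\<^sup>2
          \<le> (f x t v - f x t w) * (v - w) \<and>
       (f x t v - f x t w) * (v - w) \<le> \<nu> * (v - w)\<^sup>2)"

definition piecewise_static :: "real \<Rightarrow> (real \<Rightarrow> real \<Rightarrow> real) \<Rightarrow> bool"
  where "piecewise_static T \<alpha> \<longleftrightarrow>
    ess_bounded (lebesgue_on (QT T)) (\<lambda>(x,t). \<alpha> x t) \<and>
    (\<exists>(m::nat) (\<tau>::nat \<Rightarrow> real) (A::nat \<Rightarrow> real \<Rightarrow> real).
       m \<ge> 1 \<and> \<tau> 0 = 0 \<and> \<tau> m = T \<and> (\<forall>k<m. \<tau> k < \<tau> (Suc k)) \<and>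
       (\<forall>k\<in>{1..m}. ess_bounded (lebesgue_on Om) (A k)) \<and>
       (AE (x,t) in lebesgue_on (QT T).
          \<alpha> x t = A 1 x * indicator {\<tau> 0..\<tau> 1} t
                  + (\<Sum>k=2..m. A k x * indicator {\<tau> (k - 1)<..\<tau> k} t)))"

section \<open>Spaces of functions of space and time\<close>

text \<open>Functions \<open>u(x,t)\<close> are written \<open>u x t\<close> and viewed as curves \<open>t \<mapsto> u(\<cdot>,t)\<close>. A Banach space of
  functions of \<open>x\<close> is given by its carrier \<open>X\<close> and its norm \<open>nrm\<close>. An element of \<open>L\<^sup>2(0,T;X)\<close> is
  represented by a function that is also measurable on \<open>Q\<^sub>T\<close>: strong measurability alone would allow
  changing each \<open>u(\<cdot>,t)\<close> on a null set depending on \<open>t\<close>, and statements for a.e. \<open>(x,t)\<close>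
  would then be meaningless.\<close>

definition L2_time ::
    "real \<Rightarrow> (real \<Rightarrow> real) set \<Rightarrow> ((real \<Rightarrow> real) \<Rightarrow> real) \<Rightarrow> (real \<Rightarrow> real \<Rightarrow> real) set"
  where "L2_time T X nrm = {u.
    (\<lambda>(x,t). u x t) \<in> borel_measurable (lebesgue_on (QT T)) \<and>
    (AE t in lebesgue_on {0<..<T}. (\<lambda>x. u x t) \<in> X) \<and>
    (\<exists>s :: nat \<Rightarrow> real \<Rightarrow> real \<Rightarrow> real.
       (\<forall>n. simple_function (lebesgue_on {0<..<T}) (s n) \<and> s n ` {0<..<T} \<subseteq> X) \<and>
       (AE t in lebesgue_on {0<..<T}. (\<lambda>n. nrm (\<lambda>x. s n t x - u x t)) \<longlonglongrightarrow> 0)) \<and>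
    integrable (lebesgue_on {0<..<T}) (\<lambda>t. (nrm (\<lambda>x. u x t))\<^sup>2)}"

definition C_time ::
    "real \<Rightarrow> (real \<Rightarrow> real) set \<Rightarrow> ((real \<Rightarrow> real) \<Rightarrow> real) \<Rightarrow> (real \<Rightarrow> real \<Rightarrow> real) set"
  where "C_time T X nrm = {u. \<forall>t\<in>{0..T}. (\<lambda>x. u x t) \<in> X \<and>
    ((\<lambda>s. nrm (\<lambda>x. u x s - u x t)) \<longlongrightarrow> 0) (at t within {0..T})}"

text \<open>The distributional derivative in time of an \<open>L\<^sup>2(-1,1)\<close>-valued curve, tested with
  \<open>\<phi> \<in> C\<^sub>c\<^sup>1(0,T)\<close>. The two integrals are Bochner integrals in \<open>L\<^sup>2(-1,1)\<close>, evaluated at a.e. \<open>x\<close>.\<close>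

definition has_weak_time_deriv ::
    "real \<Rightarrow> (real \<Rightarrow> real \<Rightarrow> real) \<Rightarrow> (real \<Rightarrow> real \<Rightarrow> real) \<Rightarrow> bool"
  where "has_weak_time_deriv T u g \<longleftrightarrow>
    (\<forall>\<phi>::real \<Rightarrow> real. \<phi> C1_differentiable_on UNIV \<longrightarrow>
       (\<exists>c d. 0 < c \<and> d < T \<and> (\<forall>t. t \<notin> {c..d} \<longrightarrow> \<phi> t = 0)) \<longrightarrow>
       (AE x in lebesgue_on Om.
          (LINT t|lebesgue_on {0<..<T}. deriv \<phi> t * u x t)
            = - (LINT t|lebesgue_on {0<..<T}. \<phi> t * g x t)))"

definition H1_time :: "real \<Rightarrow> (real \<Rightarrow> real \<Rightarrow> real) set"
  where "H1_time T = {u \<in> L2_time T L2 norm_L2.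
    \<exists>g \<in> L2_time T L2 norm_L2. has_weak_time_deriv T u g}"

definition BQ :: "real \<Rightarrow> (real \<Rightarrow> real) \<Rightarrow> (real \<Rightarrow> real \<Rightarrow> real) set"
  where "BQ T a = C_time T L2 norm_L2 \<inter> L2_time T (H1a a) (norm_1a a)"

definition norm_BQ :: "real \<Rightarrow> (real \<Rightarrow> real) \<Rightarrow> (real \<Rightarrow> real \<Rightarrow> real) \<Rightarrow> real"
  where "norm_BQ T a u = sqrt ((SUP t\<in>{0..T}. (norm_L2 (\<lambda>x. u x t))\<^sup>2)
    + 2 * (LINT t|lebesgue_on {0<..<T}. LINT x|lebesgue_on Om. a x * (deriv (\<lambda>y. u y t) x)\<^sup>2))"

definition HQ ::
    "real \<Rightarrow> (real \<Rightarrow> real) \<Rightarrow> real \<Rightarrow> real \<Rightarrow> real \<Rightarrow> real \<Rightarrow> (real \<Rightarrow> real \<Rightarrow> real) set"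
  where "HQ T a \<beta>\<^sub>0 \<beta>\<^sub>1 \<gamma>\<^sub>0 \<gamma>\<^sub>1 =
    L2_time T (DA0 a \<beta>\<^sub>0 \<beta>\<^sub>1 \<gamma>\<^sub>0 \<gamma>\<^sub>1) (norm_2a a) \<inter> H1_time T \<inter> C_time T (H1a a) (norm_1a a)"

section \<open>Solutions\<close>

definition strict_solution ::
    "real \<Rightarrow> (real \<Rightarrow> real) \<Rightarrow> real \<Rightarrow> real \<Rightarrow> real \<Rightarrow> real \<Rightarrow> (real \<Rightarrow> real \<Rightarrow> real) \<Rightarrow>
     (real \<Rightarrow> real \<Rightarrow> real \<Rightarrow> real) \<Rightarrow> (real \<Rightarrow> real) \<Rightarrow> (real \<Rightarrow> real \<Rightarrow> real) \<Rightarrow> bool"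
  where "strict_solution T a \<beta>\<^sub>0 \<beta>\<^sub>1 \<gamma>\<^sub>0 \<gamma>\<^sub>1 \<alpha> f u\<^sub>0 u \<longleftrightarrow>
    u\<^sub>0 \<in> H1a a \<and> u \<in> HQ T a \<beta>\<^sub>0 \<beta>\<^sub>1 \<gamma>\<^sub>0 \<gamma>\<^sub>1 \<and>
    (\<exists>u\<^sub>t \<in> L2_time T L2 norm_L2. has_weak_time_deriv T u u\<^sub>t \<and>
       (AE (x,t) in lebesgue_on (QT T).
          u\<^sub>t x t - deriv (flux a (\<lambda>y. u y t)) x = \<alpha> x t * u x t + f x t (u x t))) \<and>
    (AE t in lebesgue_on {0<..<T}. boundary_conditions a \<beta>\<^sub>0 \<beta>\<^sub>1 \<gamma>\<^sub>0 \<gamma>\<^sub>1 (\<lambda>x. u x t)) \<and>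
    (AE x in lebesgue_on Om. u x 0 = u\<^sub>0 x)"

definition strong_solution ::
    "real \<Rightarrow> (real \<Rightarrow> real) \<Rightarrow> real \<Rightarrow> real \<Rightarrow> real \<Rightarrow> real \<Rightarrow> (real \<Rightarrow> real \<Rightarrow> real) \<Rightarrow>
     (real \<Rightarrow> real \<Rightarrow> real \<Rightarrow> real) \<Rightarrow> (real \<Rightarrow> real) \<Rightarrow> (real \<Rightarrow> real \<Rightarrow> real) \<Rightarrow> bool"
  where "strong_solution T a \<beta>\<^sub>0 \<beta>\<^sub>1 \<gamma>\<^sub>0 \<gamma>\<^sub>1 \<alpha> f u\<^sub>0 u \<longleftrightarrow>
    u\<^sub>0 \<in> L2 \<and> u \<in> BQ T a \<and> (AE x in lebesgue_on Om. u x 0 = u\<^sub>0 x) \<and>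
    (\<exists>U :: nat \<Rightarrow> real \<Rightarrow> real \<Rightarrow> real.
       (\<forall>k. U k \<in> HQ T a \<beta>\<^sub>0 \<beta>\<^sub>1 \<gamma>\<^sub>0 \<gamma>\<^sub>1 \<and>
            strict_solution T a \<beta>\<^sub>0 \<beta>\<^sub>1 \<gamma>\<^sub>0 \<gamma>\<^sub>1 \<alpha> f (\<lambda>x. U k x 0) (U k)) \<and>
       (\<lambda>k. norm_BQ T a (\<lambda>x t. U k x t - u x t)) \<longlonglongrightarrow> 0)"

end

theory Submission
  imports Defs
begin

text \<open>Let \<open>\<Phi>(y) = y - arctan y\<close> for \<open>y > 0\<close> and \<open>\<Phi>(y) = 0\<close> for \<open>y \<le> 0\<close>, and let
  \<open>E(t) = \<integral> \<Phi>(-u(x,t)) dx\<close>. For a strict solution, testing the equation with the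
  bounded function \<open>\<Phi>'(-u)\<close> gives \<open>E' \<le> C E\<close>: the diffusion term has the right sign since
  \<open>\<Phi>'' \<ge> 0\<close> and the boundary conditions control \<open>a u\<^sub>x\<close> where \<open>u < 0\<close>, and the other terms are bounded by
  \<open>\<bar>u\<bar> \<Phi>'(-u) \<le> 3 \<Phi>(-u)\<close>, because \<open>f(x,t,0) = 0\<close>. The constant \<open>C\<close> depends only on the data, and
  \<open>E\<close> is continuous for the \<open>L\<^sup>2\<close> norm, so \<open>E(t) \<le> E(0) exp(C t)\<close> passes to strong solutions, for which
  \<open>E(0) = 0\<close>. The linear growth of \<open>\<Phi>\<close>, as opposed to \<open>(u\<^sup>-)\<^sup>2\<close>, makes the boundary term vanish
  also in the strongly degenerate case, where \<open>u\<close> may be unbounded.\<close>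

section \<open>Absolutely continuous functions\<close>

text \<open>The shape of the penalty is dictated by what its derivative must do. It is bounded, so
  it can multiply an L2 function, or a flux tending to 0, with no control on \<open>u\<close>. It is
  nondecreasing, which signs the diffusion term, and Lipschitz, so that the test function changes in
  time no more than \<open>u\<close> does. It has a double zero at 0, so that extension by 0 keeps
  it C^1. The function \<open>x^2 / (1 + x^2)\<close> has all these properties and an explicit
  primitive. The obstacle in time is that u_t is given only through integral identities in t, valid
  for almost every x with a null set that may depend on the test function, so no chain rule for the
  nonlinear quantity E is at hand. Only the linear pairings of \<open>u\<close> with a fixed bounded
  function of x are differentiated; the nonlinear estimate is then assembled from them on short time
  intervals. In space, the flux is absolutely continuous up to the end points while
  \<open>1 / a\<close> blows up there, so integration by parts is done on compact subintervals and
  the boundary values enter through limits.\<close>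

lemma abs_cont_onE:
  assumes "abs_cont_on S g" "\<epsilon> > 0"
  obtains \<delta> where "\<delta> > 0"
    "\<And>(n::nat) l r. \<lbrakk>\<And>i. i < n \<Longrightarrow> l i \<le> r i \<and> {l i..r i} \<subseteq> S;
       \<And>i j. \<lbrakk>i < n; j < n; i \<noteq> j\<rbrakk> \<Longrightarrow> {l i<..<r i} \<inter> {l j<..<r j} = {};
       (\<Sum>i<n. r i - l i) < \<delta>\<rbrakk> \<Longrightarrow> (\<Sum>i<n. \<bar>g (r i) - g (l i)\<bar>) < \<epsilon>"
proof -
  from assms(1)[unfolded abs_cont_on_def, rule_format, OF assms(2)] obtain \<delta> where "\<delta> > 0"
    and *: "\<forall>(n::nat) l r. (\<forall>i<n. l i \<le> r i \<and> {l i..r i} \<subseteq> S) \<longrightarrow>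
       (\<forall>i<n. \<forall>j<n. i \<noteq> j \<longrightarrow> {l i<..<r i} \<inter> {l j<..<r j} = {}) \<longrightarrow>
       (\<Sum>i<n. r i - l i) < \<delta> \<longrightarrow> (\<Sum>i<n. \<bar>g (r i) - g (l i)\<bar>) < \<epsilon>"
    by (elim exE conjE)
  show ?thesis
    by (rule that[OF \<open>\<delta> > 0\<close>]) (rule *[rule_format]; blast)
qed

text \<open>Translates absolute continuity into the language of gauge integration. Distinct members
  of a tagged partial division have disjoint interiors, which is exactly the disjointness that
  \<open>abs_cont_on\<close> asks of its intervals; degenerate intervals are allowed on both
  sides.\<close>

lemma abs_cont_onD_tagged:
  assumes g: "abs_cont_on {c..d} g" and e: "\<epsilon> > 0"
  obtains \<delta> where "\<delta> > 0"
    "\<And>p. p tagged_partial_division_of {c..d} \<Longrightarrow> (\<Sum>(x,K)\<in>p. Sup K - Inf K) < \<delta> \<Longrightarrow>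
       (\<Sum>(x,K)\<in>p. \<bar>g (Sup K) - g (Inf K)\<bar>) < \<epsilon>"
proof (rule abs_cont_onE[OF g e])
  fix \<delta> assume "\<delta> > 0" and \<delta>: "\<And>(n::nat) l r. \<lbrakk>\<And>i. i < n \<Longrightarrow> l i \<le> r i \<and> {l i..r i} \<subseteq> {c..d};
       \<And>i j. \<lbrakk>i < n; j < n; i \<noteq> j\<rbrakk> \<Longrightarrow> {l i<..<r i} \<inter> {l j<..<r j} = {};
       (\<Sum>i<n. r i - l i) < \<delta>\<rbrakk> \<Longrightarrow> (\<Sum>i<n. \<bar>g (r i) - g (l i)\<bar>) < \<epsilon>"
  show thesis
  proof (rule that[OF \<open>\<delta> > 0\<close>])
    fix p assume p: "p tagged_partial_division_of {c..d}"
      and small: "(\<Sum>(x,K)\<in>p. Sup K - Inf K) < \<delta>"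
    note pD = tagged_partial_division_ofD[OF p]
    obtain h where h: "bij_betw h {..<card p} p"
      using ex_bij_betw_nat_finite[OF pD(1)] by (auto simp: atLeast0LessThan)
    define l r where "l = (\<lambda>i. Inf (snd (h i)))" and "r = (\<lambda>i. Sup (snd (h i)))"
    have hp: "(fst (h i), snd (h i)) \<in> p" if "i < card p" for i
      using bij_betwE[OF h] that by simp
    have K: "l i \<le> r i \<and> snd (h i) = {l i..r i}" if i: "i < card p" for i
    proof -
      obtain u v where "snd (h i) = {u..v}" "fst (h i) \<in> snd (h i)"
        using pD(2,4)[OF hp[OF i]] by auto
      then show ?thesis by (auto simp: l_def r_def)
    qed
    have "(\<Sum>i<card p. \<bar>g (r i) - g (l i)\<bar>) < \<epsilon>"
    proof (rule \<delta>)
      show "l i \<le> r i \<and> {l i..r i} \<subseteq> {c..d}" if "i < card p" for i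
        using K[OF that] pD(3)[OF hp[OF that]] by simp
      show "{l i<..<r i} \<inter> {l j<..<r j} = {}" if "i < card p" "j < card p" "i \<noteq> j" for i j
      proof -
        note ij = that
        have "h i \<noteq> h j"
          using h ij by (auto simp: bij_betw_def inj_on_def)
        then have "interior (snd (h i)) \<inter> interior (snd (h j)) = {}"
          by (intro pD(5)[OF hp hp] ij) (auto simp: prod_eq_iff)
        then show "{l i<..<r i} \<inter> {l j<..<r j} = {}" using K ij by simp
      qed
      have "(\<Sum>i<card p. r i - l i) = (\<Sum>(x,K)\<in>p. Sup K - Inf K)"
        unfolding l_def r_def using h
        by (subst sum.reindex_bij_betw[OF h, symmetric]) (simp add: case_prod_unfold)
      then show "(\<Sum>i<card p. r i - l i) < \<delta>" using small by simp
    qed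
    also have "(\<Sum>i<card p. \<bar>g (r i) - g (l i)\<bar>) = (\<Sum>(x,K)\<in>p. \<bar>g (Sup K) - g (Inf K)\<bar>)"
      unfolding l_def r_def
      by (subst sum.reindex_bij_betw[OF h, symmetric]) (simp add: case_prod_unfold)
    finally show "(\<Sum>(x,K)\<in>p. \<bar>g (Sup K) - g (Inf K)\<bar>) < \<epsilon>" .
  qed
qed

text \<open>The intervals may share end points, so additivity of measure is applied to their
  interiors, which are disjoint and have the same lengths.\<close>

lemma tagged_partial_division_length_le_measure:
  fixes p :: "(real \<times> real set) set"
  assumes p: "p tagged_partial_division_of i" and sub: "\<And>x K. (x,K) \<in> p \<Longrightarrow> K \<subseteq> U"
    and U: "U \<in> lmeasurable"
  shows "(\<Sum>(x,K)\<in>p. Sup K - Inf K) \<le> measure lebesgue U"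
proof -
  note pD = tagged_partial_division_ofD[OF p]
  have K: "\<exists>u v. u \<le> v \<and> K = {u..v}" if "(x,K) \<in> p" for x K
    using pD(2,4)[OF that] by force
  have "(\<Sum>(x,K)\<in>p. Sup K - Inf K) = (\<Sum>z\<in>p. measure lebesgue (interior (snd z)))"
  proof (rule sum.cong[OF refl])
    fix z assume "z \<in> p"
    then obtain u v where "u \<le> v" "snd z = {u..v}" using K[of "fst z" "snd z"] by auto
    then show "(case z of (x,K) \<Rightarrow> Sup K - Inf K) = measure lebesgue (interior (snd z))"
      by (simp add: case_prod_unfold)
  qed
  also have "\<dots> = measure lebesgue (\<Union>z\<in>p. interior (snd z))"
  proof (rule measure_finite_Union[symmetric])
    show "disjoint_family_on (\<lambda>z. interior (snd z)) p"
      unfolding disjoint_family_on_def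
    proof (intro ballI impI)
      fix y z assume "y \<in> p" "z \<in> p" "y \<noteq> z"
      then show "interior (snd y) \<inter> interior (snd z) = {}"
        using pD(5)[of "fst y" "snd y" "fst z" "snd z"] by simp
    qed
    show "emeasure lebesgue (interior (snd z)) \<noteq> \<infinity>" if z: "z \<in> p" for z
    proof -
      obtain u v where "u \<le> v" "snd z = {u..v}" using K[of "fst z" "snd z"] z by auto
      then show ?thesis by simp
    qed
  qed (use pD(1) in auto)
  also have "\<dots> \<le> measure lebesgue U"
  proof (rule measure_mono_fmeasurable[OF _ _ U])
    have "interior (snd z) \<subseteq> U" if "z \<in> p" for z
      using sub[of "fst z" "snd z"] interior_subset[of "snd z"] that by simp
    then show "(\<Union>z\<in>p. interior (snd z)) \<subseteq> U" by blast
    show "(\<Union>z\<in>p. interior (snd z)) \<in> sets lebesgue"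
      by (intro lmeasurable_open sets.finite_UN) (use pD(1) in auto)
  qed
  finally show ?thesis .
qed

text \<open>Proved directly for the gauge integral, so integrability of \<open>g'\<close> is part of
  the conclusion. At tags outside \<open>N\<close> differentiability controls the error of each
  piece; at tags inside \<open>N\<close> there is no derivative to use, and absolute continuity
  takes over.\<close>

theorem fundamental_theorem_of_calculus_abs_cont:
  fixes g g' :: "real \<Rightarrow> real"
  assumes "c \<le> d" and g: "abs_cont_on {c..d} g" and N: "negligible N"
    and der: "\<And>x. x \<in> {c..d} - N \<Longrightarrow> (g has_real_derivative g' x) (at x within {c..d})"
  shows "(g' has_integral (g d - g c)) {c..d}"
proof -
  \<comment> \<open>With the integrand set to 0 on \<open>N\<close>, a piece tagged in
    \<open>N\<close> contributes only the increment of \<open>g\<close>.\<close>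
  define G where "G = (\<lambda>x. if x \<in> N then 0 else g' x)"
  have "(G has_integral (g d - g c)) {c..d}"
    unfolding has_integral_real
  proof (intro allI impI)
    fix e :: real assume "e > 0"
    \<comment> \<open>The pieces tagged outside \<open>N\<close> get a total error below
      \<open>e/2\<close>; the \<open>+ 1\<close> covers the case \<open>c = d\<close>.\<close>
    define \<eta> where "\<eta> = e / (2 * (d - c + 1))"
    have "\<eta> > 0" using \<open>e > 0\<close> \<open>c \<le> d\<close> by (simp add: \<eta>_def)
    have "\<forall>x. \<exists>s>0. x \<in> {c..d} - N \<longrightarrow>
         (\<forall>y\<in>{c..d}. norm (y-x) < s \<longrightarrow> norm (g y - g x - (y-x) *\<^sub>R g' x) \<le> \<eta> * norm (y-x))"
      using der[unfolded has_field_derivative_def has_derivative_within_alt] \<open>\<eta> > 0\<close>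
      by (simp add: mult.commute) (meson zero_less_one)
    then obtain s where s: "\<And>x. 0 < s x"
      "\<And>x y. \<lbrakk>x \<in> {c..d} - N; y \<in> {c..d}; norm (y-x) < s x\<rbrakk>
                        \<Longrightarrow> norm (g y - g x - (y-x) *\<^sub>R g' x) \<le> \<eta> * norm (y-x)"
      by metis
    obtain \<delta> where "\<delta> > 0" and \<delta>: "\<And>p. p tagged_partial_division_of {c..d} \<Longrightarrow>
        (\<Sum>(x,K)\<in>p. Sup K - Inf K) < \<delta> \<Longrightarrow> (\<Sum>(x,K)\<in>p. \<bar>g (Sup K) - g (Inf K)\<bar>) < e/2"
      using abs_cont_onD_tagged[OF g, of "e/2"] \<open>e > 0\<close> by auto
    \<comment> \<open>Intervals tagged in \<open>N\<close> lie in \<open>U\<close>, so absolute continuity makes their contribution small.\<close>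
    obtain U where U: "open U" "N \<subseteq> U" "U \<in> lmeasurable" "measure lebesgue U < \<delta>"
    proof -
      have N0: "N \<in> null_sets lebesgue" using N by (simp add: negligible_iff_null_sets)
      then obtain V where V: "open V" "N \<subseteq> V" "(V - N) \<in> lmeasurable"
          "emeasure lebesgue (V - N) < ennreal \<delta>"
        using sets_lebesgue_outer_open[OF _ \<open>\<delta> > 0\<close>, of N] by auto
      have "emeasure lebesgue V = emeasure lebesgue (V - N)"
        using emeasure_Diff_null_set[OF N0, of V] V(1) by auto
      then have em: "emeasure lebesgue V < ennreal \<delta>" using V by simp
      then have "V \<in> lmeasurable" using V(1) by (auto simp: fmeasurable_def intro: less_trans)
      moreover have "measure lebesgue V < \<delta>"
        using em unfolding emeasure_eq_measure2[OF \<open>V \<in> lmeasurable\<close>]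
        by (simp add: ennreal_less_iff)
      ultimately show ?thesis using that V by blast
    qed
    define \<gamma> where "\<gamma> = (\<lambda>x. if x \<in> N then U else ball x (s x))"
    show "\<exists>\<gamma>. gauge \<gamma> \<and> (\<forall>\<D>. \<D> tagged_division_of {c..d} \<and> \<gamma> fine \<D> \<longrightarrow>
        norm ((\<Sum>(x, k)\<in>\<D>. measure lborel k *\<^sub>R G x) - (g d - g c)) < e)"
    proof (intro exI[of _ \<gamma>] conjI allI impI)
      show "gauge \<gamma>" using U s(1) by (auto simp: gauge_def \<gamma>_def)
    next
      fix p assume "p tagged_division_of {c..d} \<and> \<gamma> fine p"
      then have p: "p tagged_division_of {c..d}" and fine: "\<gamma> fine p" by auto
      have fin: "finite p" using p by auto
      have K: "\<exists>u v. u \<le> v \<and> K = {u..v} \<and> x \<in> K \<and> K \<subseteq> {c..d}" if "(x,K) \<in> p" for x K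
        using tagged_division_ofD(2,3,4)[OF p that] by force
      define q where "q = {z \<in> p. fst z \<in> N}"
      have q: "q tagged_partial_division_of {c..d}"
        using p tagged_partial_division_subset[of p _ q] by (auto simp: tagged_division_of_def q_def)
      have "(\<Sum>(x,K)\<in>q. Sup K - Inf K) \<le> measure lebesgue U"
        by (rule tagged_partial_division_length_le_measure[OF q _ U(3)])
          (use fine in \<open>fastforce simp: fine_def \<gamma>_def q_def\<close>)
      then have bad: "(\<Sum>(x,K)\<in>q. \<bar>g (Sup K) - g (Inf K)\<bar>) < e/2"
        using U(4) by (intro \<delta>[OF q]) auto
      \<comment> \<open>Straddle estimate: the tag lies between the end points, so the two errors
        measured from the tag add up to \<open>\<eta>\<close> times the length of the piece.\<close>
      have good: "\<bar>measure lborel K * g' x - (g (Sup K) - g (Inf K))\<bar> \<le> \<eta> * (Sup K - Inf K)"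
        if xK: "(x,K) \<in> p" and xN: "x \<notin> N" for x K
      proof -
        obtain u v where uv: "u \<le> v" "K = {u..v}" "x \<in> K" "K \<subseteq> {c..d}" using K[OF xK] by auto
        have ball: "K \<subseteq> ball x (s x)"
          using fine[unfolded fine_def, THEN bspec, OF xK] xN by (simp add: \<gamma>_def)
        have "u \<in> K" "v \<in> K" using uv by auto
        have x: "x \<in> {c..d} - N" using uv xN by auto
        have "norm (g u - g x - (u-x) *\<^sub>R g' x) \<le> \<eta> * norm (u-x)"
          by (rule s(2)[OF x]) (use \<open>u \<in> K\<close> ball uv(4) in \<open>auto simp: dist_real_def subset_iff\<close>)
        moreover have "norm (g v - g x - (v-x) *\<^sub>R g' x) \<le> \<eta> * norm (v-x)"
          by (rule s(2)[OF x]) (use \<open>v \<in> K\<close> ball uv(4) in \<open>auto simp: dist_real_def subset_iff\<close>)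
        ultimately have "\<bar>(v - u) * g' x - (g v - g u)\<bar> \<le> \<eta> * (x - u) + \<eta> * (v - x)"
          using uv by (auto simp: algebra_simps)
        then show ?thesis using uv by (simp add: algebra_simps)
      qed
      have "(\<Sum>(x, k)\<in>p. measure lborel k *\<^sub>R G x) - (g d - g c)
          = (\<Sum>(x,K)\<in>p. measure lborel K * G x - (g (Sup K) - g (Inf K)))"
        using additive_tagged_division_1[OF \<open>c \<le> d\<close> p, of g]
        by (simp add: case_prod_unfold sum_subtractf)
      also have "\<bar>\<dots>\<bar> \<le> (\<Sum>(x,K)\<in>p. \<bar>measure lborel K * G x - (g (Sup K) - g (Inf K))\<bar>)"
        by (simp add: case_prod_unfold)
      also have "\<dots> = (\<Sum>(x,K)\<in>p - q. \<bar>measure lborel K * G x - (g (Sup K) - g (Inf K))\<bar>)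
          + (\<Sum>(x,K)\<in>q. \<bar>measure lborel K * G x - (g (Sup K) - g (Inf K))\<bar>)"
        by (rule sum.subset_diff) (use fin in \<open>auto simp: q_def\<close>)
      also have "(\<Sum>(x,K)\<in>q. \<bar>measure lborel K * G x - (g (Sup K) - g (Inf K))\<bar>)
          = (\<Sum>(x,K)\<in>q. \<bar>g (Sup K) - g (Inf K)\<bar>)"
        by (rule sum.cong) (auto simp: q_def G_def)
      also have "(\<Sum>(x,K)\<in>p - q. \<bar>measure lborel K * G x - (g (Sup K) - g (Inf K))\<bar>)
          \<le> (\<Sum>(x,K)\<in>p - q. \<eta> * (Sup K - Inf K))"
        by (rule sum_mono) (use good in \<open>auto simp: q_def G_def\<close>)
      also have "\<dots> \<le> (\<Sum>(x,K)\<in>p. \<eta> * (Sup K - Inf K))"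
      proof (rule sum_mono2[OF fin])
        fix z assume "z \<in> p - (p - q)"
        then show "0 \<le> (case z of (x, K) \<Rightarrow> \<eta> * (Sup K - Inf K))"
          using K \<open>\<eta> > 0\<close> by (cases z) force
      qed auto
      also have "\<dots> = \<eta> * (d - c)"
        using additive_tagged_division_1[OF \<open>c \<le> d\<close> p, of "\<lambda>x. x"]
        by (simp add: case_prod_unfold flip: sum_distrib_left)
      also have "\<dots> < e/2" using \<open>e > 0\<close> \<open>c \<le> d\<close> by (simp add: \<eta>_def field_simps)
      finally show "norm ((\<Sum>(x, k)\<in>p. measure lborel k *\<^sub>R G x) - (g d - g c)) < e"
        using bad by simp
    qed
  qed
  then show ?thesis
    by (rule has_integral_spike[OF N, rotated]) (auto simp: G_def)
qed

lemma abs_cont_on_imp_continuous_on: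
  assumes g: "abs_cont_on {c..d} g" shows "continuous_on {c..d} g"
  unfolding continuous_on_iff dist_real_def
proof (intro ballI allI impI)
  fix x e :: real assume x: "x \<in> {c..d}" and "e > 0"
  show "\<exists>d'>0. \<forall>x'\<in>{c..d}. \<bar>x' - x\<bar> < d' \<longrightarrow> \<bar>g x' - g x\<bar> < e"
  proof (rule abs_cont_onE[OF g \<open>e > 0\<close>])
    fix \<delta> assume "\<delta> > 0" and \<delta>: "\<And>(n::nat) l r. \<lbrakk>\<And>i. i < n \<Longrightarrow> l i \<le> r i \<and> {l i..r i} \<subseteq> {c..d};
         \<And>i j. \<lbrakk>i < n; j < n; i \<noteq> j\<rbrakk> \<Longrightarrow> {l i<..<r i} \<inter> {l j<..<r j} = {};
         (\<Sum>i<n. r i - l i) < \<delta>\<rbrakk> \<Longrightarrow> (\<Sum>i<n. \<bar>g (r i) - g (l i)\<bar>) < e"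
    have est: "\<bar>g x' - g x\<bar> < e" if "x' \<in> {c..d}" "\<bar>x' - x\<bar> < \<delta>" for x'
    proof -
      have "(\<Sum>i<(1::nat). \<bar>g (max x x') - g (min x x')\<bar>) < e"
        by (rule \<delta>[of 1 "\<lambda>_. min x x'" "\<lambda>_. max x x'"]) (use x that in auto)
      then show ?thesis by (auto simp: min_def max_def abs_minus_commute split: if_splits)
    qed
    show "\<exists>d'>0. \<forall>x'\<in>{c..d}. \<bar>x' - x\<bar> < d' \<longrightarrow> \<bar>g x' - g x\<bar> < e"
      by (intro exI[of _ \<delta>] conjI \<open>\<delta> > 0\<close> ballI impI est)
  qed
qed

text \<open>Replaces a general product rule for absolute continuity. It is used with
  \<open>g\<close> the flux and \<open>h\<close> its product with a bounded Lipschitz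
  factor.\<close>

lemma abs_cont_on_lipschitz_combination:
  assumes g: "abs_cont_on S g" and B: "B \<ge> 0" "L \<ge> 0"
    and h: "\<And>x y. x \<in> S \<Longrightarrow> y \<in> S \<Longrightarrow> \<bar>h x - h y\<bar> \<le> B * \<bar>g x - g y\<bar> + L * \<bar>x - y\<bar>"
  shows "abs_cont_on S h"
  unfolding abs_cont_on_def
proof (intro allI impI)
  fix e :: real assume "e > 0"
  then have e2: "e / (2 * (B + 1)) > 0" using B by simp
  show "\<exists>\<delta>>0. \<forall>(n::nat) l r. (\<forall>i<n. l i \<le> r i \<and> {l i..r i} \<subseteq> S) \<longrightarrow>
       (\<forall>i<n. \<forall>j<n. i \<noteq> j \<longrightarrow> {l i<..<r i} \<inter> {l j<..<r j} = {}) \<longrightarrow>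
       (\<Sum>i<n. r i - l i) < \<delta> \<longrightarrow> (\<Sum>i<n. \<bar>h (r i) - h (l i)\<bar>) < e"
  proof (rule abs_cont_onE[OF g e2])
    fix \<delta> assume "\<delta> > 0" and \<delta>: "\<And>(n::nat) l r. \<lbrakk>\<And>i. i < n \<Longrightarrow> l i \<le> r i \<and> {l i..r i} \<subseteq> S;
         \<And>i j. \<lbrakk>i < n; j < n; i \<noteq> j\<rbrakk> \<Longrightarrow> {l i<..<r i} \<inter> {l j<..<r j} = {};
         (\<Sum>i<n. r i - l i) < \<delta>\<rbrakk> \<Longrightarrow> (\<Sum>i<n. \<bar>g (r i) - g (l i)\<bar>) < e / (2 * (B + 1))"
    define \<delta>' where "\<delta>' = min \<delta> (e / (2 * (L + 1)))"
    have est: "(\<Sum>i<n. \<bar>h (r i) - h (l i)\<bar>) < e"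
      if A: "\<forall>i<n. l i \<le> r i \<and> {l i..r i} \<subseteq> S"
        "\<forall>i<n. \<forall>j<n. i \<noteq> j \<longrightarrow> {l i<..<r i} \<inter> {l j<..<r j} = {}"
        "(\<Sum>i<n. r i - l i) < \<delta>'" for n :: nat and l r
    proof -
      have "(\<Sum>i<n. \<bar>h (r i) - h (l i)\<bar>) \<le> (\<Sum>i<n. B * \<bar>g (r i) - g (l i)\<bar> + L * (r i - l i))"
      proof (rule sum_mono)
        fix i assume "i \<in> {..<n}"
        then have "l i \<le> r i \<and> {l i..r i} \<subseteq> S" using A(1) by simp
        then have "l i \<le> r i" "l i \<in> S" "r i \<in> S" by (auto simp: subset_iff)
        then show "\<bar>h (r i) - h (l i)\<bar> \<le> B * \<bar>g (r i) - g (l i)\<bar> + L * (r i - l i)"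
          using h[of "r i" "l i"] by simp
      qed
      also have "\<dots> = B * (\<Sum>i<n. \<bar>g (r i) - g (l i)\<bar>) + L * (\<Sum>i<n. r i - l i)"
        by (simp add: sum.distrib sum_distrib_left)
      also have "\<dots> < e"
      proof -
        let ?a = "\<Sum>i<n. \<bar>g (r i) - g (l i)\<bar>" and ?b = "\<Sum>i<n. r i - l i"
        have a: "?a < e / (2 * (B + 1))" "?a \<ge> 0"
        proof -
          show "?a < e / (2 * (B + 1))"
            by (rule \<delta>) (use A in \<open>auto simp: \<delta>'_def\<close>)
        qed (simp add: sum_nonneg)
        have b: "?b < e / (2 * (L + 1))" "?b \<ge> 0" using A(1,3) by (auto simp: \<delta>'_def intro: sum_nonneg)
        have "B * ?a \<le> (B + 1) * ?a" "L * ?b \<le> (L + 1) * ?b" using a b by (auto simp: algebra_simps)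
        moreover have "(B + 1) * ?a < e / 2" "(L + 1) * ?b < e / 2"
          using a b B by (auto simp: field_simps)
        ultimately show ?thesis by linarith
      qed
      finally show ?thesis .
    qed
    have "\<delta>' > 0" using \<open>\<delta> > 0\<close> \<open>e > 0\<close> B by (simp add: \<delta>'_def)
    with est show "\<exists>\<delta>>0. \<forall>(n::nat) l r. (\<forall>i<n. l i \<le> r i \<and> {l i..r i} \<subseteq> S) \<longrightarrow>
         (\<forall>i<n. \<forall>j<n. i \<noteq> j \<longrightarrow> {l i<..<r i} \<inter> {l j<..<r j} = {}) \<longrightarrow>
         (\<Sum>i<n. r i - l i) < \<delta> \<longrightarrow> (\<Sum>i<n. \<bar>h (r i) - h (l i)\<bar>) < e"
      by (intro exI[of _ \<delta>'] conjI allI impI) simp_all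
  qed
qed

lemma abs_cont_on_subset:
  assumes "abs_cont_on S g" "T \<subseteq> S" shows "abs_cont_on T g"
  unfolding abs_cont_on_def
proof (intro allI impI)
  fix e :: real assume e: "e > 0"
  show "\<exists>\<delta>>0. \<forall>(n::nat) l r. (\<forall>i<n. l i \<le> r i \<and> {l i..r i} \<subseteq> T) \<longrightarrow>
       (\<forall>i<n. \<forall>j<n. i \<noteq> j \<longrightarrow> {l i<..<r i} \<inter> {l j<..<r j} = {}) \<longrightarrow>
       (\<Sum>i<n. r i - l i) < \<delta> \<longrightarrow> (\<Sum>i<n. \<bar>g (r i) - g (l i)\<bar>) < e"
  proof (rule abs_cont_onE[OF assms(1) e])
    fix \<delta> assume "\<delta> > 0" and \<delta>: "\<And>(n::nat) l r. \<lbrakk>\<And>i. i < n \<Longrightarrow> l i \<le> r i \<and> {l i..r i} \<subseteq> S;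
       \<And>i j. \<lbrakk>i < n; j < n; i \<noteq> j\<rbrakk> \<Longrightarrow> {l i<..<r i} \<inter> {l j<..<r j} = {};
       (\<Sum>i<n. r i - l i) < \<delta>\<rbrakk> \<Longrightarrow> (\<Sum>i<n. \<bar>g (r i) - g (l i)\<bar>) < e"
    show "\<exists>\<delta>>0. \<forall>(n::nat) l r. (\<forall>i<n. l i \<le> r i \<and> {l i..r i} \<subseteq> T) \<longrightarrow>
       (\<forall>i<n. \<forall>j<n. i \<noteq> j \<longrightarrow> {l i<..<r i} \<inter> {l j<..<r j} = {}) \<longrightarrow>
       (\<Sum>i<n. r i - l i) < \<delta> \<longrightarrow> (\<Sum>i<n. \<bar>g (r i) - g (l i)\<bar>) < e"
      by (intro exI[of _ \<delta>] conjI allI impI \<open>\<delta> > 0\<close>, rule \<delta>) (use assms(2) in \<open>blast+\<close>)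
  qed
qed

section \<open>The penalty function\<close>

text \<open>Only the point 0 needs care: there the difference quotient of the glued function is
  dominated by that of \<open>f\<close>, which tends to \<open>f' 0 = 0\<close>.\<close>

lemma has_real_derivative_cutoff:
  fixes f f' :: "real \<Rightarrow> real"
  assumes f: "\<And>x. x \<ge> 0 \<Longrightarrow> (f has_real_derivative f' x) (at x)" and 0: "f 0 = 0" "f' 0 = 0"
  shows "((\<lambda>x. if x \<le> 0 then 0 else f x) has_real_derivative (if x \<le> 0 then 0 else f' x)) (at x)"
proof -
  consider "x < 0" | "x > 0" | "x = 0" by linarith
  then show ?thesis
  proof cases
    case 1
    have "((\<lambda>x. if x \<le> 0 then 0 else f x) has_real_derivative 0) (at x)"
      by (rule has_field_derivative_transform_within_open[of "\<lambda>_. 0" _ _ "{..<0}"])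
        (use 1 in auto)
    then show ?thesis using 1 by simp
  next
    case 2
    have "((\<lambda>x. if x \<le> 0 then 0 else f x) has_real_derivative f' x) (at x)"
      by (rule has_field_derivative_transform_within_open[of f _ _ "{0<..}"])
        (use 2 f[of x] in auto)
    then show ?thesis using 2 by simp
  next
    case 3
    have "((\<lambda>h. f h / h) \<longlongrightarrow> 0) (at 0)" using f[of 0] 0 by (simp add: DERIV_def)
    then have "((\<lambda>h. \<bar>f h / h\<bar>) \<longlongrightarrow> 0) (at 0)" by (rule tendsto_rabs_zero)
    then have "((\<lambda>h. (if h \<le> 0 then 0 else f h) / h) \<longlongrightarrow> 0) (at 0)"
      by (rule Lim_null_comparison[rotated]) (auto intro!: always_eventually simp: divide_le_0_iff)
    then show ?thesis using 3 by (simp add: DERIV_def cong: if_cong)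
  qed
qed

text \<open>First of three functions, each cut off to 0 on the negative half-line: since
  \<open>x^2 / (1 + x^2) = 1 - 1 / (1 + x^2)\<close>, a primitive is \<open>x - arctan x\<close>,
  and \<open>ddpenalty\<close> is the derivative.\<close>

definition dpenalty :: "real \<Rightarrow> real" where "dpenalty x = (if x \<le> 0 then 0 else x\<^sup>2 / (1 + x\<^sup>2))"
definition ddpenalty :: "real \<Rightarrow> real" where "ddpenalty x = (if x \<le> 0 then 0 else 2 * x / (1 + x\<^sup>2)\<^sup>2)"
definition penalty :: "real \<Rightarrow> real" where "penalty x = (if x \<le> 0 then 0 else x - arctan x)"

lemma one_plus_square_pos: "0 < 1 + (x::real)\<^sup>2" by (smt (verit) zero_le_power2)

lemma dpenalty_deriv: "(dpenalty has_real_derivative ddpenalty x) (at x)"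
  unfolding dpenalty_def[abs_def] ddpenalty_def
proof (rule has_real_derivative_cutoff)
  fix x :: real
  have "1 + x\<^sup>2 \<noteq> 0" using one_plus_square_pos[of x] by simp
  then show "((\<lambda>x. x\<^sup>2 / (1 + x\<^sup>2)) has_real_derivative 2 * x / (1 + x\<^sup>2)\<^sup>2) (at x)"
    by (auto intro!: derivative_eq_intros simp: power2_eq_square divide_simps) (simp add: algebra_simps)
qed auto

lemma penalty_deriv: "(penalty has_real_derivative dpenalty x) (at x)"
  unfolding dpenalty_def penalty_def[abs_def]
proof (rule has_real_derivative_cutoff)
  fix x :: real
  have "1 + x\<^sup>2 \<noteq> 0" using one_plus_square_pos[of x] by simp
  then show "((\<lambda>x. x - arctan x) has_real_derivative x\<^sup>2 / (1 + x\<^sup>2)) (at x)"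
    by (auto intro!: derivative_eq_intros simp: field_simps)
qed auto

lemma dpenalty_bounds: "0 \<le> dpenalty x" "dpenalty x \<le> 1"
  using one_plus_square_pos[of x] by (auto simp: dpenalty_def)

lemma dpenalty_nonpos [simp]: "x \<le> 0 \<Longrightarrow> dpenalty x = 0" by (simp add: dpenalty_def)

lemma ddpenalty_bounds: "0 \<le> ddpenalty x" "ddpenalty x \<le> 1"
proof -
  have "2 * x \<le> 1 + x\<^sup>2" using sum_squares_ge_zero[of "x - 1" 0] by (simp add: power2_eq_square algebra_simps)
  also have "\<dots> \<le> (1 + x\<^sup>2)\<^sup>2" using self_le_power[of "1 + x\<^sup>2" 2] by simp
  finally show "ddpenalty x \<le> 1" using one_plus_square_pos[of x] by (simp add: ddpenalty_def)
  show "0 \<le> ddpenalty x" by (simp add: ddpenalty_def)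
qed

lemma dpenalty_continuous: "continuous_on S dpenalty"
  by (intro continuous_at_imp_continuous_on ballI DERIV_isCont[OF dpenalty_deriv])

lemma penalty_continuous: "continuous_on S penalty"
  by (intro continuous_at_imp_continuous_on ballI DERIV_isCont[OF penalty_deriv])

lemma dpenalty_lipschitz: "\<bar>dpenalty x - dpenalty y\<bar> \<le> \<bar>x - y\<bar>"
  using field_differentiable_bound[of UNIV dpenalty ddpenalty 1 y x] dpenalty_deriv ddpenalty_bounds by auto

lemma penalty_lipschitz: "\<bar>penalty x - penalty y\<bar> \<le> \<bar>x - y\<bar>"
  using field_differentiable_bound[of UNIV penalty dpenalty 1 y x] penalty_deriv dpenalty_bounds by auto

lemma penalty_nonneg: "0 \<le> penalty x"
  using arctan_le_self[of x] by (simp add: penalty_def)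

lemma dpenalty_mono: "x \<le> y \<Longrightarrow> dpenalty x \<le> dpenalty y"
  by (rule DERIV_nonneg_imp_nondecreasing[of x y dpenalty]) (use dpenalty_deriv ddpenalty_bounds in blast)+

text \<open>The graph lies above its tangent at \<open>y\<close>, by the mean value theorem and
  monotonicity of \<open>dpenalty\<close>. In the energy estimate \<open>y\<close> comes from the
  later of two times.\<close>

lemma penalty_convex: "penalty y - penalty x \<le> dpenalty y * (y - x)"
proof -
  consider "x < y" | "y < x" | "x = y" by linarith
  then show ?thesis
  proof cases
    case 1
    then obtain z where "x < z" "z < y" "penalty y - penalty x = (y - x) * dpenalty z"
      using MVT2[of x y penalty dpenalty] penalty_deriv by blast
    then show ?thesis using dpenalty_mono[of z y] by (simp add: mult.commute mult_left_mono)
  next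
    case 2
    then obtain z where "y < z" "z < x" "penalty x - penalty y = (x - y) * dpenalty z"
      using MVT2[of y x penalty dpenalty] penalty_deriv by blast
    then show ?thesis using mult_left_mono[OF dpenalty_mono[of y z], of "x - y"] by (simp add: algebra_simps)
  qed simp
qed

text \<open>Near 0 the penalty behaves like \<open>x^3 / 3\<close> and its derivative like
  \<open>x^2\<close>, which explains the constant 3. The difference of the two sides vanishes at 0
  and has derivative \<open>2 * dpenalty y - y * ddpenalty y\<close>, nonnegative because the second
  term is \<open>2 * y^2 / (1 + y^2)^2\<close>.\<close>

lemma dpenalty_le_penalty: "x * dpenalty x \<le> 3 * penalty x"
proof (cases "x \<le> 0")
  case False
  have "3 * penalty 0 - 0 * dpenalty 0 \<le> 3 * penalty x - x * dpenalty x"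
  proof (rule DERIV_nonneg_imp_nondecreasing[of 0 x "\<lambda>y. 3 * penalty y - y * dpenalty y"])
    fix y :: real assume "0 \<le> y"
    have "((\<lambda>y. 3 * penalty y - y * dpenalty y) has_real_derivative 2 * dpenalty y - y * ddpenalty y) (at y)"
      by (auto intro!: derivative_eq_intros dpenalty_deriv penalty_deriv)
    moreover have "y * ddpenalty y \<le> 2 * dpenalty y"
    proof (cases "y = 0")
      case False
      have "(1 + y\<^sup>2) \<le> (1 + y\<^sup>2)\<^sup>2" using self_le_power[of "1 + y\<^sup>2" 2] by simp
      then have "2 * y\<^sup>2 / (1 + y\<^sup>2)\<^sup>2 \<le> 2 * y\<^sup>2 / (1 + y\<^sup>2)"
        using one_plus_square_pos[of y] by (intro divide_left_mono) auto
      then show ?thesis using False \<open>0 \<le> y\<close> by (simp add: dpenalty_def ddpenalty_def power2_eq_square ac_simps)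
    qed simp
    ultimately show "\<exists>z. ((\<lambda>y. 3 * penalty y - y * dpenalty y) has_real_derivative z) (at y) \<and> 0 \<le> z"
      by (intro exI[of _ "2 * dpenalty y - y * ddpenalty y"]) simp
  qed (use False in auto)
  then show ?thesis by (simp add: penalty_def)
qed (simp add: penalty_def)

lemma penalty_eq_0_iff: "penalty x = 0 \<longleftrightarrow> x \<le> 0"
proof (cases "x \<le> 0")
  case False
  then have "0 < x * dpenalty x" using one_plus_square_pos[of x] by (simp add: dpenalty_def)
  then show ?thesis using dpenalty_le_penalty[of x] False by auto
qed (simp add: penalty_def)

section \<open>Regularity and boundary values of the flux\<close>

lemma AE_lebesgue_on_negligible:
  assumes "AE x in lebesgue_on S. P x" "S \<in> sets lebesgue"
  obtains N where "negligible N" "\<And>x. x \<in> S - N \<Longrightarrow> P x"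
proof -
  have "AE x in lebesgue. x \<in> S \<longrightarrow> P x"
    using assms by (subst (asm) AE_restrict_space_iff) auto
  then obtain N where "N \<in> null_sets lebesgue" "{x \<in> space lebesgue. \<not> (x \<in> S \<longrightarrow> P x)} \<subseteq> N"
    by (auto simp: eventually_ae_filter)
  then show ?thesis using that[of N] by (auto simp: negligible_iff_null_sets)
qed

lemma finite_measure_Om: "finite_measure (lebesgue_on Om)"
  by (rule finite_measure_lebesgue_on) auto

lemma square_integrable_mult:
  assumes "square_integrable M g" "square_integrable M h"
  shows "integrable M (\<lambda>x. g x * h x)"
proof (rule Bochner_Integration.integrable_bound)
  show "integrable M (\<lambda>x. (g x)\<^sup>2 + (h x)\<^sup>2)" "(\<lambda>x. g x * h x) \<in> borel_measurable M"
    using assms by (auto simp: square_integrable_def)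
  have "\<bar>g x * h x\<bar> \<le> (g x)\<^sup>2 + (h x)\<^sup>2" for x
    using sum_squares_bound[of "\<bar>g x\<bar>" "\<bar>h x\<bar>"] mult_nonneg_nonneg[of "\<bar>g x\<bar>" "\<bar>h x\<bar>"]
    by (simp add: abs_mult del: mult_nonneg_nonneg zero_le_mult_iff)
  then show "AE x in M. norm (g x * h x) \<le> norm ((g x)\<^sup>2 + (h x)\<^sup>2)" by auto
qed

lemma square_integrable_bounded_mult:
  assumes "finite_measure M" "square_integrable M g" "p \<in> borel_measurable M" "\<And>x. \<bar>p x\<bar> \<le> B"
  shows "integrable M (\<lambda>x. p x * g x)"
proof (rule square_integrable_mult[OF _ assms(2)])
  interpret finite_measure M by fact
  have "(p x)\<^sup>2 \<le> B\<^sup>2" for x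
    by (rule abs_le_square_iff[THEN iffD1]) (use assms(4)[of x] in linarith)
  then show "square_integrable M p"
    using assms(3) by (auto simp: square_integrable_def intro!: integrable_const_bound[where B="B\<^sup>2"])
qed

lemma square_integrable_imp_integrable:
  "finite_measure M \<Longrightarrow> square_integrable M g \<Longrightarrow> integrable M g"
  using square_integrable_bounded_mult[of M g "\<lambda>_. 1" 1] by simp

text \<open>A priori \<open>a u\<^sub>x = w\<close> only almost everywhere. But \<open>u\<close> is then a primitive of the continuous function
  \<open>w / a\<close>, so \<open>u\<close> is \<open>C\<^sup>1\<close> and the identity holds everywhere, which gives \<open>deriv (flux a u)\<close> its meaning.\<close>

lemma H2a_regularity:
  assumes D: "assumption_Deg a \<beta>\<^sub>0 \<beta>\<^sub>1 \<gamma>\<^sub>0 \<gamma>\<^sub>1 \<theta>" and u: "u \<in> H2a a"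
  obtains w where "abs_cont_on {-1..1} w" "ae_differentiable_on Om w" "deriv w \<in> L2"
    "\<And>x. x \<in> Om \<Longrightarrow> (u has_real_derivative w x / a x) (at x)"
    "\<And>x. x \<in> Om \<Longrightarrow> flux a u x = w x"
    "\<And>x. x \<in> Om \<Longrightarrow> deriv (flux a u) x = deriv w x"
proof -
  have uH: "u \<in> H1a a" and "flux a u \<in> H1" using u by (auto simp: H2a_def)
  then obtain w where w: "AE x in lebesgue_on Om. flux a u x = w x" "abs_cont_on {-1..1} w"
      "ae_differentiable_on Om w" "deriv w \<in> L2"
    unfolding H1_def by blast
  have apos: "a x > 0" if "x \<in> Om" for x using D that by (auto simp: assumption_Deg_def)
  have acont: "continuous_on {-1..1} a" using D by (auto simp: assumption_Deg_def)
  have wcont: "continuous_on {-1..1} w" by (rule abs_cont_on_imp_continuous_on[OF w(2)])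
  have "AE x in lebesgue_on Om. u differentiable (at x)"
    using uH by (simp add: H1a_def ae_differentiable_on_def)
  then obtain N1 where N1: "negligible N1" "\<And>x. x \<in> Om - N1 \<Longrightarrow> u differentiable (at x)"
    by (rule AE_lebesgue_on_negligible) auto
  from w(1) obtain N2 where N2: "negligible N2" "\<And>x. x \<in> Om - N2 \<Longrightarrow> flux a u x = w x"
    by (rule AE_lebesgue_on_negligible) auto
  have der: "(u has_real_derivative w x / a x) (at x)" if x: "x \<in> Om" for x
  proof -
    \<comment> \<open>On a compact neighbourhood of \<open>x\<close> inside the open interval,
      \<open>a\<close> has no zero, so \<open>w / a\<close> is continuous there.\<close>
    obtain c d where cd: "-1 < c" "c < x" "x < d" "d < 1"
    proof
      show "-1 < (x - 1) / 2" "(x - 1) / 2 < x" "x < (x + 1) / 2" "(x + 1) / 2 < 1" using x by auto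
    qed
    have sub: "{c..d} \<subseteq> Om" using cd by (simp add: subset_iff)
    have uac: "abs_cont_on {c..d} u"
    proof (cases "weakly_degenerate a")
      case True
      then have "abs_cont_on {-1..1} u" using uH by (simp add: H1a_def)
      then show ?thesis by (rule abs_cont_on_subset) (use cd in \<open>simp add: subset_iff\<close>)
    next
      case False
      then have "loc_abs_cont_on Om u" using uH by (simp add: H1a_def)
      then show ?thesis unfolding loc_abs_cont_on_def using sub by simp
    qed
    have cont: "continuous_on {c..d} (\<lambda>x. w x / a x)"
    proof (rule continuous_on_divide)
      have "{c..d} \<subseteq> {-1..1}" using cd by (simp add: subset_iff)
      then show "continuous_on {c..d} w" "continuous_on {c..d} a"
        using wcont acont continuous_on_subset by blast+
      show "\<forall>x\<in>{c..d}. a x \<noteq> 0" using sub apos by fastforce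
    qed
    \<comment> \<open>The fundamental theorem gives the integral of \<open>deriv u\<close>, which
      may be replaced by \<open>w / a\<close> off the null set \<open>N2\<close>. The new integrand
      is continuous, hence the primitive is differentiable at every point.\<close>
    have I: "((\<lambda>x. w x / a x) has_integral (u y - u c)) {c..y}" if y: "y \<in> {c..d}" for y
    proof (rule has_integral_spike[OF N2(1)])
      show "(deriv u has_integral (u y - u c)) {c..y}"
      proof (rule fundamental_theorem_of_calculus_abs_cont[OF _ _ N1(1)])
        show "abs_cont_on {c..y} u" using abs_cont_on_subset[OF uac] y by auto
        fix z assume z: "z \<in> {c..y} - N1"
        then have "u differentiable (at z)" using y by (intro N1(2) DiffI subsetD[OF sub]) auto
        then show "(u has_real_derivative deriv u z) (at z within {c..y})"
          by (simp add: DERIV_deriv_iff_real_differentiable has_field_derivative_at_within)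
      qed (use y in auto)
      fix z assume z: "z \<in> {c..y} - N2"
      then have zO: "z \<in> Om" using y sub by (intro subsetD[OF sub]) simp
      then have "a z * deriv u z = w z" using N2(2)[of z] z by (simp add: flux_def)
      then show "w z / a z = deriv u z" using apos[OF zO] by (simp add: field_simps)
    qed
    have "((\<lambda>y. integral {c..y} (\<lambda>x. w x / a x)) has_real_derivative w x / a x) (at x within {c..d})"
      by (rule integral_has_real_derivative[OF cont]) (use cd in auto)
    then have "((\<lambda>y. u c + integral {c..y} (\<lambda>x. w x / a x)) has_real_derivative w x / a x) (at x within {c..d})"
      by (auto intro!: derivative_eq_intros)
    then have "(u has_real_derivative w x / a x) (at x within {c..d})"
      by (rule has_field_derivative_transform_within[OF _ zero_less_one])
        (use cd integral_unique[OF I] in auto)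
    then show ?thesis using cd by (simp add: at_within_Icc_at)
  qed
  have fl: "flux a u x = w x" if "x \<in> Om" for x
    using DERIV_imp_deriv[OF der[OF that]] apos[OF that] by (simp add: flux_def)
  \<comment> \<open>A derivative at \<open>x\<close> depends only on values near \<open>x\<close>,
    so equality on the open interval suffices.\<close>
  have dfl: "deriv (flux a u) x = deriv w x" if "x \<in> Om" for x
    by (rule deriv_cong_ev) (use fl that eventually_nhds_in_open[of Om x] in \<open>auto elim: eventually_mono\<close>)
  show thesis by (rule that[OF w(2,3,4)]) (rule der fl dfl, assumption)+
qed

text \<open>The limits of the flux at the ends are the end values of \<open>w\<close>, since
  \<open>w\<close> is continuous on the closed interval. The penalty derivative is nonzero only
  where the boundary value of \<open>u\<close> is negative, and there the Robin condition with its
  sign restriction fixes the sign of the outward flux.\<close>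

lemma flux_boundary_sign:
  assumes D: "assumption_Deg a \<beta>\<^sub>0 \<beta>\<^sub>1 \<gamma>\<^sub>0 \<gamma>\<^sub>1 \<theta>"
    and bc: "boundary_conditions a \<beta>\<^sub>0 \<beta>\<^sub>1 \<gamma>\<^sub>0 \<gamma>\<^sub>1 u"
    and w: "continuous_on {-1..1} w" "\<And>x. x \<in> Om \<Longrightarrow> flux a u x = w x"
  shows "if weakly_degenerate a then 0 \<le> dpenalty (- u 1) * w 1 \<and> dpenalty (- u (-1)) * w (-1) \<le> 0
         else w 1 = 0 \<and> w (-1) = 0"
proof -
  have r: "(w \<longlongrightarrow> w (-1)) (at_right (-1))"
    using continuous_on_Icc_at_rightD[OF w(1)] by simp
  have l: "(w \<longlongrightarrow> w 1) (at_left 1)"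
    using continuous_on_Icc_at_leftD[OF w(1)] by simp
  have R: "m = w (-1)" if "(flux a u \<longlongrightarrow> m) (at_right (-1))" for m
  proof (rule tendsto_unique[OF _ that])
    have "eventually (\<lambda>x. x \<in> Om) (at_right (-1::real))"
      using eventually_at_right_real[of "-1" "1::real"] by simp
    then have "eventually (\<lambda>x. w x = flux a u x) (at_right (-1))"
      by (rule eventually_mono) (simp add: w(2))
    then show "(flux a u \<longlongrightarrow> w (-1)) (at_right (-1))" using r by (rule Lim_transform_eventually[rotated])
  qed simp
  have L: "m = w 1" if "(flux a u \<longlongrightarrow> m) (at_left 1)" for m
  proof (rule tendsto_unique[OF _ that])
    have "eventually (\<lambda>x. x \<in> Om) (at_left (1::real))"
      using eventually_at_left_real[of "-1" "1::real"] by simp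
    then have "eventually (\<lambda>x. w x = flux a u x) (at_left 1)"
      by (rule eventually_mono) (simp add: w(2))
    then show "(flux a u \<longlongrightarrow> w 1) (at_left 1)" using l by (rule Lim_transform_eventually[rotated])
  qed simp
  \<comment> \<open>Both ends at once: \<open>k\<close> is the outward normal, 1 on the right and -1
    on the left, and \<open>m\<close> the flux there.\<close>
  have sign: "0 \<le> dpenalty (- s) * (k * m)"
    if "c0\<^sup>2 + c1\<^sup>2 > 0" "0 \<le> k * (c0 * c1)" "c0 * s + c1 * m = 0" for c0 c1 s m k :: real
  proof (cases "0 \<le> s")
    case False
    \<comment> \<open>If \<open>c1 = 0\<close>, then \<open>c0\<close> is nonzero and the condition
      forces \<open>s = 0\<close>, contrary to \<open>s < 0\<close>.\<close>
    have "c1 \<noteq> 0" using that False by auto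
    then have m: "m = - c0 * s / c1" using that(3) by (simp add: field_simps)
    have "k * m = (k * (c0 * c1)) * (- s) / c1\<^sup>2"
      unfolding m using \<open>c1 \<noteq> 0\<close> by (simp add: field_simps power2_eq_square)
    also have "\<dots> \<ge> 0" using that(2) False by (intro divide_nonneg_nonneg mult_nonneg_nonneg[OF that(2)]) auto
    finally show ?thesis using dpenalty_bounds by simp
  qed simp
  show ?thesis
  proof (cases "weakly_degenerate a")
    case True
    then have b: "\<beta>\<^sub>0 * u (-1) + \<beta>\<^sub>1 * w (-1) = 0" "\<gamma>\<^sub>0 * u 1 + \<gamma>\<^sub>1 * w 1 = 0"
      using bc R L by (auto simp: boundary_conditions_def robin_bc_def)
    have s: "\<beta>\<^sub>0\<^sup>2 + \<beta>\<^sub>1\<^sup>2 > 0" "\<gamma>\<^sub>0\<^sup>2 + \<gamma>\<^sub>1\<^sup>2 > 0" "0 \<le> -1 * (\<beta>\<^sub>0 * \<beta>\<^sub>1)" "0 \<le> 1 * (\<gamma>\<^sub>0 * \<gamma>\<^sub>1)"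
      using D True by (auto simp: assumption_Deg_def)
    show ?thesis using True sign[OF s(1,3) b(1)] sign[OF s(2,4) b(2)] by simp
  next
    case False
    then show ?thesis using bc R L by (auto simp: boundary_conditions_def)
  qed
qed

lemma borel_measurable_dpenalty [measurable]: "dpenalty \<in> borel_measurable borel"
  by (rule borel_measurable_continuous_onI) (rule dpenalty_continuous)

lemma borel_measurable_penalty [measurable]: "penalty \<in> borel_measurable borel"
  by (rule borel_measurable_continuous_onI) (rule penalty_continuous)

text \<open>Integration by parts away from the degenerate ends. With \<open>u' = w / a\<close>, the
  derivative of \<open>dpenalty (- u) * w\<close> is the integrand minus
  \<open>ddpenalty (- u) * w^2 / a\<close>; dropping this signed term gives the inequality.\<close>

lemma has_integral_dpenalty_flux_ge:
  assumes w: "abs_cont_on {-1..1} w" "ae_differentiable_on Om w"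
    and apos: "\<And>x. x \<in> Om \<Longrightarrow> a x > 0" and acont: "continuous_on {-1..1} a"
    and u: "\<And>x. x \<in> Om \<Longrightarrow> (u has_real_derivative w x / a x) (at x)"
    and cd: "-1 < c" "c \<le> d" "d < 1"
    and I: "((\<lambda>x. dpenalty (- u x) * deriv w x) has_integral I) {c..d}"
  shows "dpenalty (- u d) * w d - dpenalty (- u c) * w c \<le> I"
proof -
  have sub: "{c..d} \<subseteq> Om" "{c..d} \<subseteq> {-1..1}" using cd by (simp_all add: subset_iff)
  have wc: "continuous_on {c..d} w"
    using abs_cont_on_imp_continuous_on[OF w(1)] sub(2) continuous_on_subset by blast
  have ac: "continuous_on {c..d} a" using acont sub(2) continuous_on_subset by blast
  have "continuous_on {c..d} (\<lambda>x. w x / a x)"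
    by (rule continuous_on_divide[OF wc ac]) (use sub(1) apos in fastforce)
  then have "bounded ((\<lambda>x. w x / a x) ` {c..d})" "bounded (w ` {c..d})"
    using wc by (auto intro: compact_imp_bounded compact_continuous_image)
  then obtain L W where L: "\<And>x. x \<in> {c..d} \<Longrightarrow> \<bar>w x / a x\<bar> \<le> L"
    and W: "\<And>x. x \<in> {c..d} \<Longrightarrow> \<bar>w x\<bar> \<le> W"
    unfolding bounded_iff by (metis imageI real_norm_def)
  have L0: "L \<ge> 0" "W \<ge> 0" using order_trans[OF abs_ge_zero L[of c]] order_trans[OF abs_ge_zero W[of c]] cd by auto
  \<comment> \<open>On \<open>{c..d}\<close> the quotient \<open>w / a\<close> is bounded, so
    \<open>u\<close> is Lipschitz and the product with \<open>w\<close> stays absolutely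
    continuous.\<close>
  have ulip: "\<bar>u x - u y\<bar> \<le> L * \<bar>x - y\<bar>" if "x \<in> {c..d}" "y \<in> {c..d}" for x y
  proof -
    have "norm (u x - u y) \<le> L * norm (x - y)"
    proof (rule field_differentiable_bound[OF _ _ _ that, where f' = "\<lambda>z. w z / a z"])
      fix z assume z: "z \<in> {c..d}"
      show "(u has_field_derivative w z / a z) (at z within {c..d})"
        by (rule has_field_derivative_at_within[OF u[OF subsetD[OF sub(1) z]]])
      show "norm (w z / a z) \<le> L" using L[OF z] by simp
    qed simp
    then show ?thesis by simp
  qed
  define p where "p = (\<lambda>x. dpenalty (- u x))"
  have p1: "\<bar>p x\<bar> \<le> 1" for x using dpenalty_bounds[of "- u x"] by (simp add: p_def)
  have "abs_cont_on {c..d} (\<lambda>x. p x * w x)"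
  proof (rule abs_cont_on_lipschitz_combination[where g = w and B = 1 and L = "W * L"])
    show "abs_cont_on {c..d} w" by (rule abs_cont_on_subset[OF w(1) sub(2)])
    show "0 \<le> W * L" using L0 by simp
    fix x y assume xy: "x \<in> {c..d}" "y \<in> {c..d}"
    have "p x * w x - p y * w y = p x * (w x - w y) + w y * (p x - p y)" by (simp add: algebra_simps)
    also have "\<bar>\<dots>\<bar> \<le> \<bar>p x\<bar> * \<bar>w x - w y\<bar> + \<bar>w y\<bar> * \<bar>p x - p y\<bar>"
      by (rule order_trans[OF abs_triangle_ineq]) (simp add: abs_mult)
    also have "\<dots> \<le> 1 * \<bar>w x - w y\<bar> + W * (L * \<bar>x - y\<bar>)"
    proof (intro add_mono mult_mono p1 W xy L0)
      have "\<bar>p x - p y\<bar> \<le> \<bar>u x - u y\<bar>" using dpenalty_lipschitz[of "- u x" "- u y"] by (simp add: p_def)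
      also have "\<dots> \<le> L * \<bar>x - y\<bar>" by (rule ulip[OF xy])
      finally show "\<bar>p x - p y\<bar> \<le> L * \<bar>x - y\<bar>" .
    qed auto
    finally show "\<bar>p x * w x - p y * w y\<bar> \<le> 1 * \<bar>w x - w y\<bar> + W * L * \<bar>x - y\<bar>" by simp
  qed simp
  moreover
  obtain N where N: "negligible N" "\<And>x. x \<in> Om - N \<Longrightarrow> w differentiable (at x)"
    by (rule AE_lebesgue_on_negligible[OF w(2)[unfolded ae_differentiable_on_def]]) auto
  have "((\<lambda>x. p x * w x) has_real_derivative
      - ddpenalty (- u x) * (w x / a x) * w x + deriv w x * p x) (at x within {c..d})"
    if x: "x \<in> {c..d} - N" for x
  proof -
    have xO: "x \<in> Om" using x sub(1) by blast
    have "(w has_real_derivative deriv w x) (at x)"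
      using N(2)[of x] xO x by (simp add: DERIV_deriv_iff_real_differentiable)
    moreover have "(p has_real_derivative ddpenalty (- u x) * (- (w x / a x))) (at x)"
      unfolding p_def by (rule DERIV_chain2[OF dpenalty_deriv DERIV_minus[OF u[OF xO]]])
    ultimately have "((\<lambda>x. p x * w x) has_real_derivative
      ddpenalty (- u x) * (- (w x / a x)) * w x + deriv w x * p x) (at x)"
      by (intro DERIV_mult)
    then show ?thesis by (simp add: has_field_derivative_at_within)
  qed
  ultimately have "((\<lambda>x. - ddpenalty (- u x) * (w x / a x) * w x + deriv w x * p x)
      has_integral p d * w d - p c * w c) {c..d}"
    by (intro fundamental_theorem_of_calculus_abs_cont[OF cd(2) _ N(1)])
  then have "p d * w d - p c * w c \<le> I"
  proof (rule has_integral_le[OF _ I])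
    fix x assume "x \<in> {c..d}"
    then have "0 < a x" using apos sub by blast
    then have "0 \<le> ddpenalty (- u x) * (w x * w x / a x)"
      by (rule mult_nonneg_nonneg[OF ddpenalty_bounds(1) divide_nonneg_pos[OF zero_le_square]])
    then show "- ddpenalty (- u x) * (w x / a x) * w x + deriv w x * p x \<le> dpenalty (- u x) * deriv w x"
      by (simp add: p_def mult.commute mult.left_commute)
  qed
  then show ?thesis by (simp add: p_def)
qed

lemma dpenalty_flux_nonneg:
  assumes D: "assumption_Deg a \<beta>\<^sub>0 \<beta>\<^sub>1 \<gamma>\<^sub>0 \<gamma>\<^sub>1 \<theta>" and u: "u \<in> H2a a"
    and bc: "boundary_conditions a \<beta>\<^sub>0 \<beta>\<^sub>1 \<gamma>\<^sub>0 \<gamma>\<^sub>1 u"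
  shows "integrable (lebesgue_on Om) (\<lambda>x. dpenalty (- u x) * deriv (flux a u) x)"
    and "0 \<le> (LINT x|lebesgue_on Om. dpenalty (- u x) * deriv (flux a u) x)"
proof -
  obtain w where w: "abs_cont_on {-1..1} w" "ae_differentiable_on Om w" "deriv w \<in> L2"
    and du: "\<And>x. x \<in> Om \<Longrightarrow> (u has_real_derivative w x / a x) (at x)"
    and fl: "\<And>x. x \<in> Om \<Longrightarrow> flux a u x = w x"
    and dfl: "\<And>x. x \<in> Om \<Longrightarrow> deriv (flux a u) x = deriv w x"
    by (rule H2a_regularity[OF D u]) blast
  have apos: "a x > 0" if "x \<in> Om" for x using D that by (auto simp: assumption_Deg_def)
  have acont: "continuous_on {-1..1} a" using D by (auto simp: assumption_Deg_def)
  have wcont: "continuous_on {-1..1} w" by (rule abs_cont_on_imp_continuous_on[OF w(1)])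
  define h where "h = (\<lambda>x. dpenalty (- u x) * deriv w x)"
  have um: "u \<in> borel_measurable (lebesgue_on Om)"
    using u by (simp add: H2a_def H1a_def L2_def square_integrable_def)
  have hint: "integrable (lebesgue_on Om) h"
    unfolding h_def
  proof (rule square_integrable_bounded_mult[OF finite_measure_Om])
    show "square_integrable (lebesgue_on Om) (deriv w)" using w(3) by (simp add: L2_def)
    show "(\<lambda>x. dpenalty (- u x)) \<in> borel_measurable (lebesgue_on Om)" using um by measurable
    show "\<bar>dpenalty (- u x)\<bar> \<le> 1" for x using dpenalty_bounds[of "- u x"] by simp
  qed
  have eq: "dpenalty (- u x) * deriv (flux a u) x = h x" if "x \<in> space (lebesgue_on Om)" for x
    using dfl that by (simp add: h_def)
  show "integrable (lebesgue_on Om) (\<lambda>x. dpenalty (- u x) * deriv (flux a u) x)"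
    by (subst Bochner_Integration.integrable_cong[OF refl eq]) (use hint in auto)
  have hI: "(h has_integral (LINT x|lebesgue_on Om. h x)) {-1..1}"
    using has_integral_integral_lebesgue_on[OF hint] by (simp add: has_integral_Icc_iff_Ioo)
  then have hon: "h integrable_on {-1..1}" by blast
  define F where "F = (\<lambda>y. integral {-1..y} h)"
  have Fcont: "continuous_on {-1..1} F"
    unfolding F_def by (rule indefinite_integral_continuous_1[OF hon])
  have Fsplit: "F c + integral {c..d} h = F d" if "-1 \<le> c" "c \<le> d" "d \<le> 1" for c d
    unfolding F_def using that
    by (intro Henstock_Kurzweil_Integration.integral_combine integrable_on_subinterval[OF hon]) auto
  \<comment> \<open>The bound is available only on compact subintervals of the open interval.
    Exhausting by \<open>{- d n..d n}\<close> and writing the integrals through the continuous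
    primitive \<open>F\<close> lets both sides pass to the limit.\<close>
  define d :: "nat \<Rightarrow> real" where "d = (\<lambda>n. 1 - inverse (real (Suc n)))"
  have d: "0 \<le> d n" "d n < 1" for n by (auto simp: d_def field_simps)
  have dlim: "d \<longlonglongrightarrow> 1"
    unfolding d_def using tendsto_diff[OF tendsto_const LIMSEQ_inverse_real_of_nat, of 1] by simp
  have ge: "dpenalty (- u (d n)) * w (d n) - dpenalty (- u (- d n)) * w (- d n) \<le> F (d n) - F (- d n)" for n
  proof (rule has_integral_dpenalty_flux_ge[OF w(1,2) apos acont du])
    have "(h has_integral integral {- d n..d n} h) {- d n..d n}"
      using d[of n] by (intro integrable_integral integrable_on_subinterval[OF hon]) auto
    moreover have "integral {- d n..d n} h = F (d n) - F (- d n)"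
      using Fsplit[of "- d n" "d n"] d[of n] by simp
    ultimately show "((\<lambda>x. dpenalty (- u x) * deriv w x) has_integral F (d n) - F (- d n)) {- d n..d n}"
      by (simp add: h_def)
  qed (use d[of n] in auto)
  have seq: "(\<lambda>n. g (d n)) \<longlonglongrightarrow> g 1" "(\<lambda>n. g (- d n)) \<longlonglongrightarrow> g (- 1)"
    if g: "continuous_on {-1..1} g" for g :: "real \<Rightarrow> real"
  proof -
    have m: "d n \<in> {-1..1}" "- d n \<in> {-1..1}" for n using d[of n] by auto
    show "(\<lambda>n. g (d n)) \<longlonglongrightarrow> g 1"
      by (rule continuous_on_tendsto_compose[OF g dlim]) (use m in auto)
    show "(\<lambda>n. g (- d n)) \<longlonglongrightarrow> g (- 1)"
      by (rule continuous_on_tendsto_compose[OF g tendsto_minus[OF dlim]]) (use m in auto)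
  qed
  have Fl: "(\<lambda>n. F (d n) - F (- d n)) \<longlonglongrightarrow> F 1 - F (- 1)"
    by (intro tendsto_diff seq Fcont)
  note sgn = flux_boundary_sign[OF D bc wcont fl]
  \<comment> \<open>In the weakly degenerate case \<open>u\<close> is continuous up to the ends and
    the limit is the boundary expression of known sign. Otherwise \<open>dpenalty (- u)\<close> need
    not converge at the ends, but it is bounded by 1 and \<open>w\<close> tends to 0.\<close>
  obtain l where l: "(\<lambda>n. dpenalty (- u (d n)) * w (d n) - dpenalty (- u (- d n)) * w (- d n)) \<longlonglongrightarrow> l" "0 \<le> l"
  proof (cases "weakly_degenerate a")
    case True
    then have "abs_cont_on {-1..1} u" using u by (simp add: H2a_def H1a_def)
    then have uc: "continuous_on {-1..1} u" by (rule abs_cont_on_imp_continuous_on)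
    have pc: "continuous_on {-1..1} (\<lambda>x. dpenalty (- u x) * w x)"
      by (intro continuous_on_mult wcont
          continuous_on_compose2[OF dpenalty_continuous[of UNIV] continuous_on_minus[OF uc]]) simp
    show thesis
    proof (rule that)
      show "(\<lambda>n. dpenalty (- u (d n)) * w (d n) - dpenalty (- u (- d n)) * w (- d n))
          \<longlonglongrightarrow> dpenalty (- u 1) * w 1 - dpenalty (- u (- 1)) * w (- 1)"
        by (intro tendsto_diff seq[OF pc])
      show "0 \<le> dpenalty (- u 1) * w 1 - dpenalty (- u (- 1)) * w (- 1)" using sgn True by simp
    qed
  next
    case False
    then have "w 1 = 0" "w (-1) = 0" using sgn by auto
    then have w0: "(\<lambda>n. \<bar>w (d n)\<bar>) \<longlonglongrightarrow> 0" "(\<lambda>n. \<bar>w (- d n)\<bar>) \<longlonglongrightarrow> 0"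
      using seq[OF wcont] tendsto_rabs_zero by auto
    have bd: "norm (dpenalty y * z) \<le> \<bar>z\<bar>" for y z
      using dpenalty_bounds[of y] by (simp add: abs_mult mult_left_le_one_le)
    have "(\<lambda>n. dpenalty (- u (d n)) * w (d n)) \<longlonglongrightarrow> 0"
      by (rule Lim_null_comparison[OF always_eventually w0(1)]) (intro allI bd)
    moreover have "(\<lambda>n. dpenalty (- u (- d n)) * w (- d n)) \<longlonglongrightarrow> 0"
      by (rule Lim_null_comparison[OF always_eventually w0(2)]) (intro allI bd)
    ultimately show thesis by (rule that[OF tendsto_diff]) simp
  qed
  have "l \<le> F 1 - F (-1)" by (rule LIMSEQ_le[OF l(1) Fl]) (use ge in blast)
  moreover have "F 1 = (LINT x|lebesgue_on Om. h x)" unfolding F_def using hI by (rule integral_unique)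
  moreover have "F (-1) = 0" by (simp add: F_def)
  ultimately have "0 \<le> (LINT x|lebesgue_on Om. h x)" using l(2) by simp
  also have "\<dots> = (LINT x|lebesgue_on Om. dpenalty (- u x) * deriv (flux a u) x)"
    by (rule Bochner_Integration.integral_cong[OF refl]) (simp only: eq)
  finally show "0 \<le> (LINT x|lebesgue_on Om. dpenalty (- u x) * deriv (flux a u) x)" .
qed

section \<open>Weak derivatives of scalar functions\<close>

text \<open>A C^1 step rising from 0 to 1 over [0,1], the primitive of the hat function
  \<open>tent\<close> of height 2 and area 1. Writing both with truncated powers makes every term an
  instance of the cutoff derivative rule.\<close>

definition smoothstep :: "real \<Rightarrow> real" where
  "smoothstep x = (if x \<le> 0 then 0 else 2 * x\<^sup>2)
     - 2 * (if x - 1/2 \<le> 0 then 0 else 2 * (x - 1/2)\<^sup>2) + (if x - 1 \<le> 0 then 0 else 2 * (x - 1)\<^sup>2)"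

definition tent :: "real \<Rightarrow> real" where
  "tent x = (if x \<le> 0 then 0 else 4 * x)
     - 2 * (if x - 1/2 \<le> 0 then 0 else 4 * (x - 1/2)) + (if x - 1 \<le> 0 then 0 else 4 * (x - 1))"

lemma smoothstep_deriv: "(smoothstep has_real_derivative tent x) (at x)"
proof -
  have q: "((\<lambda>x::real. if x \<le> 0 then 0 else 2 * x\<^sup>2) has_real_derivative (if x \<le> 0 then 0 else 4 * x)) (at x)" for x
    by (rule has_real_derivative_cutoff) (auto intro!: derivative_eq_intros)
  have qs: "((\<lambda>x::real. if x - c \<le> 0 then 0 else 2 * (x - c)\<^sup>2) has_real_derivative (if x - c \<le> 0 then 0 else 4 * (x - c))) (at x)" for c x
  proof -
    have "((\<lambda>x. x - c) has_real_derivative 1) (at x)" by (auto intro!: derivative_eq_intros)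
    from DERIV_chain2[OF q[of "x - c"] this] show ?thesis by simp
  qed
  show ?thesis unfolding smoothstep_def[abs_def] tent_def
    by (intro DERIV_add DERIV_diff DERIV_cmult q qs)
qed

lemma tent_continuous: "continuous_on A tent"
proof -
  have eq: "tent = (\<lambda>x. 4 * max 0 x - 8 * max 0 (x - 1/2) + 4 * max 0 (x - 1))"
    by (auto simp: fun_eq_iff tent_def max_def)
  show ?thesis unfolding eq by (intro continuous_intros)
qed

lemma tent_nonneg: "0 \<le> tent x" by (auto simp: tent_def)

lemma tent_eq_0: "x \<le> 0 \<or> 1 \<le> x \<Longrightarrow> tent x = 0" by (auto simp: tent_def)

lemma smoothstep_le_0: "x \<le> 0 \<Longrightarrow> smoothstep x = 0" by (simp add: smoothstep_def)

lemma smoothstep_ge_1: "1 \<le> x \<Longrightarrow> smoothstep x = 1"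
  by (simp add: smoothstep_def power2_eq_square) (simp add: algebra_simps)

lemma smoothstep_mono: "x \<le> y \<Longrightarrow> smoothstep x \<le> smoothstep y"
  by (rule DERIV_nonneg_imp_nondecreasing[of x y smoothstep]) (use smoothstep_deriv tent_nonneg in blast)+

lemma smoothstep_bounds: "0 \<le> smoothstep x" "smoothstep x \<le> 1"
proof -
  show "0 \<le> smoothstep x" using smoothstep_mono[of "min x 0" x] smoothstep_le_0[of "min x 0"] by simp
  show "smoothstep x \<le> 1" using smoothstep_mono[of x "max x 1"] smoothstep_ge_1[of "max x 1"] by simp
qed

text \<open>The kernel \<open>tent ((r - c) / h) / h\<close> is nonnegative, vanishes outside
  \<open>{c..c+h}\<close> and has integral 1, so the integral is an average of the values of
  \<open>m\<close> there.\<close>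

lemma integral_tent_approx:
  assumes m: "continuous_on {0..T} m" and h: "h > 0" and c: "0 \<le> c" "c + h \<le> T"
    and e: "\<And>r. r \<in> {c..c+h} \<Longrightarrow> \<bar>m r - M\<bar> \<le> e"
  shows "\<bar>integral {0..T} (\<lambda>r. tent ((r - c) / h) / h * m r) - M\<bar> \<le> e"
proof -
  define \<rho> where "\<rho> = (\<lambda>r. tent ((r - c) / h) / h)"
  have \<rho>c: "continuous_on {0..T} \<rho>" unfolding \<rho>_def
    by (intro continuous_intros continuous_on_compose2[OF tent_continuous[of UNIV]]) (use h in auto)
  have "(\<rho> has_integral (smoothstep ((T - c) / h) - smoothstep ((0 - c) / h))) {0..T}"
  proof (rule fundamental_theorem_of_calculus)
    fix x assume "x \<in> {0..T}"
    have "((\<lambda>r. (r - c) / h) has_real_derivative 1 / h) (at x within {0..T})"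
      using h by (auto intro!: derivative_eq_intros)
    from DERIV_chain2[OF smoothstep_deriv this]
    show "((\<lambda>r. smoothstep ((r - c) / h)) has_vector_derivative \<rho> x) (at x within {0..T})"
      by (simp add: \<rho>_def has_real_derivative_iff_has_vector_derivative)
  qed (use h c in auto)
  moreover have "smoothstep ((T - c) / h) = 1" "smoothstep ((0 - c) / h) = 0"
    using h c by (auto intro!: smoothstep_ge_1 smoothstep_le_0 simp: field_simps divide_le_0_iff)
  ultimately have \<rho>1: "(\<rho> has_integral 1) {0..T}" by simp
  have I: "((\<lambda>r. \<rho> r * m r) has_integral integral {0..T} (\<lambda>r. \<rho> r * m r)) {0..T}"
    by (intro integrable_integral integrable_continuous_interval continuous_intros \<rho>c m)
  have near: "\<rho> r * (M - e) \<le> \<rho> r * m r \<and> \<rho> r * m r \<le> \<rho> r * (M + e)" for r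
  proof (cases "r \<in> {c..c+h}")
    case True
    then show ?thesis using e[OF True] h tent_nonneg
      by (intro conjI mult_left_mono) (auto simp: \<rho>_def)
  next
    case False
    then have "(r - c) / h \<le> 0 \<or> 1 \<le> (r - c) / h" using h by (auto simp: field_simps divide_le_0_iff)
    then show ?thesis by (simp add: \<rho>_def tent_eq_0)
  qed
  have "1 * (M - e) \<le> integral {0..T} (\<lambda>r. \<rho> r * m r)"
    by (rule has_integral_le[OF has_integral_mult_left[OF \<rho>1] I]) (use near in blast)
  moreover have "integral {0..T} (\<lambda>r. \<rho> r * m r) \<le> 1 * (M + e)"
    by (rule has_integral_le[OF I has_integral_mult_left[OF \<rho>1]]) (use near in blast)
  ultimately show ?thesis by (simp add: \<rho>_def abs_le_iff)
qed

lemma continuous_on_integrable_lebesgue_on_Ioo: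
  fixes g :: "real \<Rightarrow> real"
  assumes "continuous_on {c..d} g" shows "integrable (lebesgue_on {c<..<d}) g"
proof (rule absolutely_integrable_imp_integrable)
  show "g absolutely_integrable_on {c<..<d}"
    by (rule set_integrable_subset[OF absolutely_integrable_continuous_real[OF assms]]) auto
qed auto

lemma lebesgue_integral_Ioo_eq_integral_Icc:
  fixes g :: "real \<Rightarrow> real"
  assumes "integrable (lebesgue_on {c<..<d}) g"
  shows "(LINT x|lebesgue_on {c<..<d}. g x) = integral {c..d} g"
  using has_integral_integral_lebesgue_on[OF assms]
  by (intro integral_unique[symmetric]) (simp add: has_integral_Icc_iff_Ioo)

text \<open>Test functions approximating the indicator of the interval from \<open>s\<close> to
  \<open>t\<close> have as derivative the difference of two averaging kernels, one concentrating at
  \<open>s\<close>, the other at \<open>t\<close>. Continuity of \<open>m\<close> makes the averages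
  converge to its values, end points of \<open>{0..T}\<close> included.\<close>

lemma weak_derivative_fundamental_theorem:
  fixes m k :: "real \<Rightarrow> real"
  assumes m: "continuous_on {0..T} m" and k: "integrable (lebesgue_on {0<..<T}) k"
    and weak: "\<And>\<phi>. \<phi> C1_differentiable_on UNIV \<Longrightarrow>
      \<exists>c d. 0 < c \<and> d < T \<and> (\<forall>t. t \<notin> {c..d} \<longrightarrow> \<phi> t = 0) \<Longrightarrow>
      (LINT t|lebesgue_on {0<..<T}. deriv \<phi> t * m t) = - (LINT t|lebesgue_on {0<..<T}. \<phi> t * k t)"
    and st: "0 \<le> s" "s \<le> t" "t \<le> T"
  shows "m t - m s = integral {s..t} k"
proof (cases "s = t")
  case False
  then have lt: "s < t" using st by simp
  \<comment> \<open>That is \<open>(t - s) / (n + 4)\<close>: four widths fit into the interval, so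
    the rising and falling ramps do not overlap.\<close>
  define h where "h = (\<lambda>n::nat. (t - s) * inverse (real (Suc (n + 3))))"
  have h: "0 < h n" "4 * h n \<le> t - s" for n
  proof -
    show "0 < h n" using lt by (simp add: h_def)
    have "(t - s) * 4 \<le> (t - s) * real (Suc (n + 3))" using lt by (intro mult_left_mono) auto
    then show "4 * h n \<le> t - s" by (simp add: h_def field_simps)
  qed
  have hlim: "h \<longlonglongrightarrow> 0"
    unfolding h_def
    using tendsto_mult[OF tendsto_const LIMSEQ_ignore_initial_segment[OF LIMSEQ_inverse_real_of_nat, of 3], of "t - s"]
    by simp
  \<comment> \<open>Rises on \<open>{s + h n..s + 2 * h n}\<close> and falls on
    \<open>{t - 2 * h n..t - h n}\<close>. The gap of one \<open>h n\<close> at each end keeps the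
    support away from 0 and \<open>T\<close> even if \<open>s = 0\<close> or
    \<open>t = T\<close>.\<close>
  define \<phi> where "\<phi> = (\<lambda>n r. smoothstep ((r - (s + h n)) / h n) - smoothstep ((r - (t - 2 * h n)) / h n))"
  define d\<phi> where "d\<phi> = (\<lambda>n r. tent ((r - (s + h n)) / h n) / h n - tent ((r - (t - 2 * h n)) / h n) / h n)"
  have der: "(\<phi> n has_real_derivative d\<phi> n r) (at r)" for n r
  proof -
    have *: "((\<lambda>r. smoothstep ((r - c) / h n)) has_real_derivative tent ((r - c) / h n) / h n) (at r)" for c
    proof -
      have "((\<lambda>r. (r - c) / h n) has_real_derivative 1 / h n) (at r)"
        using h(1)[of n] by (auto intro!: derivative_eq_intros)
      from DERIV_chain2[OF smoothstep_deriv this] show ?thesis by simp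
    qed
    show ?thesis unfolding \<phi>_def d\<phi>_def by (intro DERIV_diff *)
  qed
  have dcont: "continuous_on A (\<lambda>r. tent ((r - c) / h n) / h n)" for A c n
    by (intro continuous_intros continuous_on_compose2[OF tent_continuous[of UNIV]])
      (use h(1)[of n] in auto)
  have C1: "\<phi> n C1_differentiable_on UNIV" for n
    unfolding C1_differentiable_on_def
  proof (intro exI[of _ "d\<phi> n"] conjI ballI)
    show "continuous_on UNIV (d\<phi> n)" unfolding d\<phi>_def by (intro continuous_on_diff dcont)
  qed (use der in \<open>simp add: has_real_derivative_iff_has_vector_derivative\<close>)
  have out: "\<phi> n r = 0" if "r \<le> s + h n \<or> t - h n \<le> r" for n r
    using that
  proof
    assume "r \<le> s + h n"
    then have "(r - (s + h n)) / h n \<le> 0" "(r - (t - 2 * h n)) / h n \<le> 0"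
      using h[of n] by (auto simp: divide_le_0_iff)
    then show ?thesis by (simp add: \<phi>_def smoothstep_le_0)
  next
    assume "t - h n \<le> r"
    then have "1 \<le> (r - (s + h n)) / h n" "1 \<le> (r - (t - 2 * h n)) / h n"
      using h[of n] by (auto simp: le_divide_eq)
    then show ?thesis by (simp add: \<phi>_def smoothstep_ge_1)
  qed
  have supp: "\<exists>c d. 0 < c \<and> d < T \<and> (\<forall>r. r \<notin> {c..d} \<longrightarrow> \<phi> n r = 0)" for n
    by (rule exI[of _ "s + h n"], rule exI[of _ "t - h n"])
      (use h[of n] st out[of _ n] in force)
  have eq: "(LINT r|lebesgue_on {0<..<T}. d\<phi> n r * m r) = - (LINT r|lebesgue_on {0<..<T}. \<phi> n r * k r)" for n
    using weak[OF C1 supp, of n] DERIV_imp_deriv[OF der] by simp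
  define A where "A = (\<lambda>n c. integral {0..T} (\<lambda>r. tent ((r - c) / h n) / h n * m r))"
  have LA: "(LINT r|lebesgue_on {0<..<T}. d\<phi> n r * m r) = A n (s + h n) - A n (t - 2 * h n)" for n
  proof -
    have "continuous_on {0..T} (\<lambda>r. d\<phi> n r * m r)"
      unfolding d\<phi>_def by (intro continuous_on_mult continuous_on_diff dcont m)
    then have "(LINT r|lebesgue_on {0<..<T}. d\<phi> n r * m r) = integral {0..T} (\<lambda>r. d\<phi> n r * m r)"
      by (intro lebesgue_integral_Ioo_eq_integral_Icc continuous_on_integrable_lebesgue_on_Ioo)
    also have "\<dots> = A n (s + h n) - A n (t - 2 * h n)"
      unfolding A_def d\<phi>_def left_diff_distrib
      by (intro Henstock_Kurzweil_Integration.integral_diff integrable_continuous_interval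
          continuous_on_mult dcont m)
    finally show ?thesis .
  qed
  have Alim: "(\<lambda>n. A n (c n)) \<longlonglongrightarrow> m \<tau>"
    if \<tau>: "\<tau> \<in> {0..T}" and c: "\<And>n. 0 \<le> c n \<and> c n + h n \<le> T" "\<And>n r. r \<in> {c n..c n + h n} \<Longrightarrow> \<bar>r - \<tau>\<bar> \<le> 2 * h n" for c \<tau>
  proof (rule LIMSEQ_I)
    fix e :: real assume "0 < e"
    then have "0 < e / 2" by simp
    then obtain \<delta> where "\<delta> > 0" and \<delta>: "\<And>r. r \<in> {0..T} \<Longrightarrow> \<bar>r - \<tau>\<bar> < \<delta> \<Longrightarrow> \<bar>m r - m \<tau>\<bar> < e / 2"
      using m \<tau> unfolding continuous_on_iff dist_real_def by blast
    have "eventually (\<lambda>n. h n < \<delta> / 2) sequentially"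
      by (rule order_tendstoD(2)[OF hlim]) (use \<open>\<delta> > 0\<close> in simp)
    then obtain n0 where n0: "\<And>n. n \<ge> n0 \<Longrightarrow> h n < \<delta> / 2" by (auto simp: eventually_sequentially)
    have "norm (A n (c n) - m \<tau>) < e" if "n \<ge> n0" for n
    proof -
      have "\<bar>A n (c n) - m \<tau>\<bar> \<le> e / 2"
        unfolding A_def
      proof (rule integral_tent_approx[OF m h(1)])
        fix r assume r: "r \<in> {c n..c n + h n}"
        then have "\<bar>r - \<tau>\<bar> < \<delta>" "r \<in> {0..T}" using c(1)[of n] c(2)[OF r] n0[OF that] by auto
        then show "\<bar>m r - m \<tau>\<bar> \<le> e / 2" using \<delta>[of r] by simp
      qed (use c(1)[of n] in auto)
      then show ?thesis using \<open>0 < e\<close> by simp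
    qed
    then show "\<exists>no. \<forall>n\<ge>no. norm (A n (c n) - m \<tau>) < e" by blast
  qed
  have L1: "(\<lambda>n. A n (s + h n) - A n (t - 2 * h n)) \<longlonglongrightarrow> m s - m t"
  proof (intro tendsto_diff Alim)
    fix n r
    show "0 \<le> s + h n \<and> s + h n + h n \<le> T" "0 \<le> t - 2 * h n \<and> t - 2 * h n + h n \<le> T"
      using h[of n] st by auto
    show "\<bar>r - s\<bar> \<le> 2 * h n" if "r \<in> {s + h n..s + h n + h n}" using that h[of n] by auto
    show "\<bar>r - t\<bar> \<le> 2 * h n" if "r \<in> {t - 2 * h n..t - 2 * h n + h n}" using that h[of n] by auto
  qed (use st in auto)
  have L2: "(\<lambda>n. LINT r|lebesgue_on {0<..<T}. \<phi> n r * k r)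
      \<longlonglongrightarrow> (LINT r|lebesgue_on {0<..<T}. indicator {s<..<t} r * k r)"
  proof (rule integral_dominated_convergence[where w = "\<lambda>r. \<bar>k r\<bar>"])
    have [measurable]: "k \<in> borel_measurable (lebesgue_on {0<..<T})" using k by auto
    have "(indicator {s<..<t} :: real \<Rightarrow> real) \<in> borel_measurable (lebesgue_on {0<..<T})"
      by (rule measurable_restrict_space1) (simp add: measurable_completion)
    then show "(\<lambda>r. indicator {s<..<t} r * k r) \<in> borel_measurable (lebesgue_on {0<..<T})" by simp
    have "continuous_on UNIV (\<phi> n)" for n using der by (intro continuous_at_imp_continuous_on ballI DERIV_isCont) auto
    then have [measurable]: "\<phi> n \<in> borel_measurable borel" for n by (rule borel_measurable_continuous_onI)
    have "\<phi> n \<in> borel_measurable (lebesgue_on {0<..<T})" for n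
      by (rule measurable_restrict_space1) (simp add: measurable_completion)
    then show "(\<lambda>r. \<phi> n r * k r) \<in> borel_measurable (lebesgue_on {0<..<T})" for n by simp
    show "AE r in lebesgue_on {0<..<T}. norm (\<phi> n r * k r) \<le> \<bar>k r\<bar>" for n
    proof (rule AE_I2)
      fix r
      have "\<bar>\<phi> n r\<bar> \<le> 1"
        using smoothstep_bounds[of "(r - (s + h n)) / h n"] smoothstep_bounds[of "(r - (t - 2 * h n)) / h n"]
        unfolding \<phi>_def by linarith
      then show "norm (\<phi> n r * k r) \<le> \<bar>k r\<bar>" by (simp add: abs_mult mult_left_le_one_le)
    qed
    show "AE r in lebesgue_on {0<..<T}. (\<lambda>n. \<phi> n r * k r) \<longlonglongrightarrow> indicator {s<..<t} r * k r"
    proof (rule AE_I2, rule tendsto_mult_right)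
      fix r
      show "(\<lambda>n. \<phi> n r) \<longlonglongrightarrow> indicator {s<..<t} r"
      proof (cases "r \<in> {s<..<t}")
        case True
        have "eventually (\<lambda>n. h n < min (r - s) (t - r) / 2) sequentially"
          by (rule order_tendstoD(2)[OF hlim]) (use True in auto)
        then have "eventually (\<lambda>n. \<phi> n r = 1) sequentially"
        proof (rule eventually_mono)
          fix n assume "h n < min (r - s) (t - r) / 2"
          then have "1 \<le> (r - (s + h n)) / h n" "(r - (t - 2 * h n)) / h n \<le> 0"
            using h(1)[of n] by (auto simp: le_divide_eq divide_le_0_iff)
          then show "\<phi> n r = 1" by (simp add: \<phi>_def smoothstep_ge_1 smoothstep_le_0)
        qed
        then show ?thesis using True by (simp add: tendsto_eventually)
      next
        case False
        then have "\<phi> n r = 0" for n using out[of r n] h(1)[of n] by auto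
        then show ?thesis using False by simp
      qed
    qed
  qed (use k in auto)
  have "(\<lambda>n. - (LINT r|lebesgue_on {0<..<T}. \<phi> n r * k r)) \<longlonglongrightarrow> m s - m t"
    using L1 unfolding LA[symmetric] eq .
  with tendsto_minus[OF L2] have "m s - m t = - (LINT r|lebesgue_on {0<..<T}. indicator {s<..<t} r * k r)"
    using LIMSEQ_unique by blast
  also have "(LINT r|lebesgue_on {0<..<T}. indicator {s<..<t} r * k r) = integral {s..t} k"
  proof -
    have "(LINT r|lebesgue_on {0<..<T}. indicator {s<..<t} r * k r)
        = (LINT r|lebesgue_on {0<..<T} . (if r \<in> {s<..<t} then k r else 0))"
      by (rule Bochner_Integration.integral_cong) auto
    also have "\<dots> = integral {0<..<T} (\<lambda>r. if r \<in> {s<..<t} then k r else 0)"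
    proof (rule lebesgue_integral_eq_integral)
      have "integrable (lebesgue_on {0<..<T}) (\<lambda>r. indicator {s<..<t} r *\<^sub>R k r)"
      proof (rule integrable_mult_indicator[OF _ k])
        show "{s<..<t} \<in> sets (lebesgue_on {0<..<T})"
          by (subst sets_restrict_space_iff) (use st in auto)
      qed
      then show "integrable (lebesgue_on {0<..<T}) (\<lambda>r. if r \<in> {s<..<t} then k r else 0)"
        unfolding indicator_scaleR_eq_if .
    qed auto
    also have "\<dots> = integral ({s<..<t} \<inter> {0<..<T}) k"
      by (rule integral_restrict_Int)
    also have "{s<..<t} \<inter> {0<..<T} = {s<..<t}" using st by auto
    also have "integral {s<..<t} k = integral {s..t} k" by (simp add: integral_open_interval_real)
    finally show ?thesis .
  qed
  finally show ?thesis by simp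
qed simp

section \<open>Fubini for Lebesgue measure on rectangles\<close>

text \<open>\<open>P\<close> is not assumed measurable, whereas exchanging the order of the two
  variables requires a measurable set. A measurable null set \<open>Z\<close> covering the
  exceptions is therefore exchanged instead.\<close>

lemma AE_lborel_prod_swap:
  assumes "AE z in lborel :: (real \<times> real) measure. P z"
  shows "AE x in lborel. AE y in lborel. P (x, y)" and "AE y in lborel. AE x in lborel. P (x, y)"
proof -
  have "AE z in lborel \<Otimes>\<^sub>M lborel. P z" unfolding lborel_prod by (rule assms)
  then obtain Z where Z: "Z \<in> null_sets (lborel \<Otimes>\<^sub>M lborel :: (real \<times> real) measure)"
      "{z \<in> space (lborel \<Otimes>\<^sub>M lborel). \<not> P z} \<subseteq> Z"
    by (auto simp: eventually_ae_filter)
  have PZ: "P z" if "z \<notin> Z" for z using Z(2) that by (auto simp: space_pair_measure)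
  have "AE z in lborel \<Otimes>\<^sub>M lborel. z \<notin> Z" by (rule AE_not_in[OF Z(1)])
  from lborel_pair.AE_pair[OF this]
  have 1: "AE x in lborel. AE y in lborel. (x, y) \<notin> Z" .
  have "{z \<in> space (lborel \<Otimes>\<^sub>M lborel). (fst z, snd z) \<notin> Z} = space (lborel \<Otimes>\<^sub>M lborel) - Z"
    by auto
  then have "{z \<in> space (lborel \<Otimes>\<^sub>M lborel). (fst z, snd z) \<notin> Z} \<in> sets (lborel \<Otimes>\<^sub>M lborel)"
    by (simp only:) (rule sets.compl_sets[OF null_setsD2[OF Z(1)]])
  from lborel_pair.AE_commute[OF this] 1
  have 2: "AE y in lborel. AE x in lborel. (x, y) \<notin> Z" by simp
  show "AE x in lborel. AE y in lborel. P (x, y)" using 1 PZ by (auto elim!: eventually_mono)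
  show "AE y in lborel. AE x in lborel. P (x, y)" using 2 PZ by (auto elim!: eventually_mono)
qed

lemma AE_lebesgue_on_iff_lborel:
  fixes A :: "'a::euclidean_space set"
  assumes "A \<in> sets borel"
  shows "(AE x in lebesgue_on A. P x) \<longleftrightarrow> (AE x in lborel. x \<in> A \<longrightarrow> P x)"
  using assms by (subst AE_restrict_space_iff) (auto simp: AE_completion_iff)

lemma AE_lebesgue_on_Times:
  fixes A B :: "real set"
  assumes A: "A \<in> sets borel" and B: "B \<in> sets borel" and P: "AE z in lebesgue_on (A \<times> B). P z"
  shows "AE x in lebesgue_on A. AE y in lebesgue_on B. P (x, y)"
    and "AE y in lebesgue_on B. AE x in lebesgue_on A. P (x, y)"
proof -
  have AB: "A \<times> B \<in> sets borel" using A B by (rule borel_Times)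
  have *: "AE z in lborel. z \<in> A \<times> B \<longrightarrow> P z" using P by (simp add: AE_lebesgue_on_iff_lborel[OF AB])
  show "AE x in lebesgue_on A. AE y in lebesgue_on B. P (x, y)"
    unfolding AE_lebesgue_on_iff_lborel[OF A] AE_lebesgue_on_iff_lborel[OF B]
    using AE_lborel_prod_swap(1)[OF *] by (auto elim!: eventually_mono)
  show "AE y in lebesgue_on B. AE x in lebesgue_on A. P (x, y)"
    unfolding AE_lebesgue_on_iff_lborel[OF A] AE_lebesgue_on_iff_lborel[OF B]
    using AE_lborel_prod_swap(2)[OF *] by (auto elim!: eventually_mono)
qed

lemma lebesgue_on_borel_representative:
  fixes F :: "'a::euclidean_space \<Rightarrow> real"
  assumes F: "F \<in> borel_measurable (lebesgue_on S)" and S: "S \<in> sets borel"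
  obtains F' where "F' \<in> borel_measurable borel" "AE z in lebesgue_on S. F z = F' z"
proof -
  have "(\<lambda>z. if z \<in> S then F z else 0) \<in> borel_measurable lebesgue"
    using F S by (intro borel_measurable_if_I) auto
  then obtain F' where F': "F' \<in> borel_measurable lborel" "AE z in lborel. (if z \<in> S then F z else 0) = F' z"
    using completion_ex_borel_measurable_real by blast
  have "AE z in lebesgue_on S. F z = F' z"
    unfolding AE_lebesgue_on_iff_lborel[OF S] using F'(2) by (auto elim!: eventually_mono)
  then show thesis using that[of F'] F'(1) by simp
qed

text \<open>The converse of slicing relies on joint measurability. It is applied to a Borel
  representative of \<open>F\<close>, for which the set of good points is measurable in the product;
  the order of variables is swapped first, because the product statement takes the first variable as
  the outer one.\<close>

lemma AE_lebesgue_on_Times_nonnegI: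
  fixes A B :: "real set"
  assumes A: "A \<in> sets borel" and B: "B \<in> sets borel"
    and F: "F \<in> borel_measurable (lebesgue_on (A \<times> B))"
    and nonneg: "AE y in lebesgue_on B. AE x in lebesgue_on A. 0 \<le> F (x, y)"
  shows "AE z in lebesgue_on (A \<times> B). (0::real) \<le> F z"
proof -
  have AB: "A \<times> B \<in> sets borel" using A B by (rule borel_Times)
  obtain F' where F': "F' \<in> borel_measurable borel" "AE z in lebesgue_on (A \<times> B). F z = F' z"
    by (rule lebesgue_on_borel_representative[OF F AB])
  have "AE y in lebesgue_on B. AE x in lebesgue_on A. 0 \<le> F' (x, y)"
    using nonneg AE_lebesgue_on_Times(2)[OF A B F'(2)]
  proof eventually_elim
    case (elim y)
    show ?case using elim(1) elim(2) by eventually_elim simp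
  qed
  then have "AE y in lborel. y \<in> B \<longrightarrow> (AE x in lborel. x \<in> A \<longrightarrow> 0 \<le> F' (x, y))"
    by (simp add: AE_lebesgue_on_iff_lborel A B)
  then have ae: "AE y in lborel. AE x in lborel. (x, y) \<in> A \<times> B \<longrightarrow> 0 \<le> F' (x, y)"
    by (auto elim!: eventually_mono)
  have F'm[measurable]: "F' \<in> borel_measurable (borel \<Otimes>\<^sub>M borel)" using F'(1) by (simp add: borel_prod)
  note AB' = AB[unfolded borel_prod[symmetric], measurable]
  have S: "{z \<in> space (lborel \<Otimes>\<^sub>M lborel). z \<in> A \<times> B \<longrightarrow> 0 \<le> F' z} \<in> sets (lborel \<Otimes>\<^sub>M lborel)"
    by measurable
  then have S': "{z \<in> space (lborel \<Otimes>\<^sub>M lborel). (fst z, snd z) \<in> A \<times> B \<longrightarrow> 0 \<le> F' (fst z, snd z)} \<in> sets (lborel \<Otimes>\<^sub>M lborel)"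
    by (simp only: prod.collapse)
  have "AE x in lborel. AE y in lborel. (x, y) \<in> A \<times> B \<longrightarrow> 0 \<le> F' (x, y)"
    using lborel_pair.AE_commute[OF S'] ae by simp
  from lborel_pair.AE_pair_measure[OF S this]
  have "AE z in lborel. z \<in> A \<times> B \<longrightarrow> 0 \<le> F' z" by (simp only: lborel_prod)
  then have "AE z in lebesgue_on (A \<times> B). 0 \<le> F' z" by (simp add: AE_lebesgue_on_iff_lborel[OF AB])
  with F'(2) show ?thesis by eventually_elim simp
qed

text \<open>A function that is Lebesgue measurable on a rectangle need not be measurable for the product of the
  two Lebesgue \<open>\<sigma>\<close>-algebras, hence the passage to a representative. Time is the first variable of \<open>G\<close>,
  as it is the outer one in the integrals below.\<close>

lemma lebesgue_on_Times_representative: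
  fixes A B :: "real set"
  assumes A: "A \<in> sets borel" and B: "B \<in> sets borel"
    and F: "F \<in> borel_measurable (lebesgue_on (A \<times> B))"
  obtains G :: "real \<times> real \<Rightarrow> real" where "G \<in> borel_measurable (lebesgue_on B \<Otimes>\<^sub>M lebesgue_on A)"
    "AE t in lebesgue_on B. AE x in lebesgue_on A. F (x, t) = G (t, x)"
    "AE x in lebesgue_on A. AE t in lebesgue_on B. F (x, t) = G (t, x)"
proof -
  have AB: "A \<times> B \<in> sets borel" using A B by (rule borel_Times)
  obtain F' where F': "F' \<in> borel_measurable borel" "AE z in lebesgue_on (A \<times> B). F z = F' z"
    by (rule lebesgue_on_borel_representative[OF F AB])
  have F'm: "F' \<in> borel_measurable (borel \<Otimes>\<^sub>M borel)" using F'(1) by (simp add: borel_prod)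
  have idm: "(\<lambda>x::real. x) \<in> borel_measurable (lebesgue_on S)" for S
    using id_borel_measurable_lebesgue_on[of S] by (simp add: id_def)
  have "(\<lambda>p. (snd p, fst p)) \<in> lebesgue_on B \<Otimes>\<^sub>M lebesgue_on A \<rightarrow>\<^sub>M borel \<Otimes>\<^sub>M borel"
    by (intro measurable_Pair measurable_compose[OF measurable_snd idm] measurable_compose[OF measurable_fst idm])
  from measurable_compose[OF this F'm]
  have "(\<lambda>p. F' (snd p, fst p)) \<in> borel_measurable (lebesgue_on B \<Otimes>\<^sub>M lebesgue_on A)" .
  then show thesis
    by (rule that) (use AE_lebesgue_on_Times[OF A B F'(2)] in simp_all)
qed

section \<open>Elementary estimates in L2 of the interval, and product representatives of L2-valued
  curves\<close>

lemma norm_L2_square: "(norm_L2 h)\<^sup>2 = (LINT x|lebesgue_on Om. (h x)\<^sup>2)"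
  by (simp add: norm_L2_def)

lemma norm_L2_nonneg: "0 \<le> norm_L2 h" by (simp add: norm_L2_def)

lemma L2_integrable: "h \<in> L2 \<Longrightarrow> integrable (lebesgue_on Om) h"
  by (rule square_integrable_imp_integrable[OF finite_measure_Om]) (simp add: L2_def)

lemma L2_integrable_square: "h \<in> L2 \<Longrightarrow> integrable (lebesgue_on Om) (\<lambda>x. (h x)\<^sup>2)"
  by (simp add: L2_def square_integrable_def)

lemma L2_integrable_mult: "g \<in> L2 \<Longrightarrow> h \<in> L2 \<Longrightarrow> integrable (lebesgue_on Om) (\<lambda>x. g x * h x)"
  by (rule square_integrable_mult) (simp_all add: L2_def)

lemma L2_measurable: "h \<in> L2 \<Longrightarrow> h \<in> borel_measurable (lebesgue_on Om)"
  by (simp add: L2_def square_integrable_def)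

lemma L2_diff: assumes "g \<in> L2" "h \<in> L2" shows "(\<lambda>x. g x - h x) \<in> L2"
proof -
  have "integrable (lebesgue_on Om) (\<lambda>x. (g x)\<^sup>2 - 2 * (g x * h x) + (h x)\<^sup>2)"
    using assms by (intro Bochner_Integration.integrable_add Bochner_Integration.integrable_diff
        integrable_mult_right L2_integrable_mult L2_integrable_square)
  moreover have "(\<lambda>x. (g x - h x)\<^sup>2) = (\<lambda>x. (g x)\<^sup>2 - 2 * (g x * h x) + (h x)\<^sup>2)"
    by (simp add: power2_diff fun_eq_iff)
  moreover have "(\<lambda>x. g x - h x) \<in> borel_measurable (lebesgue_on Om)"
    by (intro borel_measurable_diff L2_measurable assms)
  ultimately show ?thesis by (simp add: L2_def square_integrable_def)
qed

lemma measure_Om: "measure (lebesgue_on Om) (space (lebesgue_on Om)) = 2"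
  by (simp add: measure_restrict_space)

text \<open>Cauchy-Schwarz on an interval of length 2, obtained by expanding the variance of
  \<open>\<bar>h\<bar>\<close>; \<open>I / 2\<close> is its mean.\<close>

lemma L1_le_norm_L2:
  assumes h: "h \<in> L2" shows "(LINT x|lebesgue_on Om. \<bar>h x\<bar>) \<le> sqrt 2 * norm_L2 h"
proof -
  interpret finite_measure "lebesgue_on Om" by (rule finite_measure_Om)
  define I where "I = (LINT x|lebesgue_on Om. \<bar>h x\<bar>)"
  have hi: "integrable (lebesgue_on Om) (\<lambda>x. \<bar>h x\<bar>)" using L2_integrable[OF h] by simp
  have "0 \<le> (LINT x|lebesgue_on Om. (\<bar>h x\<bar> - I / 2)\<^sup>2)" by simp
  also have "\<dots> = (LINT x|lebesgue_on Om. (h x)\<^sup>2 - I * \<bar>h x\<bar> + I\<^sup>2 / 4)"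
    by (rule Bochner_Integration.integral_cong) (simp_all add: power2_diff power_divide)
  also have "\<dots> = (LINT x|lebesgue_on Om. (h x)\<^sup>2) - I * I + I\<^sup>2 / 4 * 2"
    using L2_integrable_square[OF h] hi
    by (simp add: I_def measure_Om[simplified])
  finally have "I\<^sup>2 \<le> (sqrt 2 * norm_L2 h)\<^sup>2"
    by (simp add: norm_L2_square[symmetric] power_mult_distrib power2_eq_square[of I])
  then show ?thesis unfolding I_def[symmetric]
    by (rule power2_le_imp_le) (simp add: norm_L2_nonneg)
qed

text \<open>Provides an integrable function on the product of the two measure spaces, to which
  Fubini applies. Integrability comes from \<open>\<bar>v\<bar> \<le> 1 + v^2\<close> on each slice,
  where the constant 1 integrates to 2.\<close>

lemma L2_time_representative:
  assumes v: "v \<in> L2_time T L2 norm_L2"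
  obtains V :: "real \<times> real \<Rightarrow> real" where "integrable (lebesgue_on {0<..<T} \<Otimes>\<^sub>M lebesgue_on Om) V"
    "AE t in lebesgue_on {0<..<T}. AE x in lebesgue_on Om. v x t = V (t, x)"
    "AE x in lebesgue_on Om. AE t in lebesgue_on {0<..<T}. v x t = V (t, x)"
proof -
  let ?M = "lebesgue_on Om" and ?N = "lebesgue_on {0<..<T}"
  interpret M: finite_measure ?M by (rule finite_measure_Om)
  interpret N: finite_measure ?N by (rule finite_measure_lebesgue_on) auto
  interpret P: pair_sigma_finite ?N ?M ..
  have vm: "(\<lambda>(x,t). v x t) \<in> borel_measurable (lebesgue_on (QT T))"
    and vL: "AE t in ?N. (\<lambda>x. v x t) \<in> L2"
    and vi: "integrable ?N (\<lambda>t. (norm_L2 (\<lambda>x. v x t))\<^sup>2)"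
    using v by (auto simp: L2_time_def)
  obtain V where V: "V \<in> borel_measurable (?N \<Otimes>\<^sub>M ?M)"
      "AE t in ?N. AE x in ?M. v x t = V (t, x)" "AE x in ?M. AE t in ?N. v x t = V (t, x)"
    using lebesgue_on_Times_representative[OF _ _ vm] by auto
  note [measurable] = V(1)
  have sect: "AE t in ?N. integrable ?M (\<lambda>x. V (t, x)) \<and> (LINT x|?M. \<bar>V (t, x)\<bar>) \<le> 2 + (norm_L2 (\<lambda>x. v x t))\<^sup>2"
    using vL V(2) AE_space
  proof eventually_elim
    case (elim t)
    have Vm: "(\<lambda>x. V (t, x)) \<in> borel_measurable ?M" using elim(3) by simp
    have vt: "integrable ?M (\<lambda>x. v x t)" by (rule L2_integrable[OF elim(1)])
    have eq: "integrable ?M (\<lambda>x. V (t, x)) \<longleftrightarrow> integrable ?M (\<lambda>x. v x t)"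
      by (rule integrable_cong_AE) (use elim(2) vt Vm in \<open>auto elim: eventually_mono\<close>)
    have "(LINT x|?M. \<bar>V (t, x)\<bar>) = (LINT x|?M. \<bar>v x t\<bar>)"
      by (rule integral_cong_AE) (use elim(2) vt Vm in \<open>auto elim: eventually_mono\<close>)
    also have "\<dots> \<le> (LINT x|?M. 1 + (v x t)\<^sup>2)"
    proof (rule integral_mono)
      fix x
      have "2 * \<bar>v x t\<bar> \<le> 1 + (v x t)\<^sup>2"
        using sum_squares_bound[of "\<bar>v x t\<bar>" 1] by (simp add: power2_eq_square)
      then show "\<bar>v x t\<bar> \<le> 1 + (v x t)\<^sup>2" using zero_le_power2[of "v x t"] by linarith
    qed (use vt L2_integrable_square[OF elim(1)] in auto)
    also have "\<dots> = 2 + (norm_L2 (\<lambda>x. v x t))\<^sup>2"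
      using L2_integrable_square[OF elim(1)] by (simp add: norm_L2_square measure_Om[simplified])
    finally show ?case using eq vt by simp
  qed
  have "integrable (?N \<Otimes>\<^sub>M ?M) V"
  proof (rule P.Fubini_integrable)
    show "integrable ?N (\<lambda>t. LINT x|?M. norm (V (t, x)))"
    proof (rule Bochner_Integration.integrable_bound)
      show "integrable ?N (\<lambda>t. 2 + (norm_L2 (\<lambda>x. v x t))\<^sup>2)" using vi by simp
      show "(\<lambda>t. LINT x|?M. norm (V (t, x))) \<in> borel_measurable ?N" by measurable
      show "AE t in ?N. norm (LINT x|?M. norm (V (t, x))) \<le> norm (2 + (norm_L2 (\<lambda>x. v x t))\<^sup>2)"
        using sect by eventually_elim simp
    qed
    show "AE t in ?N. integrable ?M (\<lambda>x. V (t, x))" using sect by eventually_elim simp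
  qed fact
  then show thesis using that V(2,3) by blast
qed

section \<open>Weak time derivatives tested in space\<close>

lemma C_time_L2_in: "v \<in> C_time T L2 norm_L2 \<Longrightarrow> t \<in> {0..T} \<Longrightarrow> (\<lambda>x. v x t) \<in> L2"
  by (simp add: C_time_def)

lemma C_time_continuous_onI:
  fixes F :: "real \<Rightarrow> real"
  assumes v: "v \<in> C_time T X norm_L2"
    and F: "\<And>s t. s \<in> {0..T} \<Longrightarrow> t \<in> {0..T} \<Longrightarrow> \<bar>F s - F t\<bar> \<le> K * norm_L2 (\<lambda>x. v x s - v x t)"
  shows "continuous_on {0..T} F"
  unfolding continuous_on_def
proof
  fix t assume t: "t \<in> {0..T}"
  have lim: "((\<lambda>s. norm_L2 (\<lambda>x. v x s - v x t)) \<longlongrightarrow> 0) (at t within {0..T})"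
    using v t by (simp add: C_time_def)
  have "((\<lambda>s. F s - F t) \<longlongrightarrow> 0) (at t within {0..T})"
  proof (rule Lim_null_comparison)
    show "((\<lambda>s. K * norm_L2 (\<lambda>x. v x s - v x t)) \<longlongrightarrow> 0) (at t within {0..T})"
      using tendsto_mult_left[OF lim, of K] by simp
    show "\<forall>\<^sub>F s in at t within {0..T}. norm (F s - F t) \<le> K * norm_L2 (\<lambda>x. v x s - v x t)"
      unfolding eventually_at_filter by (rule always_eventually) (use F t in auto)
  qed
  then show "(F \<longlongrightarrow> F t) (at t within {0..T})" by (simp add: LIM_zero_iff)
qed

lemma integrable_bounded_mult_L2:
  assumes "\<psi> \<in> borel_measurable (lebesgue_on Om)" "\<And>x. \<bar>\<psi> x\<bar> \<le> B" "h \<in> L2"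
  shows "integrable (lebesgue_on Om) (\<lambda>x. \<psi> x * h x)"
  by (rule square_integrable_bounded_mult[OF finite_measure_Om _ assms(1,2)])
    (use assms(3) in \<open>simp add: L2_def\<close>)

lemma tested_bound:
  assumes \<psi>: "\<psi> \<in> borel_measurable (lebesgue_on Om)" "\<And>x. \<bar>\<psi> x\<bar> \<le> B" and h: "h \<in> L2"
  shows "\<bar>LINT x|lebesgue_on Om. \<psi> x * h x\<bar> \<le> B * (sqrt 2 * norm_L2 h)"
proof -
  have B: "B \<ge> 0" using \<psi>(2)[of 0] by linarith
  have "\<bar>LINT x|lebesgue_on Om. \<psi> x * h x\<bar> \<le> (LINT x|lebesgue_on Om. \<bar>\<psi> x * h x\<bar>)"
    by (rule integral_abs_bound)
  also have "\<dots> \<le> (LINT x|lebesgue_on Om. B * \<bar>h x\<bar>)"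
  proof (rule integral_mono)
    show "integrable (lebesgue_on Om) (\<lambda>x. \<bar>\<psi> x * h x\<bar>)"
      by (rule integrable_abs[OF integrable_bounded_mult_L2[OF \<psi> h]])
    show "integrable (lebesgue_on Om) (\<lambda>x. B * \<bar>h x\<bar>)"
      by (intro integrable_mult_right integrable_abs L2_integrable h)
    show "\<bar>\<psi> x * h x\<bar> \<le> B * \<bar>h x\<bar>" for x
      using \<psi>(2)[of x] by (simp add: abs_mult mult_right_mono)
  qed
  also have "\<dots> = B * (LINT x|lebesgue_on Om. \<bar>h x\<bar>)" by simp
  also have "\<dots> \<le> B * (sqrt 2 * norm_L2 h)" by (intro mult_left_mono L1_le_norm_L2 h B)
  finally show ?thesis .
qed

text \<open>Completeness of Lebesgue measure. Slices of a curve in time are only known to agree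
  almost everywhere with slices of its product representative, and inherit measurability this
  way.\<close>

lemma borel_measurable_lebesgue_on_AE:
  fixes f g :: "real \<Rightarrow> real"
  assumes f: "f \<in> borel_measurable (lebesgue_on S)" and S: "S \<in> sets lebesgue"
    and ae: "AE x in lebesgue_on S. g x = f x"
  shows "g \<in> borel_measurable (lebesgue_on S)"
proof (rule borel_measurable_if_D)
  show "(\<lambda>x. if x \<in> S then g x else 0) \<in> borel_measurable lebesgue"
  proof (rule borel_measurable_AE)
    show "(\<lambda>x. if x \<in> S then f x else 0) \<in> borel_measurable lebesgue"
      by (rule borel_measurable_if_I[OF f S])
    have "AE x in lebesgue. x \<in> S \<longrightarrow> g x = f x"
      using ae S by (subst (asm) AE_restrict_space_iff) auto
    then show "AE x in lebesgue. (if x \<in> S then f x else 0) = (if x \<in> S then g x else 0)"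
      by eventually_elim simp
  qed
qed

lemma Fubini_tested:
  fixes V :: "real \<times> real \<Rightarrow> real"
  assumes V: "integrable (lebesgue_on {0<..<T} \<Otimes>\<^sub>M lebesgue_on Om) V"
    and \<psi>: "\<psi> \<in> borel_measurable (lebesgue_on Om)" "\<And>x. \<bar>\<psi> x\<bar> \<le> B"
    and \<eta>: "continuous_on UNIV \<eta>"
  shows "(LINT t|lebesgue_on {0<..<T}. \<eta> t * (LINT x|lebesgue_on Om. \<psi> x * V (t, x)))
       = (LINT x|lebesgue_on Om. \<psi> x * (LINT t|lebesgue_on {0<..<T}. \<eta> t * V (t, x)))"
proof -
  let ?M = "lebesgue_on Om" and ?N = "lebesgue_on {0<..<T}"
  interpret M: finite_measure ?M by (rule finite_measure_Om)
  interpret N: finite_measure ?N by (rule finite_measure_lebesgue_on) auto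
  interpret P: pair_sigma_finite ?N ?M ..
  have "continuous_on {0..T} \<eta>" using \<eta> continuous_on_subset by blast
  then have "bounded (\<eta> ` {0..T})" by (intro compact_imp_bounded compact_continuous_image) auto
  then obtain K where K: "\<And>t. t \<in> {0..T} \<Longrightarrow> \<bar>\<eta> t\<bar> \<le> K"
    unfolding bounded_iff by fastforce
  have B: "B \<ge> 0" using \<psi>(2)[of 0] by linarith
  have \<eta>m: "\<eta> \<in> borel_measurable ?N"
    by (rule measurable_restrict_space1)
      (use borel_measurable_continuous_onI[OF \<eta>] in \<open>simp add: measurable_completion\<close>)
  note [measurable] = \<psi>(1) \<eta>m borel_measurable_integrable[OF V]
  have "integrable (?N \<Otimes>\<^sub>M ?M) (\<lambda>p. \<eta> (fst p) * (\<psi> (snd p) * V p))"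
  proof (rule Bochner_Integration.integrable_bound)
    show "integrable (?N \<Otimes>\<^sub>M ?M) (\<lambda>p. K * (B * V p))" using V by simp
    show "AE p in ?N \<Otimes>\<^sub>M ?M. norm (\<eta> (fst p) * (\<psi> (snd p) * V p)) \<le> norm (K * (B * V p))"
    proof (rule AE_I2)
      fix p :: "real \<times> real" assume "p \<in> space (?N \<Otimes>\<^sub>M ?M)"
      then have p: "fst p \<in> {0..T}" by (auto simp: space_pair_measure)
      have "\<bar>\<eta> (fst p)\<bar> * (\<bar>\<psi> (snd p)\<bar> * \<bar>V p\<bar>) \<le> K * (B * \<bar>V p\<bar>)"
        using K[OF p] \<psi>(2)[of "snd p"] B order_trans[OF abs_ge_zero K[OF p]]
        by (intro mult_mono) auto
      also have "\<dots> \<le> \<bar>K\<bar> * (\<bar>B\<bar> * \<bar>V p\<bar>)" by (intro mult_mono) (use B in auto)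
      finally show "norm (\<eta> (fst p) * (\<psi> (snd p) * V p)) \<le> norm (K * (B * V p))"
        by (simp add: abs_mult)
    qed
  qed measurable
  then have *: "integrable (?N \<Otimes>\<^sub>M ?M) (case_prod (\<lambda>t x. \<eta> t * (\<psi> x * V (t, x))))"
    by (simp add: case_prod_unfold)
  have "(LINT t|?N. \<eta> t * (LINT x|?M. \<psi> x * V (t, x))) = (LINT t|?N. LINT x|?M. \<eta> t * (\<psi> x * V (t, x)))"
    by simp
  also have "\<dots> = (LINT x|?M. LINT t|?N. \<eta> t * (\<psi> x * V (t, x)))"
    by (rule P.Fubini_integral[OF *, symmetric])
  also have "\<dots> = (LINT x|?M. \<psi> x * (LINT t|?N. \<eta> t * V (t, x)))"
    by (subst mult.left_commute) simp
  finally show ?thesis .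
qed

lemma integrable_tested:
  fixes V :: "real \<times> real \<Rightarrow> real"
  assumes V: "integrable (lebesgue_on {0<..<T} \<Otimes>\<^sub>M lebesgue_on Om) V"
    and \<psi>: "\<psi> \<in> borel_measurable (lebesgue_on Om)" "\<And>x. \<bar>\<psi> x\<bar> \<le> B"
  shows "integrable (lebesgue_on {0<..<T}) (\<lambda>t. LINT x|lebesgue_on Om. \<psi> x * V (t, x))"
proof -
  let ?M = "lebesgue_on Om" and ?N = "lebesgue_on {0<..<T}"
  interpret M: finite_measure ?M by (rule finite_measure_Om)
  interpret N: finite_measure ?N by (rule finite_measure_lebesgue_on) auto
  interpret P: pair_sigma_finite ?N ?M ..
  note [measurable] = \<psi>(1) borel_measurable_integrable[OF V]
  have "integrable (?N \<Otimes>\<^sub>M ?M) (\<lambda>p. \<psi> (snd p) * V p)"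
  proof (rule Bochner_Integration.integrable_bound)
    show "integrable (?N \<Otimes>\<^sub>M ?M) (\<lambda>p. B * V p)" using V by simp
    have B: "B \<ge> 0" using \<psi>(2)[of 0] by linarith
    show "AE p in ?N \<Otimes>\<^sub>M ?M. norm (\<psi> (snd p) * V p) \<le> norm (B * V p)"
      using \<psi>(2) B by (intro AE_I2) (simp add: abs_mult mult_right_mono)
  qed measurable
  from P.integrable_fst'[OF this] show ?thesis by simp
qed

text \<open>For fixed \<open>\<psi>\<close> the pairing with \<open>v\<close> is a scalar function,
  continuous by L2 continuity of the curve. Multiplying the weak identity by \<open>\<psi>\<close>
  and integrating in x, Fubini identifies its weak derivative, and the scalar fundamental theorem
  gives the identity at every pair of times.\<close>

lemma tested_weak_time_deriv:
  assumes v: "v \<in> C_time T L2 norm_L2" and weak: "has_weak_time_deriv T v g"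
    and V: "integrable (lebesgue_on {0<..<T} \<Otimes>\<^sub>M lebesgue_on Om) V"
      "AE t in lebesgue_on {0<..<T}. AE x in lebesgue_on Om. v x t = V (t, x)"
      "AE x in lebesgue_on Om. AE t in lebesgue_on {0<..<T}. v x t = V (t, x)"
    and G: "integrable (lebesgue_on {0<..<T} \<Otimes>\<^sub>M lebesgue_on Om) G"
      "AE x in lebesgue_on Om. AE t in lebesgue_on {0<..<T}. g x t = G (t, x)"
    and \<psi>: "\<psi> \<in> borel_measurable (lebesgue_on Om)" "\<And>x. \<bar>\<psi> x\<bar> \<le> B"
    and st: "0 \<le> s" "s \<le> t" "t \<le> T"
  shows "(LINT x|lebesgue_on Om. \<psi> x * (v x t - v x s))
       = integral {s..t} (\<lambda>r. LINT x|lebesgue_on Om. \<psi> x * G (r, x))"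
proof -
  let ?M = "lebesgue_on Om" and ?N = "lebesgue_on {0<..<T}"
  define m where "m = (\<lambda>r. LINT x|?M. \<psi> x * v x r)"
  have mdiff: "m r - m q = (LINT x|?M. \<psi> x * (v x r - v x q))" if "r \<in> {0..T}" "q \<in> {0..T}" for r q
    unfolding m_def right_diff_distrib
    by (intro Bochner_Integration.integral_diff[symmetric] integrable_bounded_mult_L2[OF \<psi>]
        C_time_L2_in[OF v] that)
  have mc: "continuous_on {0..T} m"
  proof (rule C_time_continuous_onI[OF v, where K = "B * sqrt 2"])
    fix r q assume rq: "r \<in> {0..T}" "q \<in> {0..T}"
    show "\<bar>m r - m q\<bar> \<le> B * sqrt 2 * norm_L2 (\<lambda>x. v x r - v x q)"
      using tested_bound[OF \<psi> L2_diff[OF C_time_L2_in[OF v rq(1)] C_time_L2_in[OF v rq(2)]]]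
      by (simp add: mdiff[OF rq] mult.assoc)
  qed
  interpret M: finite_measure ?M by (rule finite_measure_Om)
  interpret N: finite_measure ?N by (rule finite_measure_lebesgue_on) auto
  interpret P: pair_sigma_finite ?N ?M ..
  note [measurable] = \<psi>(1) borel_measurable_integrable[OF V(1)]
  have mV: "AE r in ?N. m r = (LINT x|?M. \<psi> x * V (r, x))"
    using V(2) AE_space
  proof eventually_elim
    case (elim r)
    have [measurable]: "(\<lambda>x. V (r, x)) \<in> borel_measurable ?M" using elim(2) by simp
    have [measurable]: "(\<lambda>x. v x r) \<in> borel_measurable ?M"
      by (rule L2_measurable[OF C_time_L2_in[OF v]]) (use elim(2) in auto)
    show ?case unfolding m_def
      by (rule integral_cong_AE) (use elim(1) in \<open>auto elim: eventually_mono\<close>)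
  qed
  have cont_meas: "m \<in> borel_measurable ?N"
    by (rule borel_measurable_integrable[OF continuous_on_integrable_lebesgue_on_Ioo[OF mc]])
  have "m t - m s = integral {s..t} (\<lambda>r. LINT x|?M. \<psi> x * G (r, x))"
  proof (rule weak_derivative_fundamental_theorem[OF mc integrable_tested[OF G(1) \<psi>] _ st])
    fix \<phi> :: "real \<Rightarrow> real"
    assume C1: "\<phi> C1_differentiable_on UNIV"
      and supp: "\<exists>c d. 0 < c \<and> d < T \<and> (\<forall>t. t \<notin> {c..d} \<longrightarrow> \<phi> t = 0)"
    obtain D where D: "\<And>x. (\<phi> has_real_derivative D x) (at x)" "continuous_on UNIV D"
      using C1 by (auto simp: C1_differentiable_on_def has_real_derivative_iff_has_vector_derivative)
    have dD: "deriv \<phi> = D" using DERIV_imp_deriv[OF D(1)] by auto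
    have \<phi>c: "continuous_on UNIV \<phi>"
      by (intro continuous_at_imp_continuous_on ballI DERIV_isCont[OF D(1)])
    have meas: "\<eta> \<in> borel_measurable ?N" if "continuous_on UNIV \<eta>" for \<eta> :: "real \<Rightarrow> real"
      by (rule measurable_restrict_space1)
        (use borel_measurable_continuous_onI[OF that] in \<open>simp add: measurable_completion\<close>)
    note [measurable] = meas[OF D(2)] meas[OF \<phi>c] cont_meas
    have "(LINT r|?N. deriv \<phi> r * m r) = (LINT r|?N. D r * (LINT x|?M. \<psi> x * V (r, x)))"
      unfolding dD by (rule integral_cong_AE) (use mV in \<open>auto elim: eventually_mono\<close>)
    also have "\<dots> = (LINT x|?M. \<psi> x * (LINT r|?N. D r * V (r, x)))"
      by (rule Fubini_tested[OF V(1) \<psi> D(2)])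
    also have "\<dots> = (LINT x|?M. \<psi> x * - (LINT r|?N. \<phi> r * G (r, x)))"
    proof (rule integral_cong_AE)
      note [measurable] = borel_measurable_integrable[OF G(1)]
      show "(\<lambda>x. \<psi> x * (LINT r|?N. D r * V (r, x))) \<in> borel_measurable ?M" by measurable
      show "(\<lambda>x. \<psi> x * - (LINT r|?N. \<phi> r * G (r, x))) \<in> borel_measurable ?M" by measurable
      \<comment> \<open>The null set of points \<open>x\<close> may depend on \<open>\<phi>\<close>,
        which is harmless because \<open>\<phi>\<close> is fixed before integrating in
        \<open>x\<close>.\<close>
      have "AE x in ?M. (LINT r|?N. deriv \<phi> r * v x r) = - (LINT r|?N. \<phi> r * g x r)"
        using weak[unfolded has_weak_time_deriv_def] C1 supp by blast
      then show "AE x in ?M. \<psi> x * (LINT r|?N. D r * V (r, x)) = \<psi> x * - (LINT r|?N. \<phi> r * G (r, x))"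
        using V(3) G(2) AE_space
      proof eventually_elim
        case (elim x)
        have [measurable]: "(\<lambda>r. V (r, x)) \<in> borel_measurable ?N" "(\<lambda>r. G (r, x)) \<in> borel_measurable ?N"
          using elim(4) by simp_all
        have [measurable]: "(\<lambda>r. v x r) \<in> borel_measurable ?N" "(\<lambda>r. g x r) \<in> borel_measurable ?N"
          by (rule borel_measurable_lebesgue_on_AE[OF _ _ elim(2)]; simp)
            (rule borel_measurable_lebesgue_on_AE[OF _ _ elim(3)]; simp)
        have "(LINT r|?N. D r * V (r, x)) = (LINT r|?N. D r * v x r)"
          by (rule integral_cong_AE) (use elim(2) in \<open>auto elim: eventually_mono\<close>)
        moreover have "(LINT r|?N. \<phi> r * G (r, x)) = (LINT r|?N. \<phi> r * g x r)"
          by (rule integral_cong_AE) (use elim(3) in \<open>auto elim: eventually_mono\<close>)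
        ultimately show ?case using elim(1) by (simp add: dD)
      qed
    qed
    also have "\<dots> = - (LINT x|?M. \<psi> x * (LINT r|?N. \<phi> r * G (r, x)))" by simp
    also have "\<dots> = - (LINT r|?N. \<phi> r * (LINT x|?M. \<psi> x * G (r, x)))"
      using Fubini_tested[OF G(1) \<psi> \<phi>c] by simp
    finally show "(LINT r|?N. deriv \<phi> r * m r) = - (LINT r|?N. \<phi> r * (LINT x|?M. \<psi> x * G (r, x)))" .
  qed
  then show ?thesis using mdiff[of t s] st by simp
qed

section \<open>The energy inequality\<close>

lemma penalty_le_abs: "penalty x \<le> \<bar>x\<bar>"
  using penalty_lipschitz[of x 0] penalty_nonneg[of x] by (simp add: penalty_def)

lemma integrable_penalty:
  assumes "u \<in> L2" shows "integrable (lebesgue_on Om) (\<lambda>x. penalty (- u x))"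
proof (rule Bochner_Integration.integrable_bound[OF L2_integrable[OF assms]])
  have [measurable]: "u \<in> borel_measurable (lebesgue_on Om)" by (rule L2_measurable[OF assms])
  show "(\<lambda>x. penalty (- u x)) \<in> borel_measurable (lebesgue_on Om)" by measurable
  show "AE x in lebesgue_on Om. norm (penalty (- u x)) \<le> norm (u x)"
    using penalty_le_abs penalty_nonneg by (intro AE_I2) (metis abs_minus_cancel abs_of_nonneg real_norm_def)
qed

lemma dpenalty_compose_measurable:
  assumes "u \<in> L2" shows "(\<lambda>x. dpenalty (- u x)) \<in> borel_measurable (lebesgue_on Om)"
proof -
  have [measurable]: "u \<in> borel_measurable (lebesgue_on Om)" by (rule L2_measurable[OF assms])
  show ?thesis by measurable
qed

lemma dpenalty_abs_le_1: "\<bar>dpenalty x\<bar> \<le> 1" using dpenalty_bounds[of x] by simp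

text \<open>The equation is multiplied by \<open>dpenalty (- u)\<close> at a fixed time. The flux
  term has a nonnegative integral and is dropped; the factor 3 is the constant of
  \<open>dpenalty_le_penalty\<close>.\<close>

lemma energy_dissipation:
  assumes D: "assumption_Deg a \<beta>\<^sub>0 \<beta>\<^sub>1 \<gamma>\<^sub>0 \<gamma>\<^sub>1 \<theta>" and u: "u \<in> H2a a"
    and bc: "boundary_conditions a \<beta>\<^sub>0 \<beta>\<^sub>1 \<gamma>\<^sub>0 \<gamma>\<^sub>1 u" and g: "g \<in> L2"
    and eq: "AE x in lebesgue_on Om. g x - deriv (flux a u) x = \<alpha> x * u x + F x"
    and \<alpha>: "AE x in lebesgue_on Om. \<bar>\<alpha> x\<bar> \<le> A"
    and F: "AE x in lebesgue_on Om. F x * u x \<le> \<nu> * (u x)\<^sup>2"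
    and A: "0 \<le> A" "0 \<le> \<nu>"
  shows "- (LINT x|lebesgue_on Om. dpenalty (- u x) * g x) \<le> 3 * (A + \<nu>) * (LINT x|lebesgue_on Om. penalty (- u x))"
proof -
  have uL: "u \<in> L2" using u by (simp add: H2a_def H1a_def)
  note fl = dpenalty_flux_nonneg[OF D u bc]
  have gi: "integrable (lebesgue_on Om) (\<lambda>x. dpenalty (- u x) * g x)"
    by (rule integrable_bounded_mult_L2[OF dpenalty_compose_measurable[OF uL] dpenalty_abs_le_1 g])
  note Pi = integrable_penalty[OF uL]
  have "(LINT x|lebesgue_on Om. - (dpenalty (- u x) * g x)) \<le>
      (LINT x|lebesgue_on Om. 3 * (A + \<nu>) * penalty (- u x) - dpenalty (- u x) * deriv (flux a u) x)"
  proof (rule integral_mono_AE)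
    show "integrable (lebesgue_on Om) (\<lambda>x. - (dpenalty (- u x) * g x))" using gi by simp
    show "integrable (lebesgue_on Om) (\<lambda>x. 3 * (A + \<nu>) * penalty (- u x) - dpenalty (- u x) * deriv (flux a u) x)"
      by (intro Bochner_Integration.integrable_diff integrable_mult_right Pi fl(1))
    show "AE x in lebesgue_on Om. - (dpenalty (- u x) * g x) \<le>
        3 * (A + \<nu>) * penalty (- u x) - dpenalty (- u x) * deriv (flux a u) x"
      using eq \<alpha> F
    proof eventually_elim
      case (elim x)
      \<comment> \<open>Only points with \<open>u x < 0\<close> matter. There the quadratic
        one-sided bound on \<open>F\<close> may be divided by \<open>- u x > 0\<close> and becomes
        linear.\<close>
      have "- (dpenalty (- u x) * (\<alpha> x * u x + F x)) \<le> 3 * (A + \<nu>) * penalty (- u x)"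
      proof (cases "0 \<le> u x")
        case False
        then have neg: "u x < 0" by simp
        have "- F x * (- u x) \<le> (\<nu> * (- u x)) * (- u x)" using elim(3) by (simp add: power2_eq_square)
        then have "- F x \<le> \<nu> * (- u x)" using neg by (simp only: mult_le_cancel_right)
        moreover have "- (\<alpha> x * u x) \<le> A * (- u x)"
          using mult_right_mono[of "\<alpha> x" A "- u x"] elim(2) neg by simp
        ultimately have "- (\<alpha> x * u x + F x) \<le> (A + \<nu>) * (- u x)" by (simp add: algebra_simps)
        then have "dpenalty (- u x) * - (\<alpha> x * u x + F x) \<le> dpenalty (- u x) * ((A + \<nu>) * (- u x))"
          by (rule mult_left_mono) (rule dpenalty_bounds)
        also have "\<dots> = (A + \<nu>) * ((- u x) * dpenalty (- u x))" by simp
        also have "\<dots> \<le> (A + \<nu>) * (3 * penalty (- u x))"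
        proof (rule mult_left_mono[OF dpenalty_le_penalty])
          show "0 \<le> A + \<nu>" using A by simp
        qed
        finally show ?thesis by (simp only: mult_minus_right mult.assoc mult.left_commute[of 3])
      qed (simp add: penalty_def)
      moreover have "g x = deriv (flux a u) x + (\<alpha> x * u x + F x)" using elim(1) by simp
      ultimately show ?case by (simp add: algebra_simps)
    qed
  qed
  also have "\<dots> = 3 * (A + \<nu>) * (LINT x|lebesgue_on Om. penalty (- u x))
      - (LINT x|lebesgue_on Om. dpenalty (- u x) * deriv (flux a u) x)"
    using Pi fl(1) by (subst Bochner_Integration.integral_diff) auto
  also have "\<dots> \<le> 3 * (A + \<nu>) * (LINT x|lebesgue_on Om. penalty (- u x))" using fl(2) by simp
  finally show ?thesis by simp
qed

section \<open>Comparison of integrals in time and the Gronwall inequality\<close>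

lemma integral_le_AE_Ioo:
  fixes k H :: "real \<Rightarrow> real"
  assumes k: "integrable (lebesgue_on {0<..<T}) k" and H: "H integrable_on {0..T}"
    and le: "AE r in lebesgue_on {0<..<T}. r \<in> {s..t} \<longrightarrow> k r \<le> H r" and st: "0 \<le> s" "t \<le> T"
  shows "integral {s..t} k \<le> integral {s..t} H"
proof -
  from le obtain Z where Z: "negligible Z" "\<And>r. r \<in> {0<..<T} - Z \<Longrightarrow> r \<in> {s..t} \<longrightarrow> k r \<le> H r"
    by (rule AE_lebesgue_on_negligible) auto
  \<comment> \<open>The end points join the exceptional set because the almost everywhere bound
    concerns the open interval only.\<close>
  define Z' where "Z' = Z \<union> {0, T}"
  have Z': "negligible Z'" using Z(1) by (simp add: Z'_def)
  have kT: "k integrable_on {0..T}"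
    using integrable_on_lebesgue_on[OF k] by (simp add: integrable_on_Icc_iff_Ioo)
  have ki: "k integrable_on {s..t}" "H integrable_on {s..t}"
    using integrable_on_subinterval[OF kT] integrable_on_subinterval[OF H] st by auto
  define k' where "k' = (\<lambda>r. if r \<in> Z' then H r else k r)"
  have "integral {s..t} k = integral {s..t} k'"
    by (rule integral_spike[OF Z']) (simp add: k'_def)
  also have "\<dots> \<le> integral {s..t} H"
  proof (rule integral_le)
    show "k' integrable_on {s..t}"
      by (rule integrable_spike[OF ki(1) Z']) (simp add: k'_def)
    fix r assume r: "r \<in> {s..t}"
    show "k' r \<le> H r"
    proof (cases "r \<in> Z'")
      case False
      then have "r \<in> {0<..<T} - Z" using r st by (auto simp: Z'_def)
      then show ?thesis using Z(2) r False by (simp add: k'_def)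
    qed (simp add: k'_def)
  qed (rule ki)
  finally show ?thesis .
qed

text \<open>The integrating factor is applied to the right-hand side of the hypothesis, which is
  differentiable, whereas \<open>E\<close> itself is only continuous.\<close>

lemma gronwall_integral:
  fixes E :: "real \<Rightarrow> real"
  assumes E: "continuous_on {0..T} E" and C: "0 \<le> C"
    and le: "\<And>t. t \<in> {0..T} \<Longrightarrow> E t \<le> E0 + C * integral {0..t} E" and t: "t \<in> {0..T}"
  shows "E t \<le> E0 * exp (C * t)"
proof -
  define w where "w = (\<lambda>t. (E0 + C * integral {0..t} E) * exp (- C * t))"
  have dw: "(w has_real_derivative
      (C * E r - C * (E0 + C * integral {0..r} E)) * exp (- C * r)) (at r within {0..T})" if "r \<in> {0..T}" for r
  proof -
    note d = integral_has_real_derivative[OF E that]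
    show ?thesis unfolding w_def
      by (auto intro!: derivative_eq_intros d) (simp add: algebra_simps)
  qed
  have "w t \<le> w 0"
  proof (rule DERIV_nonpos_imp_decreasing_open[of 0 t w])
    show "0 \<le> t" using t by simp
    have "continuous_on {0..T} w" by (rule DERIV_continuous_on[OF dw])
    then show "continuous_on {0..t} w" by (rule continuous_on_subset) (use t in auto)
    fix r assume r: "0 < r" "r < t"
    then have rT: "r \<in> {0..T}" using t by auto
    have "(w has_real_derivative (C * E r - C * (E0 + C * integral {0..r} E)) * exp (- C * r)) (at r)"
      using dw[OF rT] r t by (simp add: at_within_Icc_at)
    moreover have "(C * E r - C * (E0 + C * integral {0..r} E)) * exp (- C * r) \<le> 0"
      using mult_left_mono[OF le[OF rT] C] by (simp add: mult_le_0_iff)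
    ultimately show "\<exists>y. (w has_real_derivative y) (at r) \<and> y \<le> 0" by blast
  qed
  then have "(E0 + C * integral {0..t} E) * exp (- C * t) * exp (C * t) \<le> E0 * exp (C * t)"
    by (intro mult_right_mono) (auto simp: w_def)
  then have "E0 + C * integral {0..t} E \<le> E0 * exp (C * t)"
    by (simp add: mult.assoc exp_minus)
  then show ?thesis using le[OF t] by simp
qed

section \<open>Estimates for L2 curves and for the energy functional\<close>

lemma norm_L2_diff_square_le:
  assumes "g \<in> L2" "h \<in> L2" "k \<in> L2"
  shows "(norm_L2 (\<lambda>x. g x - h x))\<^sup>2 \<le> 2 * (norm_L2 (\<lambda>x. g x - k x))\<^sup>2 + 2 * (norm_L2 (\<lambda>x. h x - k x))\<^sup>2"
proof -
  note i = L2_integrable_square[OF L2_diff]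
  have "(LINT x|lebesgue_on Om. (g x - h x)\<^sup>2)
      \<le> (LINT x|lebesgue_on Om. 2 * (g x - k x)\<^sup>2 + 2 * (h x - k x)\<^sup>2)"
  proof (rule integral_mono)
    fix x
    have "0 \<le> (g x - k x + (h x - k x))\<^sup>2" by simp
    then show "(g x - h x)\<^sup>2 \<le> 2 * (g x - k x)\<^sup>2 + 2 * (h x - k x)\<^sup>2"
      by (simp add: power2_eq_square algebra_simps)
  qed (use assms in \<open>auto intro!: i\<close>)
  also have "\<dots> = 2 * (LINT x|lebesgue_on Om. (g x - k x)\<^sup>2) + 2 * (LINT x|lebesgue_on Om. (h x - k x)\<^sup>2)"
    using i[OF assms(1,3)] i[OF assms(2,3)] by simp
  finally show ?thesis by (simp add: norm_L2_square)
qed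

lemma L2_zero: "(\<lambda>x. 0) \<in> L2" by (simp add: L2_def square_integrable_def)

text \<open>Compactness of the time interval, by Bolzano's lemma. Boundedness is what makes the
  \<open>SUP\<close> in \<open>norm_BQ\<close> an actual upper bound.\<close>

lemma C_time_norm_L2_bounded:
  assumes v: "v \<in> C_time T L2 norm_L2" and T: "0 \<le> T"
  obtains K where "\<And>t. t \<in> {0..T} \<Longrightarrow> (norm_L2 (\<lambda>x. v x t))\<^sup>2 \<le> K"
proof -
  define P where "P = (\<lambda>a b. \<exists>K. \<forall>t\<in>{a..b} \<inter> {0..T}. (norm_L2 (\<lambda>x. v x t))\<^sup>2 \<le> K)"
  have "P 0 T"
    using T
  proof (induction rule: Bolzano)
    case (trans a b c)
    then obtain K1 K2 where K: "\<And>t. t \<in> {a..b} \<inter> {0..T} \<Longrightarrow> (norm_L2 (\<lambda>x. v x t))\<^sup>2 \<le> K1"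
      "\<And>t. t \<in> {b..c} \<inter> {0..T} \<Longrightarrow> (norm_L2 (\<lambda>x. v x t))\<^sup>2 \<le> K2"
      unfolding P_def by blast
    show ?case unfolding P_def
    proof (intro exI[of _ "max K1 K2"] ballI)
      fix t assume "t \<in> {a..c} \<inter> {0..T}"
      then have "t \<in> {a..b} \<inter> {0..T} \<or> t \<in> {b..c} \<inter> {0..T}" by auto
      then show "(norm_L2 (\<lambda>x. v x t))\<^sup>2 \<le> max K1 K2" using K by (metis le_max_iff_disj)
    qed
  next
    case (local \<tau>)
    then have \<tau>: "\<tau> \<in> {0..T}" by simp
    have "((\<lambda>s. norm_L2 (\<lambda>x. v x s - v x \<tau>)) \<longlongrightarrow> 0) (at \<tau> within {0..T})"
      using v \<tau> by (simp add: C_time_def)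
    then have "\<forall>\<^sub>F s in at \<tau> within {0..T}. norm_L2 (\<lambda>x. v x s - v x \<tau>) < 1"
      by (rule order_tendstoD) simp
    then obtain d where d: "d > 0" "\<And>s. s \<in> {0..T} \<Longrightarrow> s \<noteq> \<tau> \<Longrightarrow> dist s \<tau> < d \<Longrightarrow> norm_L2 (\<lambda>x. v x s - v x \<tau>) < 1"
      unfolding eventually_at by blast
    have d': "norm_L2 (\<lambda>x. v x s - v x \<tau>) \<le> 1" if "s \<in> {0..T}" "\<bar>s - \<tau>\<bar> < d" for s
      using d(2)[OF that(1)] that(2) by (cases "s = \<tau>") (auto simp: dist_real_def norm_L2_def)
    show ?case
    proof (intro exI[of _ d] conjI allI impI \<open>d > 0\<close>)
      fix a b assume ab: "a \<le> \<tau> \<and> \<tau> \<le> b \<and> b - a < d"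
      show "P a b" unfolding P_def
      \<comment> \<open>Near \<open>\<tau>\<close> the distance to \<open>v\<close> at time
        \<open>\<tau>\<close> is at most 1, and the square of a sum is at most twice the sum of
        squares.\<close>
      proof (intro exI[of _ "2 + 2 * (norm_L2 (\<lambda>x. v x \<tau>))\<^sup>2"] ballI)
        fix t assume t: "t \<in> {a..b} \<inter> {0..T}"
        then have tT: "t \<in> {0..T}" "\<bar>t - \<tau>\<bar> < d" using ab by auto
        have "(norm_L2 (\<lambda>x. v x t - v x \<tau>))\<^sup>2 \<le> 1\<^sup>2"
          by (rule power_mono[OF d'[OF tT] norm_L2_nonneg])
        then show "(norm_L2 (\<lambda>x. v x t))\<^sup>2 \<le> 2 + 2 * (norm_L2 (\<lambda>x. v x \<tau>))\<^sup>2"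
          using norm_L2_diff_square_le[OF C_time_L2_in[OF v tT(1)] L2_zero C_time_L2_in[OF v \<tau>]]
          by (simp add: norm_L2_square)
      qed
    qed
  qed
  then show thesis using that unfolding P_def by blast
qed

text \<open>Young's inequality with weight \<open>\<eta>\<close>. The form is chosen for
  \<open>g\<close> the time derivative: the right-hand side is then small with \<open>\<eta>\<close>
  and integrable in time.\<close>

lemma L2_mult_le:
  assumes h: "h \<in> L2" and g: "g \<in> L2" and \<eta>: "0 < \<eta>" "(norm_L2 h)\<^sup>2 \<le> \<eta>\<^sup>2"
  shows "(LINT x|lebesgue_on Om. \<bar>h x * g x\<bar>) \<le> \<eta> * (1 + (norm_L2 g)\<^sup>2)"
proof -
  have "(LINT x|lebesgue_on Om. \<bar>h x * g x\<bar>) \<le> (LINT x|lebesgue_on Om. (h x)\<^sup>2 / \<eta> + \<eta> * (g x)\<^sup>2)"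
  proof (rule integral_mono)
    fix x
    have "2 * \<bar>h x * g x\<bar> = 2 * (\<bar>h x\<bar> / sqrt \<eta>) * (sqrt \<eta> * \<bar>g x\<bar>)" using \<eta> by (simp add: abs_mult)
    also have "\<dots> \<le> (\<bar>h x\<bar> / sqrt \<eta>)\<^sup>2 + (sqrt \<eta> * \<bar>g x\<bar>)\<^sup>2" by (rule sum_squares_bound)
    also have "\<dots> = (h x)\<^sup>2 / \<eta> + \<eta> * (g x)\<^sup>2" using \<eta> by (simp add: power_divide power_mult_distrib)
    finally show "\<bar>h x * g x\<bar> \<le> (h x)\<^sup>2 / \<eta> + \<eta> * (g x)\<^sup>2"
      using abs_ge_zero[of "h x * g x"] by linarith
  next
    show "integrable (lebesgue_on Om) (\<lambda>x. \<bar>h x * g x\<bar>)"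
      by (intro integrable_abs L2_integrable_mult h g)
    show "integrable (lebesgue_on Om) (\<lambda>x. (h x)\<^sup>2 / \<eta> + \<eta> * (g x)\<^sup>2)"
      using L2_integrable_square[OF h] L2_integrable_square[OF g] by simp
  qed
  also have "\<dots> = (norm_L2 h)\<^sup>2 / \<eta> + \<eta> * (norm_L2 g)\<^sup>2"
    using L2_integrable_square[OF h] L2_integrable_square[OF g] by (simp add: norm_L2_square)
  also have "(norm_L2 h)\<^sup>2 / \<eta> \<le> \<eta>"
    using \<eta> by (simp add: pos_divide_le_eq power2_eq_square[of \<eta>])
  finally show ?thesis by (simp add: algebra_simps)
qed

lemma energy_lipschitz:
  assumes "g \<in> L2" "h \<in> L2"
  shows "\<bar>(LINT x|lebesgue_on Om. penalty (- g x)) - (LINT x|lebesgue_on Om. penalty (- h x))\<bar>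
       \<le> sqrt 2 * norm_L2 (\<lambda>x. g x - h x)"
proof -
  have "(LINT x|lebesgue_on Om. penalty (- g x)) - (LINT x|lebesgue_on Om. penalty (- h x))
      = (LINT x|lebesgue_on Om. penalty (- g x) - penalty (- h x))"
    by (rule Bochner_Integration.integral_diff[symmetric]) (intro integrable_penalty assms)+
  also have "\<bar>\<dots>\<bar> \<le> (LINT x|lebesgue_on Om. \<bar>penalty (- g x) - penalty (- h x)\<bar>)" by (rule integral_abs_bound)
  also have "\<dots> \<le> (LINT x|lebesgue_on Om. \<bar>g x - h x\<bar>)"
  proof (rule integral_mono)
    show "\<bar>penalty (- g x) - penalty (- h x)\<bar> \<le> \<bar>g x - h x\<bar>" for x
      using penalty_lipschitz[of "- g x" "- h x"] by simp
    show "integrable (lebesgue_on Om) (\<lambda>x. \<bar>penalty (- g x) - penalty (- h x)\<bar>)"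
      by (intro integrable_abs Bochner_Integration.integrable_diff integrable_penalty assms)
    show "integrable (lebesgue_on Om) (\<lambda>x. \<bar>g x - h x\<bar>)"
      by (intro integrable_abs L2_integrable L2_diff assms)
  qed
  also have "\<dots> \<le> sqrt 2 * norm_L2 (\<lambda>x. g x - h x)" by (intro L1_le_norm_L2 L2_diff assms)
  finally show ?thesis .
qed

lemma energy_convex:
  assumes "g \<in> L2" "h \<in> L2"
  shows "(LINT x|lebesgue_on Om. penalty (- g x)) - (LINT x|lebesgue_on Om. penalty (- h x))
       \<le> - (LINT x|lebesgue_on Om. dpenalty (- g x) * (g x - h x))"
proof -
  note i = integrable_bounded_mult_L2[OF dpenalty_compose_measurable[OF assms(1)] dpenalty_abs_le_1 L2_diff[OF assms]]
  have "(LINT x|lebesgue_on Om. penalty (- g x)) - (LINT x|lebesgue_on Om. penalty (- h x))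
      = (LINT x|lebesgue_on Om. penalty (- g x) - penalty (- h x))"
    by (rule Bochner_Integration.integral_diff[symmetric]) (intro integrable_penalty assms)+
  also have "\<dots> \<le> (LINT x|lebesgue_on Om. - (dpenalty (- g x) * (g x - h x)))"
  proof (rule integral_mono)
    show "integrable (lebesgue_on Om) (\<lambda>x. penalty (- g x) - penalty (- h x))"
      by (intro Bochner_Integration.integrable_diff integrable_penalty assms)
    show "integrable (lebesgue_on Om) (\<lambda>x. - (dpenalty (- g x) * (g x - h x)))" using i by simp
    fix x
    show "penalty (- g x) - penalty (- h x) \<le> - (dpenalty (- g x) * (g x - h x))"
      using penalty_convex[of "- g x" "- h x"] by (simp add: algebra_simps)
  qed
  finally show ?thesis by simp
qed

lemma C_time_H1a_imp_L2:
  assumes "v \<in> C_time T (H1a a) (norm_1a a)" shows "v \<in> C_time T L2 norm_L2"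
  unfolding C_time_def mem_Collect_eq
proof (intro ballI conjI)
  fix t assume t: "t \<in> {0..T}"
  then show "(\<lambda>x. v x t) \<in> L2" using assms by (simp add: C_time_def H1a_def)
  have lim: "((\<lambda>s. norm_1a a (\<lambda>x. v x s - v x t)) \<longlongrightarrow> 0) (at t within {0..T})"
    using assms t by (simp add: C_time_def)
  show "((\<lambda>s. norm_L2 (\<lambda>x. v x s - v x t)) \<longlongrightarrow> 0) (at t within {0..T})"
  proof (rule Lim_null_comparison[OF always_eventually lim], intro allI)
    fix s
    have "norm_L2 h \<le> norm_1a a h" for h
      unfolding norm_1a_def by (rule real_le_rsqrt) simp
    then show "norm (norm_L2 (\<lambda>x. v x s - v x t)) \<le> norm_1a a (\<lambda>x. v x s - v x t)"
      using norm_L2_nonneg by simp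
  qed
qed

text \<open>The growth bound at 0 gives \<open>f x t 0 = 0\<close>, because
  \<open>\<theta> \<ge> 1\<close> makes \<open>rpow 0 \<theta>\<close> vanish; then the upper
  one-sided Lipschitz bound is taken at the pair \<open>v\<close>, 0.\<close>

lemma assumption_SL_sign:
  assumes "assumption_SL T a f \<delta> \<theta> \<nu>"
  shows "AE z in lebesgue_on (QT T). \<forall>v. f (fst z) (snd z) v * v \<le> \<nu> * v\<^sup>2"
proof -
  have \<theta>: "1 \<le> \<theta>" and ae: "AE (x,t) in lebesgue_on (QT T). \<forall>v w.
       \<bar>f x t v\<bar> \<le> \<delta> * rpow \<bar>v\<bar> \<theta> \<and>
       - \<nu> * (1 + rpow \<bar>v\<bar> (\<theta> - 1) + rpow \<bar>w\<bar> (\<theta> - 1)) * (v - w)\<^sup>2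
          \<le> (f x t v - f x t w) * (v - w) \<and>
       (f x t v - f x t w) * (v - w) \<le> \<nu> * (v - w)\<^sup>2"
    using assms by (auto simp: assumption_SL_def)
  from ae show ?thesis
  proof (rule eventually_mono, intro allI)
    fix z v
    assume "case z of (x,t) \<Rightarrow> \<forall>v w.
       \<bar>f x t v\<bar> \<le> \<delta> * rpow \<bar>v\<bar> \<theta> \<and>
       - \<nu> * (1 + rpow \<bar>v\<bar> (\<theta> - 1) + rpow \<bar>w\<bar> (\<theta> - 1)) * (v - w)\<^sup>2
          \<le> (f x t v - f x t w) * (v - w) \<and>
       (f x t v - f x t w) * (v - w) \<le> \<nu> * (v - w)\<^sup>2"
    then have *: "\<And>v w. \<bar>f (fst z) (snd z) v\<bar> \<le> \<delta> * rpow \<bar>v\<bar> \<theta>"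
       "\<And>v w. (f (fst z) (snd z) v - f (fst z) (snd z) w) * (v - w) \<le> \<nu> * (v - w)\<^sup>2"
      by (auto simp: case_prod_unfold)
    have "f (fst z) (snd z) 0 = 0" using *(1)[of 0] \<theta> by (simp add: rpow_def)
    then show "f (fst z) (snd z) v * v \<le> \<nu> * v\<^sup>2" using *(2)[of v 0] by simp
  qed
qed

text \<open>The integrated inequality is additive over adjacent time intervals, so by Bolzano's lemma it suffices
  to prove it on short intervals \<open>[p, q]\<close>, up to an error \<open>\<epsilon> (1 + \<parallel>u\<^sub>t\<parallel>\<^sup>2)\<close>. There the test function is frozen at
  time \<open>q\<close>: convexity of the penalty replaces the chain rule, and \<open>L\<^sup>2\<close>-continuity in time bounds the error.\<close>

lemma strict_solution_energy:
  assumes D: "assumption_Deg a \<beta>\<^sub>0 \<beta>\<^sub>1 \<gamma>\<^sub>0 \<gamma>\<^sub>1 \<theta>" and SL: "assumption_SL T a f \<delta> \<theta> \<nu>"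
    and \<alpha>: "AE z in lebesgue_on (QT T). \<bar>\<alpha> (fst z) (snd z)\<bar> \<le> A" and A: "0 \<le> A"
    and sol: "strict_solution T a \<beta>\<^sub>0 \<beta>\<^sub>1 \<gamma>\<^sub>0 \<gamma>\<^sub>1 \<alpha> f u\<^sub>0 v" and t0: "t0 \<in> {0..T}"
  shows "(LINT x|lebesgue_on Om. penalty (- v x t0))
       \<le> (LINT x|lebesgue_on Om. penalty (- v x 0)) * exp (3 * (A + \<nu>) * t0)"
proof -
  let ?M = "lebesgue_on Om" and ?N = "lebesgue_on {0<..<T}"
  have \<nu>: "0 \<le> \<nu>" using SL by (simp add: assumption_SL_def)
  have HQ: "v \<in> HQ T a \<beta>\<^sub>0 \<beta>\<^sub>1 \<gamma>\<^sub>0 \<gamma>\<^sub>1"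
    and bc: "AE t in ?N. boundary_conditions a \<beta>\<^sub>0 \<beta>\<^sub>1 \<gamma>\<^sub>0 \<gamma>\<^sub>1 (\<lambda>x. v x t)"
    using sol by (auto simp: strict_solution_def)
  obtain g where g: "g \<in> L2_time T L2 norm_L2" "has_weak_time_deriv T v g"
    and eq: "AE (x,t) in lebesgue_on (QT T).
          g x t - deriv (flux a (\<lambda>y. v y t)) x = \<alpha> x t * v x t + f x t (v x t)"
    using sol by (auto simp: strict_solution_def)
  have vC: "v \<in> C_time T L2 norm_L2" using HQ by (intro C_time_H1a_imp_L2) (auto simp: HQ_def)
  note vL = C_time_L2_in[OF vC]
  have DA: "AE t in ?N. (\<lambda>x. v x t) \<in> H2a a"
    using HQ by (auto simp: HQ_def L2_time_def DA0_def elim: eventually_mono)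
  have gL: "AE t in ?N. (\<lambda>x. g x t) \<in> L2" and gi: "integrable ?N (\<lambda>t. (norm_L2 (\<lambda>x. g x t))\<^sup>2)"
    using g(1) by (auto simp: L2_time_def)
  have "v \<in> L2_time T L2 norm_L2" using HQ by (simp add: HQ_def H1_time_def)
  then obtain V where V: "integrable (?N \<Otimes>\<^sub>M ?M) V" "AE t in ?N. AE x in ?M. v x t = V (t, x)"
    "AE x in ?M. AE t in ?N. v x t = V (t, x)" by (rule L2_time_representative)
  obtain G where G: "integrable (?N \<Otimes>\<^sub>M ?M) G" "AE t in ?N. AE x in ?M. g x t = G (t, x)"
    "AE x in ?M. AE t in ?N. g x t = G (t, x)" by (rule L2_time_representative[OF g(1)])
  have Om: "Om \<in> sets borel" "{0<..<T} \<in> sets borel" by auto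
  note slice = AE_lebesgue_on_Times(2)[OF Om]
  define E where "E = (\<lambda>t. LINT x|?M. penalty (- v x t))"
  have Ec: "continuous_on {0..T} E"
    unfolding E_def by (rule C_time_continuous_onI[OF vC]) (rule energy_lipschitz[OF vL vL])
  define C where "C = 3 * (A + \<nu>)"
  have C: "0 \<le> C" using A \<nu> by (simp add: C_def)
  have diss: "AE r in ?N. - (LINT x|?M. dpenalty (- v x r) * g x r) \<le> C * E r"
    using DA bc gL slice[OF eq] slice[OF \<alpha>] slice[OF assumption_SL_sign[OF SL]]
  proof eventually_elim
    case (elim r)
    show ?case unfolding C_def E_def
    proof (rule energy_dissipation[OF D elim(1,2,3) _ _ _ A \<nu>])
      show "AE x in ?M. g x r - deriv (flux a (\<lambda>x. v x r)) x = \<alpha> x r * v x r + f x r (v x r)"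
        using elim(4) by simp
      show "AE x in ?M. \<bar>\<alpha> x r\<bar> \<le> A" using elim(5) by simp
      show "AE x in ?M. f x r (v x r) * v x r \<le> \<nu> * (v x r)\<^sup>2"
        using elim(6) by (rule eventually_mono) simp
    qed
  qed
  define n where "n = (\<lambda>r. 1 + (norm_L2 (\<lambda>x. g x r))\<^sup>2)"
  have nint: "n integrable_on {0..T}"
  proof -
    have "(\<lambda>t. (norm_L2 (\<lambda>x. g x t))\<^sup>2) integrable_on {0..T}"
      using integrable_on_lebesgue_on[OF gi] by (simp add: integrable_on_Icc_iff_Ioo)
    then show ?thesis unfolding n_def by (intro integrable_add) auto
  qed
  have Ei: "E integrable_on {0..T}" by (rule integrable_continuous_interval[OF Ec])
  have main: "E t - E 0 \<le> integral {0..t} (\<lambda>r. C * E r + \<epsilon> * n r)"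
    if \<epsilon>: "0 < \<epsilon>" and t: "t \<in> {0..T}" for \<epsilon> t
  proof -
    define H where "H = (\<lambda>r. C * E r + \<epsilon> * n r)"
    have Hi: "H integrable_on {0..T}"
      unfolding H_def by (intro integrable_add integrable_on_mult_right Ei nint)
    \<comment> \<open>The guards are needed because the short intervals around \<open>\<tau>\<close>
      in Bolzano's lemma may leave \<open>{0..T}\<close>.\<close>
    define P where "P = (\<lambda>s t. 0 \<le> s \<longrightarrow> t \<le> T \<longrightarrow> E t - E s \<le> integral {s..t} H)"
    have "0 \<le> t" using t by simp
    then have "P 0 t"
    proof (induction rule: Bolzano)
      case (trans p q r)
      show ?case unfolding P_def
      proof (intro impI)
        assume pr: "0 \<le> p" "r \<le> T"
        have "integral {p..q} H + integral {q..r} H = integral {p..r} H"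
          using trans pr
          by (intro Henstock_Kurzweil_Integration.integral_combine integrable_on_subinterval[OF Hi]) auto
        then show "E r - E p \<le> integral {p..r} H" using trans pr by (auto simp: P_def)
      qed
    next
      case (local \<tau>)
      then have \<tau>: "\<tau> \<in> {0..T}" using t by simp
      have "((\<lambda>s. norm_L2 (\<lambda>x. v x s - v x \<tau>)) \<longlongrightarrow> 0) (at \<tau> within {0..T})"
        using vC \<tau> by (simp add: C_time_def)
      then have "\<forall>\<^sub>F s in at \<tau> within {0..T}. norm_L2 (\<lambda>x. v x s - v x \<tau>) < \<epsilon> / 2"
        by (rule order_tendstoD) (use \<epsilon> in simp)
      then obtain d where d: "d > 0" "\<And>s. s \<in> {0..T} \<Longrightarrow> s \<noteq> \<tau> \<Longrightarrow> dist s \<tau> < d \<Longrightarrow> norm_L2 (\<lambda>x. v x s - v x \<tau>) < \<epsilon> / 2"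
        unfolding eventually_at by blast
      \<comment> \<open>Half of \<open>\<epsilon>\<close>, because times \<open>r\<close> and
        \<open>q\<close> are compared through \<open>\<tau>\<close>: twice the sum of the two
        squares is then at most \<open>\<epsilon>^2\<close>.\<close>
      have d': "(norm_L2 (\<lambda>x. v x s - v x \<tau>))\<^sup>2 \<le> (\<epsilon> / 2)\<^sup>2" if "s \<in> {0..T}" "\<bar>s - \<tau>\<bar> < d" for s
      proof -
        have "norm_L2 (\<lambda>x. v x s - v x \<tau>) \<le> \<epsilon> / 2"
          using d(2)[OF that(1)] that(2) \<epsilon> by (cases "s = \<tau>") (auto simp: dist_real_def norm_L2_def)
        then show ?thesis by (rule power_mono) (rule norm_L2_nonneg)
      qed
      show ?case
      proof (intro exI[of _ d] conjI allI impI \<open>d > 0\<close>)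
        fix p q assume pq: "p \<le> \<tau> \<and> \<tau> \<le> q \<and> q - p < d"
        show "P p q" unfolding P_def
        proof (intro impI)
          assume p0: "0 \<le> p" and qT: "q \<le> T"
          have pT: "p \<in> {0..T}" and qT': "q \<in> {0..T}" using p0 qT pq by auto
          define \<psi> where "\<psi> = (\<lambda>x. dpenalty (- v x q))"
          have \<psi>: "\<psi> \<in> borel_measurable ?M" "\<And>x. \<bar>\<psi> x\<bar> \<le> 1"
            unfolding \<psi>_def using dpenalty_compose_measurable[OF vL[OF qT']] dpenalty_abs_le_1 by auto
          have "E q - E p \<le> - (LINT x|?M. \<psi> x * (v x q - v x p))"
            unfolding E_def \<psi>_def by (rule energy_convex[OF vL[OF qT'] vL[OF pT]])
          also have "\<dots> = - integral {p..q} (\<lambda>r. LINT x|?M. \<psi> x * G (r, x))"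
            using tested_weak_time_deriv[OF vC g(2) V G(1,3) \<psi> p0 _ qT] pq by simp
          also have "\<dots> = integral {p..q} (\<lambda>r. - (LINT x|?M. \<psi> x * G (r, x)))" by simp
          also have "\<dots> \<le> integral {p..q} H"
          proof (rule integral_le_AE_Ioo[OF _ Hi _ p0 qT])
            show "integrable ?N (\<lambda>r. - (LINT x|?M. \<psi> x * G (r, x)))"
              using integrable_tested[OF G(1) \<psi>] by simp
            interpret M: finite_measure ?M by (rule finite_measure_Om)
            interpret N: finite_measure ?N by (rule finite_measure_lebesgue_on) auto
            interpret PP: pair_sigma_finite ?N ?M ..
            note [measurable] = \<psi>(1) borel_measurable_integrable[OF G(1)]
            show "AE r in ?N. r \<in> {p..q} \<longrightarrow> - (LINT x|?M. \<psi> x * G (r, x)) \<le> H r"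
              using diss gL G(2) AE_space
            proof eventually_elim
              case (elim r)
              show ?case
              proof
                assume r: "r \<in> {p..q}"
                then have rT: "r \<in> {0..T}" "\<bar>r - \<tau>\<bar> < d" "\<bar>q - \<tau>\<bar> < d" using p0 qT pq by auto
                have [measurable]: "(\<lambda>x. G (r, x)) \<in> borel_measurable ?M" using elim(4) by simp
                have [measurable]: "(\<lambda>x. g x r) \<in> borel_measurable ?M" by (rule L2_measurable[OF elim(2)])
                define \<psi>r where "\<psi>r = (\<lambda>x. dpenalty (- v x r))"
                have \<psi>r: "\<psi>r \<in> borel_measurable ?M" "\<And>x. \<bar>\<psi>r x\<bar> \<le> 1"
                  unfolding \<psi>r_def using dpenalty_compose_measurable[OF vL[OF rT(1)]] dpenalty_abs_le_1 by auto
                note i = integrable_bounded_mult_L2[OF \<psi> elim(2)] integrable_bounded_mult_L2[OF \<psi>r elim(2)]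
                have "(LINT x|?M. \<psi> x * G (r, x)) = (LINT x|?M. \<psi> x * g x r)"
                  by (rule integral_cong_AE) (use elim(3) in \<open>auto elim: eventually_mono\<close>)
                \<comment> \<open>The test function frozen at \<open>q\<close> is exchanged for the
                  one at the running time \<open>r\<close>: the first term obeys the dissipation
                  bound, the second is the cost of the exchange.\<close>
                then have "- (LINT x|?M. \<psi> x * G (r, x))
                    = - (LINT x|?M. \<psi>r x * g x r) + (LINT x|?M. \<psi>r x * g x r - \<psi> x * g x r)"
                  using i by simp
                also have "- (LINT x|?M. \<psi>r x * g x r) \<le> C * E r" using elim(1) by (simp add: \<psi>r_def)
                also have "(LINT x|?M. \<psi>r x * g x r - \<psi> x * g x r) \<le> (LINT x|?M. \<bar>(v x r - v x q) * g x r\<bar>)"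
                proof (rule integral_mono)
                  show "integrable ?M (\<lambda>x. \<psi>r x * g x r - \<psi> x * g x r)"
                    using i by (intro Bochner_Integration.integrable_diff)
                  show "integrable ?M (\<lambda>x. \<bar>(v x r - v x q) * g x r\<bar>)"
                    by (intro integrable_abs L2_integrable_mult L2_diff vL rT(1) qT' elim(2))
                  fix x
                  have "(\<psi>r x - \<psi> x) * g x r \<le> \<bar>\<psi>r x - \<psi> x\<bar> * \<bar>g x r\<bar>"
                    using abs_ge_self[of "(\<psi>r x - \<psi> x) * g x r"] by (simp add: abs_mult)
                  also have "\<dots> \<le> \<bar>v x r - v x q\<bar> * \<bar>g x r\<bar>"
                    using dpenalty_lipschitz[of "- v x r" "- v x q"]
                    by (intro mult_right_mono) (simp_all add: \<psi>r_def \<psi>_def)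
                  finally show "\<psi>r x * g x r - \<psi> x * g x r \<le> \<bar>(v x r - v x q) * g x r\<bar>"
                    by (simp only: abs_mult left_diff_distrib[of "\<psi>r x"])
                qed
                also have "\<dots> \<le> \<epsilon> * n r"
                  unfolding n_def
                proof (rule L2_mult_le[OF L2_diff[OF vL[OF rT(1)] vL[OF qT']] elim(2) \<epsilon>])
                  show "(norm_L2 (\<lambda>x. v x r - v x q))\<^sup>2 \<le> \<epsilon>\<^sup>2"
                    using norm_L2_diff_square_le[OF vL[OF rT(1)] vL[OF qT'] vL[OF \<tau>]]
                      d'[OF rT(1,2)] d'[OF qT' rT(3)] by (simp add: power_divide)
                qed
                finally show "- (LINT x|?M. \<psi> x * G (r, x)) \<le> H r" by (simp add: H_def)
              qed
            qed
          qed
          finally show "E q - E p \<le> integral {p..q} H" .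
        qed
      qed
    qed
    then show ?thesis using t by (simp add: P_def H_def)
  qed
  have "E t \<le> E 0 + C * integral {0..t} E" if t: "t \<in> {0..T}" for t
  proof (rule field_le_epsilon)
    fix e :: real assume "0 < e"
    \<comment> \<open>The \<open>+ 1\<close> keeps the divisor positive; with
      \<open>\<epsilon> = e / S\<close> the error term in \<open>main\<close> is at most
      \<open>e\<close>.\<close>
    define S where "S = \<bar>integral {0..t} n\<bar> + 1"
    have S: "0 < S" by (simp add: S_def)
    define \<epsilon> where "\<epsilon> = e / S"
    have \<epsilon>: "0 < \<epsilon>" using \<open>0 < e\<close> S by (simp add: \<epsilon>_def)
    have sub: "{0..t} \<subseteq> {0..T}" using t by simp
    have "integral {0..t} (\<lambda>r. C * E r + \<epsilon> * n r) = C * integral {0..t} E + \<epsilon> * integral {0..t} n"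
      using integrable_on_subinterval[OF Ei sub] integrable_on_subinterval[OF nint sub]
      by (subst Henstock_Kurzweil_Integration.integral_add) (auto intro: integrable_on_mult_right)
    moreover have "\<epsilon> * integral {0..t} n \<le> \<epsilon> * S" using \<epsilon> by (intro mult_left_mono) (auto simp: S_def)
    moreover have "\<epsilon> * S = e" using S by (simp add: \<epsilon>_def)
    ultimately show "E t \<le> E 0 + C * integral {0..t} E + e" using main[OF \<epsilon> t] by simp
  qed
  from gronwall_integral[OF Ec C this t0] show ?thesis by (simp add: E_def C_def)
qed

section \<open>Passage from strict to strong solutions\<close>

lemma C_time_norm_BQ_ge:
  assumes a: "\<And>x. x \<in> Om \<Longrightarrow> 0 \<le> a x" and v: "v \<in> C_time T L2 norm_L2" "u \<in> C_time T L2 norm_L2"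
    and t: "t \<in> {0..T}"
  shows "norm_L2 (\<lambda>x. v x t - u x t) \<le> norm_BQ T a (\<lambda>x t. v x t - u x t)"
proof -
  let ?w = "\<lambda>t. (norm_L2 (\<lambda>x. v x t - u x t))\<^sup>2"
  have T: "0 \<le> T" using t by simp
  obtain K1 where K1: "\<And>t. t \<in> {0..T} \<Longrightarrow> (norm_L2 (\<lambda>x. v x t))\<^sup>2 \<le> K1"
    using C_time_norm_L2_bounded[OF v(1) T] by blast
  obtain K2 where K2: "\<And>t. t \<in> {0..T} \<Longrightarrow> (norm_L2 (\<lambda>x. u x t))\<^sup>2 \<le> K2"
    using C_time_norm_L2_bounded[OF v(2) T] by blast
  have "bdd_above (?w ` {0..T})"
  proof (rule bdd_aboveI2[where M = "2 * K1 + 2 * K2"])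
    fix s assume s: "s \<in> {0..T}"
    show "?w s \<le> 2 * K1 + 2 * K2"
      using norm_L2_diff_square_le[OF C_time_L2_in[OF v(1) s] C_time_L2_in[OF v(2) s] L2_zero] K1[OF s] K2[OF s]
      by simp
  qed
  then have "?w t \<le> (SUP t\<in>{0..T}. ?w t)" by (rule cSUP_upper[OF t])
  moreover have "0 \<le> (LINT t|lebesgue_on {0<..<T}. LINT x|lebesgue_on Om. a x * (deriv (\<lambda>y. v y t - u y t) x)\<^sup>2)"
    by (intro Bochner_Integration.integral_nonneg mult_nonneg_nonneg a) auto
  ultimately show ?thesis unfolding norm_BQ_def by (intro real_le_rsqrt) linarith
qed

theorem proposition1p2:
  fixes T \<beta>\<^sub>0 \<beta>\<^sub>1 \<gamma>\<^sub>0 \<gamma>\<^sub>1 \<delta> \<theta> \<nu> :: real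
    and a u\<^sub>0 :: "real \<Rightarrow> real"
    and \<alpha> u :: "real \<Rightarrow> real \<Rightarrow> real"
    and f :: "real \<Rightarrow> real \<Rightarrow> real \<Rightarrow> real"
  assumes "T > 0"
    and "assumption_Deg a \<beta>\<^sub>0 \<beta>\<^sub>1 \<gamma>\<^sub>0 \<gamma>\<^sub>1 \<theta>"
    and "assumption_SL T a f \<delta> \<theta> \<nu>"
    and "piecewise_static T \<alpha>"
    and "u\<^sub>0 \<in> L2"
    and "AE x in lebesgue_on Om. u\<^sub>0 x \<ge> 0"
    and "strong_solution T a \<beta>\<^sub>0 \<beta>\<^sub>1 \<gamma>\<^sub>0 \<gamma>\<^sub>1 \<alpha> f u\<^sub>0 u"
  shows "AE (x,t) in lebesgue_on (QT T). u x t \<ge> 0"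
proof -
  let ?M = "lebesgue_on Om"
  note D = assms(2) and SL = assms(3)
  obtain A0 where A0: "AE z in lebesgue_on (QT T). \<bar>case z of (x,t) \<Rightarrow> \<alpha> x t\<bar> \<le> A0"
    using assms(4) by (auto simp: piecewise_static_def ess_bounded_def)
  define A where "A = \<bar>A0\<bar>"
  have \<alpha>: "AE z in lebesgue_on (QT T). \<bar>\<alpha> (fst z) (snd z)\<bar> \<le> A" and A: "0 \<le> A"
    using A0 by (auto simp: A_def elim!: eventually_mono)
  have uB: "u \<in> BQ T a" and u0: "AE x in ?M. u x 0 = u\<^sub>0 x"
    using assms(7) by (auto simp: strong_solution_def)
  obtain U where U: "\<And>k. strict_solution T a \<beta>\<^sub>0 \<beta>\<^sub>1 \<gamma>\<^sub>0 \<gamma>\<^sub>1 \<alpha> f (\<lambda>x. U k x 0) (U k)"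
    and Ulim: "(\<lambda>k. norm_BQ T a (\<lambda>x t. U k x t - u x t)) \<longlonglongrightarrow> 0"
    using assms(7) by (auto simp: strong_solution_def)
  have uC: "u \<in> C_time T L2 norm_L2" using uB by (simp add: BQ_def)
  have UC: "U k \<in> C_time T L2 norm_L2" for k
    using U[of k] by (intro C_time_H1a_imp_L2) (auto simp: strict_solution_def HQ_def)
  have a0: "0 \<le> a x" if "x \<in> Om" for x
    using D that by (intro less_imp_le) (auto simp: assumption_Deg_def)
  define E :: "(real \<Rightarrow> real \<Rightarrow> real) \<Rightarrow> real \<Rightarrow> real" where "E = (\<lambda>w t. LINT x|?M. penalty (- w x t))"
  have Elim: "(\<lambda>k. E (U k) t) \<longlonglongrightarrow> E u t" if t: "t \<in> {0..T}" for t
  proof -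
    have "(\<lambda>k. E (U k) t - E u t) \<longlonglongrightarrow> 0"
    proof (rule Lim_null_comparison[OF always_eventually], intro allI)
      fix k
      have "\<bar>E (U k) t - E u t\<bar> \<le> sqrt 2 * norm_L2 (\<lambda>x. U k x t - u x t)"
        unfolding E_def by (rule energy_lipschitz[OF C_time_L2_in[OF UC t] C_time_L2_in[OF uC t]])
      also have "\<dots> \<le> sqrt 2 * norm_BQ T a (\<lambda>x t. U k x t - u x t)"
        by (intro mult_left_mono C_time_norm_BQ_ge[OF a0 UC uC t]) auto
      finally show "norm (E (U k) t - E u t) \<le> sqrt 2 * norm_BQ T a (\<lambda>x t. U k x t - u x t)" by simp
      show "(\<lambda>k. sqrt 2 * norm_BQ T a (\<lambda>x t. U k x t - u x t)) \<longlonglongrightarrow> 0"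
        using tendsto_mult_left[OF Ulim, of "sqrt 2"] by simp
    qed
    then show ?thesis by (simp add: LIM_zero_iff)
  qed
  have E0: "E u 0 = 0"
  proof -
    have "AE x in ?M. penalty (- u x 0) = 0"
      using u0 assms(6) by eventually_elim (simp add: penalty_eq_0_iff)
    then show ?thesis unfolding E_def by (rule integral_eq_zero_AE)
  qed
  have nonneg: "AE x in ?M. 0 \<le> u x t" if t: "t \<in> {0..T}" for t
  proof -
    have 0: "0 \<in> {0..T}" using \<open>T > 0\<close> by simp
    have "E u t \<le> E u 0 * exp (3 * (A + \<nu>) * t)"
    proof (rule LIMSEQ_le[OF Elim[OF t] tendsto_mult_right[OF Elim[OF 0]]], intro exI allI impI)
      fix k
      show "E (U k) t \<le> E (U k) 0 * exp (3 * (A + \<nu>) * t)"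
        unfolding E_def by (rule strict_solution_energy[OF D SL \<alpha> A U t])
    qed
    moreover have "0 \<le> E u t" unfolding E_def by (intro Bochner_Integration.integral_nonneg penalty_nonneg)
    ultimately have "(LINT x|?M. penalty (- u x t)) = 0" using E0 by (simp add: E_def)
    then have "AE x in ?M. penalty (- u x t) = 0"
      using integrable_penalty[OF C_time_L2_in[OF uC t]]
      by (subst (asm) integral_nonneg_eq_0_iff_AE) (simp_all add: penalty_nonneg)
    then show ?thesis by eventually_elim (simp add: penalty_eq_0_iff)
  qed
  \<comment> \<open>Nonnegativity is known at each time for almost every x; the joint measurability
    built into \<open>L2_time\<close> upgrades this to almost every point of the rectangle.\<close>
  have "AE z in lebesgue_on (QT T). 0 \<le> (\<lambda>(x, t). u x t) z"
  proof (rule AE_lebesgue_on_Times_nonnegI)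
    show "(\<lambda>(x, t). u x t) \<in> borel_measurable (lebesgue_on (QT T))"
      using uB by (simp add: BQ_def L2_time_def)
    show "AE t in lebesgue_on {0<..<T}. AE x in ?M. 0 \<le> (\<lambda>(x, t). u x t) (x, t)"
    proof (rule AE_I2)
      fix t assume "t \<in> space (lebesgue_on {0<..<T})"
      then have "t \<in> {0..T}" by simp
      then show "AE x in ?M. 0 \<le> (\<lambda>(x, t). u x t) (x, t)" using nonneg by simp
    qed
  qed auto
  then show ?thesis by (simp add: case_prod_unfold)
qed

end
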